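(* Let $m,n\in\mathbb{N}$, $\nu_j\in(0,1)$ and $\lambda_j>0$ for $j=1,\dots,m$, and $c>0$. For $r\in\mathbb{N}$ and $t>0$ let $$\mathfrak{H}_r^{\nu_1,\dots,\nu_m}(t)=\sum_{j=1}^m\lambda_j^{1/\nu_j}\;{}_1H^{\nu_j}\bigl({}_2H^{\nu_j}\bigl({}_3H^{\nu_j}\bigl(\cdots{}_rH^{\nu_j}(t)\cdots\bigr)\bigr)\bigr),\qquad \mathfrak{L}_r^{\nu_1,\dots,\nu_m}(t)=\inf\bigl\{s>0:\mathfrak{H}_r^{\nu_1,\dots,\nu_m}(s)\ge t\bigr\},$$ where the ${}_kH^{\nu_j}$, $k=1,\dots,r$, $j=1,\dots,m$, are independent stable subordinators, ${}_kH^{\nu_j}$ of order $\nu_j$, and let $\mathbf{B}_n$ be an $n$-dimensional Brownian motion, independent of $\mathfrak{L}_r^{\nu_1,\dots,\nu_m}$, with $\mathbb{E}e^{i\boldsymbol{\xi}\cdot\mathbf{B}_n(t)}=e^{-t\|\boldsymbol{\xi}\|^2}$. Then the distribution of the limiting process $$\lim_{r\to\infty}\mathbf{B}_n\bigl(c^2\mathfrak{L}_r^{\nu_1,\dots,\nu_m}(t)\bigr)\stackrel{\text{law}}{=}X_{m,n}$$ (limit in law) does not depend on $t$ and reads $$\mathfrak{w}_m(\mathbf{x})=\frac{\Pr\{X_{m,n}\in d\mathbf{x}\}}{d\mathbf{x}}=\frac{1}{(2\pi)^{n/2}}\left(\frac{\sqrt{\sum_{j=1}^m\lambda_j}}{c}\right)^{\frac{n+2}{2}}\|\mathbf{x}\|^{-\frac{n-2}{2}}K_{\frac{n-2}{2}}\left(\frac{\sqrt{\sum_{j=1}^m\lambda_j}}{c}\,\|\mathbf{x}\|\right).$$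 This density solves the equation $$\Bigl(\sum_{j=1}^m\lambda_j\Bigr)\mathfrak{w}_m(x_1,\dots,x_n)=c^2\sum_{j=1}^n\frac{\partial^2}{\partial x_j^2}\mathfrak{w}_m(x_1,\dots,x_n),$$ which is obtained by letting $r\to\infty$ from the equation, taken with $\beta=1$, $$\sum_{j=1}^m\lambda_j\frac{{}^C\partial^{\nu_j^r}}{\partial t^{\nu_j^r}}\mathfrak{w}^{\beta,r}_{\nu_1,\dots,\nu_m}(\mathbf{x},t)=-c^2(-\Delta)^\beta\mathfrak{w}^{\beta,r}_{\nu_1,\dots,\nu_m}(\mathbf{x},t),\quad \mathbf{x}\in\mathbb{R}^n,\ t>0,\qquad \mathfrak{w}^{\beta,r}_{\nu_1,\dots,\nu_m}(\mathbf{x},0)=\delta(\mathbf{x}).$$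
   Context: $\nu_j^r$ denotes the $r$-th power of $\nu_j$. A stable subordinator $H^\nu(t)$, $t>0$, of order $\nu\in(0,1)$ is the nonnegative process with stationary independent increments and $\mathbb{E}e^{-\mu H^\nu(t)}=e^{-t\mu^\nu}$ for $\mu>0$. $\|\cdot\|$ is the Euclidean norm on $\mathbb{R}^n$ and $\delta$ is the Dirac delta. $K_\nu$ is the modified Bessel function of the second kind, $K_\nu(z)=\int_0^\infty e^{-z\cosh s}\cosh(\nu s)\,ds$ for $z>0$. For $\nu\in(0,1)$ the Dzerbayshan-Caputo derivative is $\frac{{}^C\partial^\nu}{\partial t^\nu}f(t)=\frac{1}{\Gamma(1-\nu)}\int_0^t\frac{f'(s)}{(t-s)^{\nu}}\,ds$. For $\beta\in(0,1]$, $-(-\Delta)^\beta$ is the operator with Fourier multiplier $-\|\boldsymbol{\xi}\|^{2\beta}$; for $\beta=1$ it is the Laplacian $\Delta=\sum_{j=1}^n\partial^2/\partial x_j^2$.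
   Formalization: The weight λ_j^{1/ν_j} is corrected to λ_j^{1/ν_j^r} (with the printed weight the claim fails, e.g. m=1, λ_1=4, where the limit has 1 in place of λ_1), and both differential equations are stated for x ≠ 0, since the densities are singular or have a kink at the origin. *)

theory Defs
  imports "HOL-Probability.Probability"
begin

text \<open>Processes are functions \<open>X :: real \<Rightarrow> 'a \<Rightarrow> 'b\<close> of time and outcome; only times
  \<open>t \<ge> 0\<close> are meaningful.\<close>

definition stationary_increments ::
  "'a measure \<Rightarrow> (real \<Rightarrow> 'a \<Rightarrow> 'b::euclidean_space) \<Rightarrow> bool" where
  "stationary_increments M X \<longleftrightarrow>
     (\<forall>s\<ge>0. \<forall>h\<ge>0. distr M borel (\<lambda>\<omega>. X (s + h) \<omega> - X s \<omega>) =
                     distr M borel (\<lambda>\<omega>. X h \<omega> - X 0 \<omega>))"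

definition independent_increments ::
  "'a measure \<Rightarrow> (real \<Rightarrow> 'a \<Rightarrow> 'b::euclidean_space) \<Rightarrow> bool" where
  "independent_increments M X \<longleftrightarrow>
     (\<forall>N (\<tau>::nat \<Rightarrow> real). 0 \<le> \<tau> 0 \<and> mono_on {..N} \<tau> \<longrightarrow>
        prob_space.indep_vars M (\<lambda>_. borel)
          (\<lambda>i \<omega>. X (\<tau> (Suc i)) \<omega> - X (\<tau> i) \<omega>) {..<N})"

text \<open>Path regularity is the usual one for Levy processes; it is required of all paths (not
  almost all), so that compositions and inverses of processes are random variables without
  completing the probability space.\<close>

definition stable_subordinator :: "'a measure \<Rightarrow> real \<Rightarrow> (real \<Rightarrow> 'a \<Rightarrow> real) \<Rightarrow> bool" where
  "stable_subordinator M \<alpha> S \<longleftrightarrow>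
     (\<forall>t\<ge>0. S t \<in> borel_measurable M) \<and>
     (\<forall>\<omega>\<in>space M. S 0 \<omega> = 0 \<and> mono_on {0..} (\<lambda>t. S t \<omega>) \<and>
        (\<forall>t\<ge>0. continuous (at_right t) (\<lambda>s. S s \<omega>))) \<and>
     stationary_increments M S \<and> independent_increments M S \<and>
     (\<forall>t>0. \<forall>\<mu>>0. (LINT \<omega>|M. exp (- \<mu> * S t \<omega>)) = exp (- t * \<mu> powr \<alpha>))"

text \<open>The normalisation is \<open>E exp (i \<xi> \<bullet> B t) = exp (- t |\<xi>|\<^sup>2)\<close>, without the factor 1/2.\<close>

definition brownian_motion :: "'a measure \<Rightarrow> (real \<Rightarrow> 'a \<Rightarrow> real ^ 'n) \<Rightarrow> bool" where
  "brownian_motion M B \<longleftrightarrow>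
     (\<forall>t\<ge>0. B t \<in> borel_measurable M) \<and>
     (\<forall>\<omega>\<in>space M. B 0 \<omega> = 0 \<and> continuous_on {0..} (\<lambda>t. B t \<omega>)) \<and>
     stationary_increments M B \<and> independent_increments M B \<and>
     (\<forall>t\<ge>0. \<forall>\<xi>. (LINT \<omega>|M. iexp (\<xi> \<bullet> B t \<omega>)) = complex_of_real (exp (- t * (norm \<xi>)\<^sup>2)))"

text \<open>\<open>iterated_subordinator S r t = S 1 (S 2 (\<dots> (S r t)))\<close>\<close>

primrec iterated_subordinator ::
  "(nat \<Rightarrow> real \<Rightarrow> 'a \<Rightarrow> real) \<Rightarrow> nat \<Rightarrow> real \<Rightarrow> 'a \<Rightarrow> real" where
  "iterated_subordinator S 0 t \<omega> = t"
| "iterated_subordinator S (Suc r) t \<omega> = iterated_subordinator S r (S (Suc r) t \<omega>) \<omega>"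

text \<open>\<open>H k j\<close> is the \<open>k\<close>-th subordinator of order \<open>\<nu> j\<close>.  The \<open>r\<close>-fold iterate is stable of
  order \<open>\<nu> j ^ r\<close>, so the weight \<open>lam j powr (1 / \<nu> j ^ r)\<close> gives the Laplace exponent
  \<open>\<Sum>j. lam j * \<mu> powr (\<nu> j ^ r)\<close>, i.e. the coefficients \<open>lam j\<close> of the fractional equation.
  (The weight \<open>lam j powr (1 / \<nu> j)\<close>, which agrees for \<open>r = 1\<close>, would give the coefficients
  \<open>lam j powr (\<nu> j ^ (r - 1))\<close>, which tend to 1.)\<close>

definition weighted_sum_process ::
  "nat \<Rightarrow> (nat \<Rightarrow> real) \<Rightarrow> (nat \<Rightarrow> real) \<Rightarrow> (nat \<Rightarrow> nat \<Rightarrow> real \<Rightarrow> 'a \<Rightarrow> real) \<Rightarrow>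
   nat \<Rightarrow> real \<Rightarrow> 'a \<Rightarrow> real" where
  "weighted_sum_process m lam \<nu> H r t \<omega> =
     (\<Sum>j=1..m. lam j powr (1 / \<nu> j ^ r) * iterated_subordinator (\<lambda>k. H k j) r t \<omega>)"

text \<open>The level \<open>t\<close> is almost surely reached; the value 0 on the remaining null event is
  arbitrary and only serves to keep the time argument nonnegative.\<close>

definition inverse_process :: "(real \<Rightarrow> 'a \<Rightarrow> real) \<Rightarrow> real \<Rightarrow> 'a \<Rightarrow> real" where
  "inverse_process S t \<omega> =
     (if \<exists>s>0. t \<le> S s \<omega> then Inf {s. 0 < s \<and> t \<le> S s \<omega>} else 0)"

text \<open>Independence of the families \<open>(X s)\<close>, \<open>s \<in> I\<close>, and \<open>(Y t)\<close>, \<open>t \<in> J\<close>, as processes.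
  This is \<open>prob_space.indep_var_eq\<close>, written out because \<open>prob_space.indep_var\<close> forces both
  variables to have the same type.\<close>

definition independent_processes ::
  "'a measure \<Rightarrow> real set \<Rightarrow> (real \<Rightarrow> 'a \<Rightarrow> 'b::euclidean_space) \<Rightarrow>
   real set \<Rightarrow> (real \<Rightarrow> 'a \<Rightarrow> 'c::euclidean_space) \<Rightarrow> bool" where
  "independent_processes M I X J Y \<longleftrightarrow>
     (\<forall>s\<in>I. X s \<in> borel_measurable M) \<and> (\<forall>t\<in>J. Y t \<in> borel_measurable M) \<and>
     prob_space.indep_set M
       (sets (vimage_algebra (space M) (\<lambda>\<omega>. \<lambda>s\<in>I. X s \<omega>) (PiM I (\<lambda>_. borel))))
       (sets (vimage_algebra (space M) (\<lambda>\<omega>. \<lambda>t\<in>J. Y t \<omega>) (PiM J (\<lambda>_. borel))))"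

definition converges_in_law ::
  "('i \<Rightarrow> 'b::euclidean_space measure) \<Rightarrow> 'b measure \<Rightarrow> 'i filter \<Rightarrow> bool" where
  "converges_in_law P Q F \<longleftrightarrow>
     (\<forall>f::'b \<Rightarrow> real. continuous_on UNIV f \<and> bounded (range f) \<longrightarrow>
        ((\<lambda>i. LINT x|P i. f x) \<longlongrightarrow> (LINT x|Q. f x)) F)"

definition bessel_K :: "real \<Rightarrow> real \<Rightarrow> real" where
  "bessel_K \<nu> z = (LINT s:{0..}|lborel. exp (- z * cosh s) * cosh (\<nu> * s))"

definition limit_density :: "nat \<Rightarrow> (nat \<Rightarrow> real) \<Rightarrow> real \<Rightarrow> real ^ 'n \<Rightarrow> real" where
  "limit_density m lam c x =
     (let n = real CARD('n); a = sqrt (\<Sum>j=1..m. lam j) / c in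
       1 / (2 * pi) powr (n / 2) * a powr ((n + 2) / 2) * norm x powr (- (n - 2) / 2) *
       bessel_K ((n - 2) / 2) (a * norm x))"

definition partial_differentiable :: "'n \<Rightarrow> (real ^ 'n \<Rightarrow> real) \<Rightarrow> real ^ 'n \<Rightarrow> bool" where
  "partial_differentiable j f x \<longleftrightarrow> (\<lambda>h. f (x + h *\<^sub>R axis j 1)) differentiable (at 0)"

definition partial_deriv :: "'n \<Rightarrow> (real ^ 'n \<Rightarrow> real) \<Rightarrow> real ^ 'n \<Rightarrow> real" where
  "partial_deriv j f x = deriv (\<lambda>h. f (x + h *\<^sub>R axis j 1)) 0"

definition has_second_partials :: "(real ^ 'n \<Rightarrow> real) \<Rightarrow> real ^ 'n \<Rightarrow> bool" where
  "has_second_partials f x \<longleftrightarrow>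
     (\<forall>j. (\<forall>\<^sub>F y in nhds x. partial_differentiable j f y) \<and>
          partial_differentiable j (partial_deriv j f) x)"

definition laplacian :: "(real ^ 'n \<Rightarrow> real) \<Rightarrow> real ^ 'n \<Rightarrow> real" where
  "laplacian f x = (\<Sum>j\<in>UNIV. partial_deriv j (partial_deriv j f) x)"

definition caputo_differentiable :: "real \<Rightarrow> (real \<Rightarrow> real) \<Rightarrow> real \<Rightarrow> bool" where
  "caputo_differentiable \<alpha> f t \<longleftrightarrow>
     (\<forall>s\<in>{0<..<t}. f differentiable (at s)) \<and>
     set_integrable lborel {0<..<t} (\<lambda>s. deriv f s / (t - s) powr \<alpha>)"

definition caputo_deriv :: "real \<Rightarrow> (real \<Rightarrow> real) \<Rightarrow> real \<Rightarrow> real" where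
  "caputo_deriv \<alpha> f t =
     1 / Gamma (1 - \<alpha>) * (LINT s:{0<..<t}|lborel. deriv f s / (t - s) powr \<alpha>)"

text \<open>Solutions \<open>u x t\<close> of
  \<open>(\<Sum>j=1..m. lam j * \<partial>\<^sup>\<alpha>\<^sup>j u / \<partial>t\<^sup>\<alpha>\<^sup>j) = c\<^sup>2 * \<Delta> u\<close> with initial value the Dirac delta.  The solutions
  of interest are singular at the origin (unbounded if \<open>n \<ge> 2\<close>, with a kink if \<open>n = 1\<close>), so the
  equation is required classically at \<open>x \<noteq> 0\<close>.  The initial condition is that \<open>u _ t\<close> tends
  to the Dirac measure at 0 weakly, and to 0 pointwise off the origin, as \<open>t\<close> decreases to 0.\<close>

definition solves_fractional_cauchy ::
  "nat \<Rightarrow> (nat \<Rightarrow> real) \<Rightarrow> (nat \<Rightarrow> real) \<Rightarrow> real \<Rightarrow> (real ^ 'n \<Rightarrow> real \<Rightarrow> real) \<Rightarrow> bool" where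
  "solves_fractional_cauchy m lam \<alpha> c u \<longleftrightarrow>
     (\<forall>x t. x \<noteq> 0 \<and> t > 0 \<longrightarrow>
        (\<forall>j\<in>{1..m}. caputo_differentiable (\<alpha> j) (u x) t) \<and>
        has_second_partials (\<lambda>y. u y t) x \<and>
        (\<Sum>j=1..m. lam j * caputo_deriv (\<alpha> j) (u x) t) = c\<^sup>2 * laplacian (\<lambda>y. u y t) x) \<and>
     converges_in_law (\<lambda>t. density lborel (\<lambda>x. ennreal (u x t))) (return borel 0) (at_right 0) \<and>
     (\<forall>x. x \<noteq> 0 \<longrightarrow> (u x \<longlongrightarrow> 0) (at_right 0))"

end

theory Submission
  imports Defs "HOL-Complex_Analysis.Complex_Analysis" "HOL-Real_Asymp.Real_Asymp"
begin

text \<open>The clock \<open>c\<^sup>2 * L r t\<close> exceeds \<open>s\<close> exactly when the subordinator at time \<open>s / c\<^sup>2\<close> is below \<open>t\<close>. That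
  subordinator has Laplace exponent \<open>(\<Sum>j=1..m. lam j * \<mu> powr \<nu> j ^ r) / c\<^sup>2\<close>, which tends to the
  constant \<open>l = (\<Sum>j=1..m. lam j) / c\<^sup>2\<close>; so the clock becomes exponential with rate \<open>l\<close>, for every \<open>t\<close>.
  Hence the law of the time-changed Brownian motion, a Gaussian mixture over the clock, tends to the
  Gaussian mixture over the exponential law. The substitution \<open>s = sqrt (b / l) * exp y\<close> in
  \<open>\<integral> exp (- l * s - b / s) * s powr - p\<close> turns its density into the Bessel function, and the heat equation
  for the Gauss kernel with one integration by parts in \<open>s\<close> gives the elliptic equation.

  For the fractional equation, the subordinator has a density \<open>dens s \<tau>\<close> by Fourier inversion of its
  characteristic function, and the clock average of \<open>g s = gauss s x\<close> has the time derivative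
  \<open>v t = \<integral> g' s * dens s t ds\<close>. Its Caputo derivatives are therefore convolutions with explicit Laplace
  transforms; their weighted sum and the clock average of \<open>g'\<close>, which is the Laplacian, have the
  same Laplace transform and agree by Lerch's theorem. The bound \<open>|v t| \<le> C / t\<close>, uniform in \<open>r\<close>, lets the
  fractional integral of order \<open>1 - \<nu> j ^ r\<close> be replaced in the limit by the plain integral.\<close>

subsection \<open>Gaussian mixtures\<close>

text \<open>Three obstacles shape the proof. The subordinators are known only through their Laplace
  transforms at positive \<mu>, and the limiting transform no longer depends on \<mu>: the mass
  gathers at 0 or escapes to infinity, so their laws have no weak limit. Their tails are squeezed
  instead between two exponential bounds, one with \<mu> near 0 and one with \<mu> large.

  The clock law is accessible only through its tails. Every average over it is therefore rewritten
  as an integral against tails, which moves the dependence on \<open>t\<close> into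
  \<open>dens\<close>.

  The bound on \<open>dens s\<close> contains a negative power of \<open>s\<close>. For
  \<open>x \<noteq> 0\<close> the function \<open>gauss s x\<close> and its derivatives in
  \<open>s\<close> vanish at 0 faster than any power and absorb it; this is where
  \<open>x \<noteq> 0\<close> enters. The constant \<kappa>, a lower bound of
  \<open>cos (pi * \<alpha> j / 2)\<close>, keeps the characteristic exponent away from the
  imaginary axis. Since \<open>\<nu> j ^ r\<close> decreases in \<open>r\<close>, the value for
  \<open>r = 1\<close> serves every \<open>r\<close>, and this gives the uniform bound on
  \<open>v\<close>.\<close>

definition gauss :: "real \<Rightarrow> 'b::euclidean_space \<Rightarrow> real" where
  "gauss s x = (if s > 0 then (4 * pi * s) powr (- (real DIM('b) / 2)) * exp (- (norm x)\<^sup>2 / (4 * s)) else 0)"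

lemma gauss_nonneg [simp]: "0 \<le> gauss s x"
  by (simp add: gauss_def)

lemma gauss_measurable [measurable]:
  assumes [measurable]: "f \<in> borel_measurable M" "g \<in> borel_measurable M"
  shows "(\<lambda>w. gauss (f w) (g w :: 'b::euclidean_space)) \<in> borel_measurable M"
  unfolding gauss_def by measurable

lemma norm_sq_eq_sum:
  fixes x :: "'b::euclidean_space"
  shows "(norm x)\<^sup>2 = (\<Sum>b\<in>Basis. (x \<bullet> b)\<^sup>2)"
  by (subst power2_norm_eq_inner, subst euclidean_inner) (simp add: power2_eq_square)

lemma gauss_eq_prod:
  fixes x :: "'b::euclidean_space"
  assumes "s > 0"
  shows "gauss s x = (\<Prod>b\<in>Basis. normal_density 0 (sqrt (2 * s)) (x \<bullet> b))"
proof -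
  have "exp (- (norm x)\<^sup>2 / (4 * s)) = (\<Prod>b\<in>Basis. exp (- (x \<bullet> b)\<^sup>2 / (4 * s)))"
    by (simp add: norm_sq_eq_sum exp_sum[symmetric] sum_negf sum_divide_distrib)
  moreover have "(4 * pi * s) powr (- (real DIM('b) / 2)) = (\<Prod>b\<in>(Basis::'b set). 1 / sqrt (4 * pi * s))"
  proof -
    have "(4 * pi * s) powr (- (real DIM('b) / 2)) = ((4 * pi * s) powr (- (1/2))) powr (real DIM('b))"
      by (simp add: powr_powr)
    also have "\<dots> = ((4 * pi * s) powr (- (1/2))) ^ DIM('b)"
      using assms by (simp add: powr_realpow)
    also have "(4 * pi * s) powr (- (1/2)) = 1 / sqrt (4 * pi * s)"
      using assms by (simp add: powr_minus powr_half_sqrt field_simps)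
    finally show ?thesis by simp
  qed
  ultimately show ?thesis
    using assms by (simp add: gauss_def normal_density_def prod_dividef power_divide mult_ac)
qed

text \<open>Rescaling the variable by \<sigma> reduces this to the characteristic function of the
  standard normal law.\<close>

lemma char_normal_density:
  assumes "\<sigma> > 0"
  shows "integrable lborel (\<lambda>y. iexp (t * y) * normal_density 0 \<sigma> y)"
    and "(LINT y|lborel. iexp (t * y) * normal_density 0 \<sigma> y) = exp (- (\<sigma>\<^sup>2 * t\<^sup>2) / 2)"
proof -
  show "integrable lborel (\<lambda>y. iexp (t * y) * normal_density 0 \<sigma> y)"
    by (rule Bochner_Integration.integrable_bound[OF integrable_normal_density[of \<sigma> 0]])
       (use assms in \<open>auto simp: norm_mult\<close>)
  have "char std_normal_distribution (t * \<sigma>) = (LINT y|lborel. std_normal_density y *\<^sub>R iexp (t * \<sigma> * y))"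
    by (simp add: char_def integral_density)
  also have "\<dots> = (LINT y|lborel. \<sigma> *\<^sub>R (normal_density 0 \<sigma> (\<sigma> * y) *\<^sub>R iexp (t * (\<sigma> * y))))"
    using assms by (intro Bochner_Integration.integral_cong)
     (auto simp: normal_density_def real_sqrt_mult field_simps scaleR_conv_of_real)
  also have "\<dots> = (LINT y|lborel. iexp (t * y) * normal_density 0 \<sigma> y)"
    using lborel_integral_real_affine[of \<sigma> "\<lambda>y. normal_density 0 \<sigma> y *\<^sub>R iexp (t * y)" 0] assms
    by (simp add: scaleR_conv_of_real mult.commute)
  finally show "(LINT y|lborel. iexp (t * y) * normal_density 0 \<sigma> y) = exp (- (\<sigma>\<^sup>2 * t\<^sup>2) / 2)"
    by (simp add: char_std_normal_distribution power_mult_distrib mult.commute)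
qed

interpretation lborel_product: product_sigma_finite "\<lambda>_::'i. lborel :: real measure" ..

text \<open>Lebesgue measure on a Euclidean space is the image of the product of the coordinate
  measures, so this is Fubini for a finite product.\<close>

lemma integral_lborel_prod:
  fixes f :: "'b::euclidean_space \<Rightarrow> real \<Rightarrow> 'c::{real_normed_field,banach,second_countable_topology}"
  assumes "\<And>b. b \<in> Basis \<Longrightarrow> integrable lborel (f b)"
  shows "integrable lborel (\<lambda>x. \<Prod>b\<in>Basis. f b (x \<bullet> b))"
    and "(LINT x|lborel. (\<Prod>b\<in>Basis. f b (x \<bullet> b))) = (\<Prod>b\<in>Basis. LINT y|lborel. f b y)"
proof -
  have [measurable]: "f b \<in> borel_measurable borel" if "b \<in> Basis" for b
    using borel_measurable_integrable[OF assms[OF that]] by simp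
  have eq: "(\<Prod>b\<in>Basis. f b ((\<Sum>c\<in>Basis. g c *\<^sub>R c) \<bullet> b)) = (\<Prod>b\<in>Basis. f b (g b))" for g :: "'b \<Rightarrow> real"
    by (intro prod.cong) auto
  show "integrable lborel (\<lambda>x. \<Prod>b\<in>Basis. f b (x \<bullet> b))"
    by (subst lborel_eq, subst integrable_distr_eq)
       (auto simp: eq intro!: lborel_product.product_integrable_prod assms)
  show "(LINT x|lborel. (\<Prod>b\<in>Basis. f b (x \<bullet> b))) = (\<Prod>b\<in>Basis. LINT y|lborel. f b y)"
    by (subst lborel_eq, subst integral_distr)
       (auto simp: eq intro!: lborel_product.product_integral_prod assms)
qed

lemma char_gauss:
  fixes \<xi> :: "'b::euclidean_space"
  assumes "s > 0"
  shows "integrable lborel (\<lambda>x. iexp (\<xi> \<bullet> x) * gauss s x)"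
    and "(LINT x|lborel. iexp (\<xi> \<bullet> x) * gauss s x) = exp (- s * (norm \<xi>)\<^sup>2)"
proof -
  have eq: "iexp (\<xi> \<bullet> x) * gauss s x =
     (\<Prod>b\<in>Basis. iexp ((\<xi> \<bullet> b) * (x \<bullet> b)) * normal_density 0 (sqrt (2 * s)) (x \<bullet> b))" for x
  proof -
    have "\<xi> \<bullet> x = (\<Sum>b\<in>Basis. (\<xi> \<bullet> b) * (x \<bullet> b))"
      by (rule euclidean_inner)
    then have "iexp (\<xi> \<bullet> x) = (\<Prod>b\<in>Basis. iexp ((\<xi> \<bullet> b) * (x \<bullet> b)))"
      by (simp add: exp_sum[symmetric] sum_distrib_left)
    then show ?thesis
      using assms by (simp add: gauss_eq_prod prod.distrib)
  qed
  have sq: "sqrt (2 * s) > 0" using assms by simp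
  note c = char_normal_density[OF sq]
  show "integrable lborel (\<lambda>x. iexp (\<xi> \<bullet> x) * gauss s x)"
    unfolding eq by (rule integral_lborel_prod(1)) (rule c(1))
  have "(LINT x|lborel. iexp (\<xi> \<bullet> x) * gauss s x) = (\<Prod>b\<in>Basis. complex_of_real (exp (- s * (\<xi> \<bullet> b)\<^sup>2)))"
  proof -
    have "(LINT x|lborel. iexp (\<xi> \<bullet> x) * gauss s x) =
      (\<Prod>b\<in>Basis. LINT y|lborel. iexp ((\<xi> \<bullet> b) * y) * normal_density 0 (sqrt (2 * s)) y)"
      unfolding eq by (rule integral_lborel_prod(2)) (rule c(1))
    then show ?thesis
      using assms by (simp only: c(2)) simp
  qed
  also have "\<dots> = exp (- s * (norm \<xi>)\<^sup>2)"
    by (simp add: of_real_prod[symmetric] exp_sum[symmetric] norm_sq_eq_sum sum_distrib_left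
        sum_negf del: of_real_prod)
  finally show "(LINT x|lborel. iexp (\<xi> \<bullet> x) * gauss s x) = exp (- s * (norm \<xi>)\<^sup>2)" .
qed

lemma
  assumes "s > 0"
  shows integrable_gauss: "integrable lborel (gauss s :: 'b::euclidean_space \<Rightarrow> real)"
    and integral_gauss: "(LINT x|lborel. gauss s (x :: 'b)) = 1"
proof -
  have "integrable lborel (\<lambda>x::'b. complex_of_real (gauss s x))"
       "(LINT x::'b|lborel. complex_of_real (gauss s x)) = complex_of_real 1"
    using char_gauss[OF assms, of "0::'b"] by auto
  then show "integrable lborel (gauss s :: 'b \<Rightarrow> real)" "(LINT x|lborel. gauss s (x :: 'b)) = 1"
    by (simp_all only: complex_of_real_integrable_eq integral_complex_of_real of_real_eq_iff)
qed

text \<open>The substitution \<open>y = x + sqrt s *\<^sub>R z\<close> moves the dependence on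
  \<open>s\<close> from the weight into the argument of \<open>f\<close>. With the fixed weight
  \<open>gauss 1\<close>, limits in \<open>s\<close> become dominated convergence.\<close>

lemma integral_gauss_shift:
  fixes f :: "'b::euclidean_space \<Rightarrow> 'c::{banach, second_countable_topology}"
  assumes "s > 0" and [measurable]: "f \<in> borel_measurable borel"
  shows "(LINT y|lborel. gauss s (y - x) *\<^sub>R f y) = (LINT z|lborel. gauss 1 z *\<^sub>R f (x + sqrt s *\<^sub>R z))"
proof -
  have sc: "sqrt s ^ DIM('b) * gauss s (sqrt s *\<^sub>R z) = gauss 1 z" for z :: 'b
  proof -
    have "sqrt s ^ DIM('b) = s powr (real DIM('b) / 2)"
      using assms by (simp add: powr_half_sqrt[symmetric] powr_realpow[symmetric] powr_powr)
    then have "sqrt s ^ DIM('b) * (4 * pi * s) powr (- (real DIM('b) / 2)) = (4 * pi) powr (- (real DIM('b) / 2))"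
      using assms by (simp add: powr_mult powr_minus field_simps)
    then show ?thesis
      using assms by (simp add: gauss_def power_mult_distrib mult.assoc[symmetric])
  qed
  have "(LINT y|lborel. gauss s (y - x) *\<^sub>R f y) =
    integral\<^sup>L (density (distr lborel borel (\<lambda>z. x + sqrt s *\<^sub>R z)) (\<lambda>_. \<bar>sqrt s\<bar> ^ DIM('b))) (\<lambda>y. gauss s (y - x) *\<^sub>R f y)"
    using assms by (subst lborel_affine[of "sqrt s" x]) auto
  also have "\<dots> = (LINT z|lborel. (sqrt s ^ DIM('b) * gauss s (sqrt s *\<^sub>R z)) *\<^sub>R f (x + sqrt s *\<^sub>R z))"
    using assms by (subst integral_density) (auto simp: integral_distr)
  finally show ?thesis by (simp only: sc)
qed

section \<open>Characteristic functions determine measures on Euclidean spaces\<close>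

text \<open>The indicator of an open set is the pointwise limit of truncated multiples of the
  distance to the complement, and open sets form an intersection-stable generator.\<close>

lemma measure_eqI_integral_continuous:
  fixes P Q :: "'b::euclidean_space measure"
  assumes "prob_space P" "prob_space Q" and [measurable_cong, simp]: "sets P = sets borel" "sets Q = sets borel"
    and eq: "\<And>f :: 'b \<Rightarrow> real. continuous_on UNIV f \<Longrightarrow> (\<And>x. 0 \<le> f x \<and> f x \<le> 1) \<Longrightarrow> (LINT x|P. f x) = (LINT x|Q. f x)"
  shows "P = Q"
proof -
  interpret P: prob_space P by fact
  interpret Q: prob_space Q by fact
  have [simp]: "space P = UNIV" "space Q = UNIV"
    using sets_eq_imp_space_eq[OF assms(3)] sets_eq_imp_space_eq[OF assms(4)] by auto
  have op: "measure P U = measure Q U" if U: "open U" for U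
  \<comment> \<open>The whole space is separate because \<open>infdist\<close> to the empty set is
    0, so that the approximating functions would vanish.\<close>
  proof (cases "U = UNIV")
    case True
    then show ?thesis using P.prob_space Q.prob_space by simp
  next
    case False
    define f where "f n x = min 1 (real n * infdist x (- U))" for n x
    have f: "continuous_on UNIV (f n)" "0 \<le> f n x \<and> f n x \<le> 1" for n x
      unfolding f_def by (auto intro!: continuous_intros simp: infdist_nonneg)
    have [measurable]: "f n \<in> borel_measurable borel" for n
      using f(1) by (rule borel_measurable_continuous_onI)
    have [measurable]: "U \<in> sets borel" using U by auto
    have lim: "(\<lambda>n. f n x) \<longlonglongrightarrow> indicator U x" for x
    proof (cases "x \<in> U")
      case True
      have "infdist x (- U) \<noteq> 0"
        using True U False in_closed_iff_infdist_zero[of "- U" x] by auto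
      then have "infdist x (- U) > 0" using infdist_nonneg[of x "- U"] by linarith
      then obtain n0 :: nat where "n0 > 0" "1 / infdist x (- U) \<le> n0"
        by (meson reals_Archimedean2 less_imp_le zero_less_divide_1_iff less_trans of_nat_0_less_iff)
      then have "f n x = 1" if "n \<ge> n0" for n
      proof -
        have "1 \<le> real n0 * infdist x (- U)"
          using \<open>1 / infdist x (- U) \<le> n0\<close> \<open>infdist x (- U) > 0\<close> by (simp add: field_simps)
        also have "\<dots> \<le> real n * infdist x (- U)"
          using that \<open>infdist x (- U) > 0\<close> by (intro mult_right_mono) auto
        finally show ?thesis by (simp add: f_def)
      qed
      then have "\<forall>\<^sub>F n in sequentially. f n x = indicator U x"
        using True by (auto simp: eventually_sequentially)
      then show ?thesis by (rule tendsto_eventually)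
    next
      case False
      then show ?thesis by (simp add: f_def)
    qed
    have "(\<lambda>n. LINT x|P. f n x) \<longlonglongrightarrow> (LINT x|P. indicator U x)"
      using f by (intro integral_dominated_convergence[where w="\<lambda>_. 1"]) (auto simp: lim)
    moreover have "(\<lambda>n. LINT x|Q. f n x) \<longlonglongrightarrow> (LINT x|Q. indicator U x)"
      using f by (intro integral_dominated_convergence[where w="\<lambda>_. 1"]) (auto simp: lim)
    ultimately have "(LINT x|P. indicator U x) = (LINT x|Q. indicator U x :: real)"
      using eq[OF f] LIMSEQ_unique by auto
    then show ?thesis by simp
  qed
  show ?thesis
  proof (rule measure_eqI_generator_eq[where E="{S. open S}" and \<Omega>=UNIV and A="\<lambda>_. UNIV"])
    show "Int_stable {S::'b set. open S}" by (auto simp: Int_stable_def)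
    show "emeasure P X = emeasure Q X" if "X \<in> {S. open S}" for X
      using op[of X] that by (simp add: P.emeasure_eq_measure Q.emeasure_eq_measure)
  qed (auto simp: borel_def)
qed

text \<open>\<open>D R e\<close> is the density of \<open>R\<close> smoothed by a Gaussian. By
  \<open>D_eq\<close> it depends on \<open>R\<close> only through its characteristic function, and
  by \<open>lim\<close> integrating it against \<open>f\<close> recovers the integral of
  \<open>f\<close> under \<open>R\<close> as \<open>e\<close> tends to 0.\<close>

theorem char_fun_unique:
  fixes P Q :: "'b::euclidean_space measure"
  assumes P: "prob_space P" "sets P = sets borel" and Q: "prob_space Q" "sets Q = sets borel"
    and eq: "\<And>\<xi>. (LINT x|P. iexp (\<xi> \<bullet> x)) = (LINT x|Q. iexp (\<xi> \<bullet> x))"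
  shows "P = Q"
proof (rule measure_eqI_integral_continuous)
  fix f :: "'b \<Rightarrow> real" assume f: "continuous_on UNIV f" "\<And>x. 0 \<le> f x \<and> f x \<le> 1"
  have fm [measurable]: "f \<in> borel_measurable borel"
    using f(1) by (rule borel_measurable_continuous_onI)
  define sm where "sm s x = (LINT z|lborel. gauss 1 z *\<^sub>R f (x + sqrt s *\<^sub>R z))" for s x
  define D where "D R e y = (LINT x|R. gauss e (y - x))" for R :: "'b measure" and e y
  have D_eq: "complex_of_real (D R e y) =
     (4 * pi * e) powr (- (real DIM('b) / 2)) *
       (LINT \<xi>|lborel. iexp (y \<bullet> \<xi>) * gauss (1/(4*e)) \<xi> * (LINT x|R. iexp ((- \<xi>) \<bullet> x)))"
    if R: "prob_space R" "sets R = sets borel" and e: "e > 0" for R :: "'b measure" and e y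
  proof -
    interpret R: prob_space R by fact
    note [measurable_cong] = R(2)
    interpret pair_sigma_finite R lborel ..
    define C where "C = (4 * pi * e) powr (- (real DIM('b) / 2))"
    \<comment> \<open>The Gauss kernel is self-dual: up to its height \<open>C\<close> at the
      origin, \<open>gauss e\<close> is the characteristic function of
      \<open>gauss (1 / (4 * e))\<close>.\<close>
    have g: "complex_of_real (gauss e z) = C * (LINT \<xi>|lborel. iexp (z \<bullet> \<xi>) * gauss (1/(4*e)) \<xi>)" for z :: 'b
      using e char_gauss(2)[of "1/(4*e)" z] by (simp add: gauss_def C_def)
    have int: "integrable (R \<Otimes>\<^sub>M lborel) (\<lambda>(x, \<xi>). iexp ((y - x) \<bullet> \<xi>) * gauss (1/(4*e)) \<xi>)"
    proof (rule Fubini_integrable)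
      have "norm (iexp ((y - x) \<bullet> \<xi>) * gauss (1/(4*e)) \<xi>) = gauss (1/(4*e)) \<xi>" for x \<xi>
        by (simp add: norm_mult)
      then show "integrable R (\<lambda>x. LINT \<xi>|lborel. norm (case (x, \<xi>) of (x, \<xi>) \<Rightarrow> iexp ((y - x) \<bullet> \<xi>) * gauss (1/(4*e)) \<xi>))"
        using e by (simp add: integral_gauss)
    qed (use e in \<open>auto intro!: char_gauss(1)\<close>)
    have "complex_of_real (D R e y) = (LINT x|R. complex_of_real (gauss e (y - x)))"
      by (simp add: D_def)
    also have "\<dots> = C * (LINT x|R. LINT \<xi>|lborel. iexp ((y - x) \<bullet> \<xi>) * gauss (1/(4*e)) \<xi>)"
      by (simp add: g)
    also have "(LINT x|R. LINT \<xi>|lborel. iexp ((y - x) \<bullet> \<xi>) * gauss (1/(4*e)) \<xi>) =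
        (LINT \<xi>|lborel. LINT x|R. iexp ((y - x) \<bullet> \<xi>) * gauss (1/(4*e)) \<xi>)"
      using Fubini_integral[OF int] by simp
    also have "\<dots> = (LINT \<xi>|lborel. LINT x|R. (iexp (y \<bullet> \<xi>) * gauss (1/(4*e)) \<xi>) * iexp ((- \<xi>) \<bullet> x))"
      by (intro Bochner_Integration.integral_cong)
         (auto simp: inner_diff_left inner_commute exp_add[symmetric] algebra_simps)
    finally show ?thesis by (simp add: C_def)
  qed
  have D_PQ: "D P e y = D Q e y" if "e > 0" for e y
  proof -
    have "complex_of_real (D P e y) = complex_of_real (D Q e y)"
      unfolding D_eq[OF P that] D_eq[OF Q that] by (simp only: eq)
    then show ?thesis by simp
  qed
  have lim: "(\<lambda>k. LINT y|lborel. D R (1 / Suc k) y * f y) \<longlonglongrightarrow> (LINT x|R. f x)"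
    if R: "prob_space R" "sets R = sets borel" for R :: "'b measure"
  proof -
    interpret R: prob_space R by fact
    note [measurable_cong] = R(2)
    interpret pair_sigma_finite R lborel ..
    have [measurable]: "(\<lambda>x. sm s x) \<in> borel_measurable borel" for s
      unfolding sm_def by measurable
    have "(LINT y|lborel. D R e y * f y) = (LINT x|R. sm e x)" if e: "e > 0" for e
    proof -
      have sh: "integrable lborel (\<lambda>y. gauss e (y - x))" "(LINT y|lborel. gauss e (y - x)) = 1" for x :: 'b
        using e integrable_distr_eq[of "(+) (- x)" lborel borel "gauss e :: 'b \<Rightarrow> real"]
          integral_distr[of "(+) (- x)" lborel borel "gauss e :: 'b \<Rightarrow> real"]
        unfolding lborel_distr_plus by (simp_all add: integrable_gauss integral_gauss)
      have int: "integrable (R \<Otimes>\<^sub>M lborel) (\<lambda>(x, y). gauss e (y - x) * f y)"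
      proof (rule Fubini_integrable)
        show i: "AE x in R. integrable lborel (\<lambda>y. case (x, y) of (x, y) \<Rightarrow> gauss e (y - x) * f y)"
        proof (rule AE_I2)
          fix x
          show "integrable lborel (\<lambda>y. case (x, y) of (x, y) \<Rightarrow> gauss e (y - x) * f y)"
            using f(2) by (auto intro!: AE_I2 Bochner_Integration.integrable_bound[OF sh(1)[of x]] mult_left_le)
        qed
        have "(LINT y|lborel. norm (gauss e (y - x) * f y)) \<le> (LINT y|lborel. gauss e (y - x))" for x
          using f(2) by (intro integral_mono') (auto intro!: sh(1) mult_left_le)
        then show "integrable R (\<lambda>x. LINT y|lborel. norm (case (x, y) of (x, y) \<Rightarrow> gauss e (y - x) * f y))"
          by (intro R.integrable_const_bound[where B=1]) (auto simp: sh(2))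
      qed auto
      have "(LINT y|lborel. D R e y * f y) = (LINT y|lborel. LINT x|R. gauss e (y - x) * f y)"
        by (simp add: D_def)
      also have "\<dots> = (LINT x|R. LINT y|lborel. gauss e (y - x) * f y)"
        using Fubini_integral[OF int] by simp
      also have "\<dots> = (LINT x|R. sm e x)"
        using integral_gauss_shift[OF e fm] by (simp add: sm_def)
      finally show ?thesis .
    qed
    moreover have "(\<lambda>k. LINT x|R. sm (1 / Suc k) x) \<longlonglongrightarrow> (LINT x|R. f x)"
    proof (rule integral_dominated_convergence[where w="\<lambda>_. 1"])
      have *: "norm (gauss 1 z *\<^sub>R f y) \<le> gauss 1 z" for z y :: 'b
        using f(2) by (auto intro: mult_left_le)
      have "norm (sm s x) \<le> 1" for s x
      proof -
        have "norm (sm s x) \<le> (LINT z|lborel. gauss 1 (z::'b))"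
          unfolding sm_def by (rule Bochner_Integration.integral_norm_bound_integral)
            (auto intro!: integrable_gauss * Bochner_Integration.integrable_bound[OF integrable_gauss[of 1]] simp: mult_left_le f(2))
        then show ?thesis by (simp add: integral_gauss)
      qed
      then show "AE x in R. norm (sm (1 / Suc k) x) \<le> 1" for k by auto
      have "(\<lambda>k. sm (1 / Suc k) x) \<longlonglongrightarrow> (LINT z::'b|lborel. gauss 1 z *\<^sub>R f x)" for x
        unfolding sm_def
      proof (rule integral_dominated_convergence[where w="gauss 1 :: 'b \<Rightarrow> real"])
        show "AE z in lborel. (\<lambda>k. gauss 1 z *\<^sub>R f (x + sqrt (1 / Suc k) *\<^sub>R z)) \<longlonglongrightarrow> gauss 1 z *\<^sub>R f x"
        proof (intro AE_I2 tendsto_intros)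
          fix z
          have "(\<lambda>k. x + sqrt (1 / Suc k) *\<^sub>R z) \<longlonglongrightarrow> x + sqrt 0 *\<^sub>R z"
            by (intro tendsto_intros LIMSEQ_Suc[OF lim_1_over_n])
          then show "(\<lambda>k. f (x + sqrt (1 / Suc k) *\<^sub>R z)) \<longlonglongrightarrow> f x"
            using f(1) by (intro continuous_on_tendsto_compose[OF f(1)]) auto
        qed
      qed (use * in \<open>auto intro: integrable_gauss\<close>)
      then show "AE x in R. (\<lambda>k. sm (1 / Suc k) x) \<longlonglongrightarrow> f x"
        by (simp add: integral_gauss)
    qed auto
    ultimately show ?thesis by simp
  qed
  show "(LINT x|P. f x) = (LINT x|Q. f x)"
    using LIMSEQ_unique[OF lim[OF P]] lim[OF Q] D_PQ by simp
qed (use assms in auto)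

section \<open>Mixtures of centred Gaussian laws over a random time\<close>

text \<open>At \<open>x = 0\<close> the integral may diverge. The value 0 chosen there is also that
  of \<open>limit_density\<close>, because \<open>0 powr a\<close> is 0, so the two can be equal as
  functions and not only almost everywhere.\<close>

definition gauss_mix :: "real measure \<Rightarrow> 'b::euclidean_space \<Rightarrow> real" where
  "gauss_mix N x = (if x = 0 then 0 else LINT s|N. gauss s x)"

lemma gauss_mix_nonneg [simp]: "0 \<le> gauss_mix N x"
  by (auto simp: gauss_mix_def)

lemma gauss_mix_measurable [measurable]:
  assumes "prob_space N" and [measurable_cong]: "sets N = sets borel"
  shows "(gauss_mix N :: 'b::euclidean_space \<Rightarrow> real) \<in> borel_measurable borel"
proof -
  interpret prob_space N by fact
  show ?thesis unfolding gauss_mix_def by measurable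
qed

lemma integral_gauss_mix:
  fixes f :: "'b::euclidean_space \<Rightarrow> 'c::{banach, second_countable_topology}"
  assumes N: "prob_space N" and sN[measurable_cong]: "sets N = sets borel" and pos: "AE s in N. s > 0"
    and [measurable]: "f \<in> borel_measurable borel" and B: "\<And>x. norm (f x) \<le> B"
  shows "integrable lborel (\<lambda>x. gauss_mix N x *\<^sub>R f x)"
    and "(LINT x|lborel. gauss_mix N x *\<^sub>R f x) = (LINT s|N. LINT x|lborel. gauss s x *\<^sub>R f x)"
proof -
  interpret N: prob_space N by fact
  interpret pair_sigma_finite N lborel ..
  have [measurable]: "(gauss_mix N :: 'b::euclidean_space \<Rightarrow> real) \<in> borel_measurable borel"
    by (rule gauss_mix_measurable[OF N sN])
  have gi: "integrable lborel (\<lambda>x::'b. gauss s x)" for s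
  proof (cases "s > 0")
    case True
    then show ?thesis by (rule integrable_gauss)
  qed (simp add: gauss_def)
  have int0: "integrable (N \<Otimes>\<^sub>M lborel) (\<lambda>(s, x::'b). gauss s x)"
  proof (rule Fubini_integrable)
    have "norm (LINT x::'b|lborel. norm (gauss s x)) \<le> 1" for s
      by (cases "s > 0") (simp add: integral_gauss, simp add: gauss_def)
    then show "integrable N (\<lambda>s. LINT x|lborel. norm (case (s, x) of (s, x::'b) \<Rightarrow> gauss s x))"
      by (intro N.integrable_const_bound[where B=1]) auto
  qed (auto intro!: AE_I2 gi)
  have B0: "B \<ge> 0" using norm_ge_zero[THEN order_trans, OF B] .
  have *: "norm (gauss s x *\<^sub>R f x) \<le> B * gauss s x" for s x
    using mult_left_mono[OF B[of x] gauss_nonneg[of s x]] by (simp add: mult.commute)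
  have int: "integrable (N \<Otimes>\<^sub>M lborel) (\<lambda>(s, x). gauss s x *\<^sub>R f x)"
    by (rule Bochner_Integration.integrable_bound[OF integrable_mult_right[OF int0, of B]])
       (use * B0 in \<open>auto intro!: AE_I2\<close>)
  have "AE x::'b in lborel. integrable N (\<lambda>s. gauss s x)"
    using AE_integrable_snd[of "\<lambda>s (x::'b). gauss s x"] int0 by simp
  then have ae: "AE x in lborel. (LINT s|N. gauss s x *\<^sub>R f x) = gauss_mix N x *\<^sub>R f x"
    using AE_lborel_singleton[of "0::'b"] by eventually_elim (auto simp: gauss_mix_def)
  show "integrable lborel (\<lambda>x. gauss_mix N x *\<^sub>R f x)"
    using integrable_snd[of "\<lambda>s x. gauss s x *\<^sub>R f x"] int
    by (subst integrable_cong_AE[where g="\<lambda>x. LINT s|N. gauss s x *\<^sub>R f x"]) (use ae in auto)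
  have "(LINT x|lborel. gauss_mix N x *\<^sub>R f x) = (LINT x|lborel. LINT s|N. gauss s x *\<^sub>R f x)"
    by (rule integral_cong_AE) (use ae in auto)
  also have "\<dots> = (LINT s|N. LINT x|lborel. gauss s x *\<^sub>R f x)"
    using Fubini_integral[OF int] by simp
  finally show "(LINT x|lborel. gauss_mix N x *\<^sub>R f x) = (LINT s|N. LINT x|lborel. gauss s x *\<^sub>R f x)" .
qed

lemma prob_space_gauss_mix:
  assumes N: "prob_space N" "sets N = sets borel" "AE s in N. s > 0"
  shows "prob_space (density lborel (\<lambda>x::'b::euclidean_space. ennreal (gauss_mix N x)))"
proof -
  interpret N: prob_space N by fact
  note i = integral_gauss_mix[OF N, of "\<lambda>_::'b. 1::real" 1]
  have [measurable]: "(gauss_mix N :: 'b::euclidean_space \<Rightarrow> real) \<in> borel_measurable borel"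
    by (rule gauss_mix_measurable[OF N(1,2)])
  have "(LINT s|N. LINT x::'b|lborel. gauss s x) = (LINT s|N. 1)"
  proof (rule integral_cong_AE)
    note [measurable_cong] = N(2)
    show "(\<lambda>s. LINT x::'b|lborel. gauss s x) \<in> borel_measurable N" by measurable
    show "AE s in N. (LINT x::'b|lborel. gauss s x) = 1"
      using N(3) by eventually_elim (simp add: integral_gauss)
  qed auto
  then have "(\<integral>\<^sup>+x. ennreal (gauss_mix N (x::'b)) \<partial>lborel) = 1"
    using i by (subst nn_integral_eq_integral) (auto simp: N.prob_space)
  then show ?thesis
    by (intro prob_spaceI) (simp add: emeasure_density)
qed

text \<open>The characteristic function of a mixture is the mixture of the Gaussian ones,
  \<open>exp (- s * (norm \<xi>)\<^sup>2)\<close>; uniqueness does the rest.\<close>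

lemma distr_eq_gauss_mix:
  fixes P :: "'b::euclidean_space measure"
  assumes P: "prob_space P" "sets P = sets borel"
    and N: "prob_space N" "sets N = sets borel" "AE s in N. s > 0"
    and ch: "\<And>\<xi>. (LINT x|P. iexp (\<xi> \<bullet> x)) = complex_of_real (LINT s|N. exp (- s * (norm \<xi>)\<^sup>2))"
  shows "P = density lborel (\<lambda>x. ennreal (gauss_mix N x))"
proof (rule char_fun_unique[OF P prob_space_gauss_mix[OF N]])
  fix \<xi> :: 'b
  have [measurable]: "(gauss_mix N :: 'b::euclidean_space \<Rightarrow> real) \<in> borel_measurable borel"
    by (rule gauss_mix_measurable[OF N(1,2)])
  note [measurable_cong] = N(2)
  have "(LINT x|density lborel (\<lambda>x. ennreal (gauss_mix N x)). iexp (\<xi> \<bullet> x)) = (LINT x|lborel. gauss_mix N x *\<^sub>R iexp (\<xi> \<bullet> x))"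
    by (subst integral_density) auto
  also have "\<dots> = (LINT s|N. LINT x|lborel. gauss s x *\<^sub>R iexp (\<xi> \<bullet> x))"
    by (rule integral_gauss_mix(2)[OF N, where B=1]) auto
  also have "\<dots> = (LINT s|N. complex_of_real (exp (- s * (norm \<xi>)\<^sup>2)))"
  proof (rule integral_cong_AE)
    show "AE s in N. (LINT x|lborel. gauss s x *\<^sub>R iexp (\<xi> \<bullet> x)) = complex_of_real (exp (- s * (norm \<xi>)\<^sup>2))"
      using N(3) by eventually_elim (subst char_gauss(2)[symmetric], simp_all add: scaleR_conv_of_real mult.commute)
  qed measurable
  finally show "(LINT x|P. iexp (\<xi> \<bullet> x)) = (LINT x|density lborel (\<lambda>x. ennreal (gauss_mix N x)). iexp (\<xi> \<bullet> x))"
    by (simp add: ch)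
qed auto

text \<open>This reduces convergence in law of mixtures on the whole space to the convergence of
  integrals of one function of \<open>s\<close> under the mixing laws.\<close>

lemma integral_density_gauss_mix:
  fixes f :: "'b::euclidean_space \<Rightarrow> real"
  assumes N: "prob_space N" "sets N = sets borel" "AE s in N. s > 0"
    and f: "f \<in> borel_measurable borel" "\<And>x. norm (f x) \<le> B"
  shows "(LINT x|density lborel (\<lambda>x. ennreal (gauss_mix N x)). f x) =
         (LINT s|N. LINT z|lborel. gauss 1 z * f (sqrt s *\<^sub>R z))"
proof -
  have [measurable]: "(gauss_mix N :: 'b::euclidean_space \<Rightarrow> real) \<in> borel_measurable borel"
    by (rule gauss_mix_measurable[OF N(1,2)])
  note [measurable_cong] = N(2) and [measurable] = f(1)
  have "(LINT x|density lborel (\<lambda>x. ennreal (gauss_mix N x)). f x) = (LINT x|lborel. gauss_mix N x *\<^sub>R f x)"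
    by (subst integral_density) auto
  also have "\<dots> = (LINT s|N. LINT x|lborel. gauss s x *\<^sub>R f x)"
    by (rule integral_gauss_mix(2)[OF N f])
  also have "\<dots> = (LINT s|N. LINT z|lborel. gauss 1 z * f (sqrt s *\<^sub>R z))"
  proof (rule integral_cong_AE)
    show "AE s in N. (LINT x|lborel. gauss s x *\<^sub>R f x) = (LINT z|lborel. gauss 1 z * f (sqrt s *\<^sub>R z))"
      using N(3) by eventually_elim (use integral_gauss_shift[OF _ f(1), of _ 0] in simp)
  qed measurable
  finally show ?thesis .
qed

text \<open>These are the properties that make the inner function a test function for weak
  convergence on the line. Negative \<open>s\<close> does no harm, since \<open>sqrt\<close> is
  extended as an odd continuous function.\<close>

lemma continuous_gauss_average:
  fixes f :: "'b::euclidean_space \<Rightarrow> real"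
  assumes f: "continuous_on UNIV f" "\<And>x. norm (f x) \<le> B"
  shows "isCont (\<lambda>s. LINT z|lborel. gauss 1 z * f (sqrt s *\<^sub>R z)) s"
    and "norm (LINT z|lborel. gauss 1 z * f (sqrt s *\<^sub>R z)) \<le> B"
proof -
  have [measurable]: "f \<in> borel_measurable borel"
    using f(1) by (rule borel_measurable_continuous_onI)
  have *: "norm (gauss 1 z * f y) \<le> B * gauss 1 z" for z y :: 'b
    using mult_left_mono[OF f(2)[of y] gauss_nonneg[of 1 z]] by (simp add: abs_mult mult.commute)
  have i: "integrable lborel (\<lambda>z::'b. B * gauss 1 z)"
    by (intro integrable_mult_right integrable_gauss) auto
  have B0: "B \<ge> 0" using f(2)[of 0] norm_ge_zero[of "f 0"] by linarith
  show "isCont (\<lambda>s. LINT z|lborel. gauss 1 z * f (sqrt s *\<^sub>R z)) s"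
    unfolding continuous_at_sequentially comp_def
  proof safe
    fix S assume S: "S \<longlonglongrightarrow> s"
    show "(\<lambda>n. LINT z|lborel. gauss 1 z * f (sqrt (S n) *\<^sub>R z)) \<longlonglongrightarrow> (LINT z|lborel. gauss 1 z * f (sqrt s *\<^sub>R z))"
    proof (rule integral_dominated_convergence[OF _ _ i])
      show "AE z in lborel. (\<lambda>n. gauss 1 z * f (sqrt (S n) *\<^sub>R z)) \<longlonglongrightarrow> gauss 1 z * f (sqrt s *\<^sub>R z)"
        by (intro AE_I2 tendsto_mult tendsto_const continuous_on_tendsto_compose[OF f(1)] tendsto_scaleR tendsto_real_sqrt S) auto
    qed (use * in auto)
  qed
  have i2: "integrable lborel (\<lambda>z. gauss 1 z * f (sqrt s *\<^sub>R z))"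
    by (rule Bochner_Integration.integrable_bound[OF i]) (use * B0 in auto)
  have "norm (LINT z|lborel. gauss 1 z * f (sqrt s *\<^sub>R z)) \<le> (LINT z::'b|lborel. B * gauss 1 z)"
    by (rule Bochner_Integration.integral_norm_bound_integral)
      (use * B0 in \<open>auto simp: integrable_gauss intro!: i2\<close>)
  then show "norm (LINT z|lborel. gauss 1 z * f (sqrt s *\<^sub>R z)) \<le> B"
    by (simp add: integral_gauss)
qed

section \<open>Differentiation under the integral, and the kernels
  \<open>s powr - p * exp (- b / s)\<close>\<close>

text \<open>The parameter ranges over a real normed field because the lemma serves twice: for real
  derivatives of Gaussian mixtures, and for the holomorphy of Laplace transforms.\<close>

lemma has_field_derivative_integral:
  fixes f f' :: "'a::{real_normed_field,banach,second_countable_topology} \<Rightarrow> 'b \<Rightarrow> 'a"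
  assumes d: "d > 0"
    and der: "\<And>y s. y \<in> ball x d \<Longrightarrow> s \<in> space M \<Longrightarrow> ((\<lambda>y. f y s) has_field_derivative f' y s) (at y)"
    and bd: "\<And>y s. y \<in> ball x d \<Longrightarrow> s \<in> space M \<Longrightarrow> norm (f' y s) \<le> w s"
    and w: "integrable M w" and int: "\<And>y. y \<in> ball x d \<Longrightarrow> integrable M (f y)"
    and f': "f' x \<in> borel_measurable M"
  shows "((\<lambda>y. LINT s|M. f y s) has_field_derivative (LINT s|M. f' x s)) (at x)"
  unfolding has_field_derivative_iff tendsto_at_iff_sequentially comp_def
proof safe
  fix X :: "nat \<Rightarrow> 'a" assume X: "\<forall>i. X i \<in> UNIV - {x}" "X \<longlonglongrightarrow> x"
  have xb: "x \<in> ball x d" using d by simp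
  have "\<forall>\<^sub>F i in sequentially. X i \<in> ball x d"
    using X(2) d by (intro topological_tendstoD) auto
  then obtain i0 where "\<forall>i\<ge>i0. X i \<in> ball x d"
    unfolding eventually_sequentially by blast
  then have i0: "\<And>i. X (i + i0) \<in> ball x d" by simp
  have Xne: "X i \<noteq> x" for i using X(1) by auto
  \<comment> \<open>The sequence is shifted so that all its members lie in the ball, where the bound
    \<open>w\<close> is available.\<close>
  have "(\<lambda>i. LINT s|M. (f (X (i + i0)) s - f x s) / (X (i + i0) - x)) \<longlonglongrightarrow> (LINT s|M. f' x s)"
  proof (rule integral_dominated_convergence[OF f' _ w])
    show "(\<lambda>s. (f (X (i + i0)) s - f x s) / (X (i + i0) - x)) \<in> borel_measurable M" for i
      using borel_measurable_integrable[OF int[OF i0[of i]]] borel_measurable_integrable[OF int[OF xb]]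
      by measurable
    show "AE s in M. (\<lambda>i. (f (X (i + i0)) s - f x s) / (X (i + i0) - x)) \<longlonglongrightarrow> f' x s"
    proof (rule AE_I2)
      fix s assume s: "s \<in> space M"
      have "(\<lambda>i. (f (X i) s - f x s) / (X i - x)) \<longlonglongrightarrow> f' x s"
        using der[OF xb s] X unfolding has_field_derivative_iff tendsto_at_iff_sequentially comp_def by blast
      then show "(\<lambda>i. (f (X (i + i0)) s - f x s) / (X (i + i0) - x)) \<longlonglongrightarrow> f' x s"
        by (rule LIMSEQ_ignore_initial_segment)
    qed
    show "AE s in M. norm ((f (X (i + i0)) s - f x s) / (X (i + i0) - x)) \<le> w s" for i
    proof (rule AE_I2)
      fix s assume s: "s \<in> space M"
      \<comment> \<open>The mean value inequality on the convex ball turns the bound on the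
        derivative into one on the difference quotients.\<close>
      have "norm (f (X (i + i0)) s - f x s) \<le> w s * norm (X (i + i0) - x)"
      proof (rule field_differentiable_bound[of "ball x d" "\<lambda>y. f y s" "\<lambda>y. f' y s"])
        show "((\<lambda>y. f y s) has_field_derivative f' z s) (at z within ball x d)" if "z \<in> ball x d" for z
          using der[OF that s] by (rule has_field_derivative_at_within)
      qed (rule convex_ball, rule bd[OF _ s], assumption, rule i0, rule xb)
      then show "norm ((f (X (i + i0)) s - f x s) / (X (i + i0) - x)) \<le> w s"
        using Xne[of "i + i0"] by (simp add: norm_divide field_simps)
    qed
  qed
  also have "(\<lambda>i. LINT s|M. (f (X (i + i0)) s - f x s) / (X (i + i0) - x)) =
     (\<lambda>i. ((LINT s|M. f (X (i + i0)) s) - (LINT s|M. f x s)) / (X (i + i0) - x))"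
    using int[OF i0] int[OF xb] by (intro ext) (simp add: Bochner_Integration.integral_diff)
  finally show "(\<lambda>i. ((LINT s|M. f (X i) s) - (LINT s|M. f x s)) / (X i - x)) \<longlonglongrightarrow> (LINT s|M. f' x s)"
    by (rule LIMSEQ_offset)
qed

text \<open>With \<open>b = (norm x)\<^sup>2 / 4\<close> the Gauss kernel and all its derivatives in
  \<open>s\<close> are combinations of these functions. For \<open>b > 0\<close> the extension by 0
  is smooth across \<open>s = 0\<close>, so that later integrations by parts run over the whole
  line.\<close>

definition ek :: "real \<Rightarrow> real \<Rightarrow> real \<Rightarrow> real" where
  "ek p b s = (if s > 0 then s powr (- p) * exp (- b / s) else 0)"

lemma ek_nonneg [simp]: "0 \<le> ek p b s" by (simp add: ek_def)

lemma ek_nonpos [simp]: "s \<le> 0 \<Longrightarrow> ek p b s = 0" by (simp add: ek_def)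

lemma ek_measurable [measurable]:
  assumes [measurable]: "f \<in> borel_measurable M" "g \<in> borel_measurable M"
  shows "(\<lambda>w. ek p (f w) (g w)) \<in> borel_measurable M"
  unfolding ek_def by measurable

lemma ek_mono: "b0 \<le> b \<Longrightarrow> ek p b s \<le> ek p b0 s"
  by (auto simp: ek_def intro!: mult_left_mono divide_right_mono)

lemma ek_mult_powr: "s powr (- q) * ek p b s = ek (p + q) b s"
  by (auto simp: ek_def powr_add[symmetric] mult.assoc[symmetric] add.commute)

lemma ek_tendsto_0: 
  assumes "b > 0"
  shows "(ek p b \<longlongrightarrow> 0) (at 0)"
proof -
  have "((\<lambda>s. s powr (- p) * exp (- b / s)) \<longlongrightarrow> 0) (at_right 0)"
    using assms by real_asymp
  then have "(ek p b \<longlongrightarrow> 0) (at_right 0)"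
    by (rule Lim_transform_eventually) (auto simp: ek_def eventually_at_right_field intro!: exI[of _ 1])
  moreover have "(ek p b \<longlongrightarrow> 0) (at_left 0)"
    by (rule tendsto_eventually) (auto simp: eventually_at_left_field intro!: exI[of _ "-1"])
  ultimately show ?thesis by (simp add: filterlim_split_at)
qed

lemma ek_has_derivative:
  assumes "b > 0"
  shows "(ek p b has_real_derivative (b * ek (p + 2) b s - p * ek (p + 1) b s)) (at s)"
proof (cases s "0::real" rule: linorder_cases)
  case less
  have "((\<lambda>_. 0) has_real_derivative 0) (at s)" by simp
  then have "(ek p b has_real_derivative 0) (at s)"
    by (rule has_field_derivative_transform_within_open[where S="{..<0}"]) (use less in auto)
  then show ?thesis using less by simp
next
  case equal
  have "(ek (p + 1) b \<longlongrightarrow> 0) (at 0)" by (rule ek_tendsto_0[OF assms])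
  \<comment> \<open>The difference quotient of \<open>ek p b\<close> at 0 is again a kernel, with
    \<open>p\<close> raised by one; for negative \<open>h\<close> both sides are 0.\<close>
  moreover have "\<forall>\<^sub>F h in at (0::real). ek (p + 1) b h = (ek p b h - ek p b 0) / (h - 0)"
    unfolding eventually_at
    by (intro exI[of _ 1]) (auto simp: ek_def powr_diff powr_minus field_simps powr_add)
  ultimately have "(ek p b has_real_derivative 0) (at 0)"
    unfolding has_field_derivative_iff by (rule Lim_transform_eventually)
  then show ?thesis using equal by simp
next
  case greater
  have "((\<lambda>s. s powr (- p) * exp (- b / s)) has_real_derivative (b * ek (p + 2) b s - p * ek (p + 1) b s)) (at s)"
    using greater
    by (auto intro!: derivative_eq_intros simp: ek_def powr_diff powr_minus powr_add field_simps power2_eq_square)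
  then show ?thesis
    by (rule has_field_derivative_transform_within_open[where S="{0<..}"]) (use greater in \<open>auto simp: ek_def\<close>)
qed

lemma ek_continuous: "b > 0 \<Longrightarrow> isCont (ek p b) s"
  using ek_has_derivative DERIV_isCont by blast

lemma ek_has_derivative_b:
  "((\<lambda>b. ek p b s) has_real_derivative - ek (p + 1) b s) (at b)"
  by (cases "s > 0")
    (auto simp: ek_def powr_diff powr_minus powr_add field_simps intro!: derivative_eq_intros)

text \<open>In the variable \<open>y = 1 / s\<close> the kernel is
  \<open>y powr p * exp (- b * y)\<close>, which is below 1 for large \<open>y\<close> and at most
  \<open>y powr p\<close> elsewhere.\<close>

lemma ek_bounded:
  assumes b: "b > 0" and p: "p \<ge> 0"
  obtains C where "C \<ge> 0" "\<And>s. ek p b s \<le> C"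
proof -
  have "((\<lambda>y. y powr p * exp (- b * y)) \<longlongrightarrow> 0) at_top"
    using b by real_asymp
  then have "\<forall>\<^sub>F y in at_top. y powr p * exp (- b * y) < 1"
    by (rule order_tendstoD) simp
  then obtain Y where Y: "\<And>y. y \<ge> Y \<Longrightarrow> y powr p * exp (- b * y) < 1"
    by (auto simp: eventually_at_top_linorder)
  have "ek p b s \<le> max 1 (Y powr p)" for s
  proof (cases "s > 0")
    case True
    have e: "ek p b s = (1/s) powr p * exp (- b * (1/s))"
      using True by (simp add: ek_def powr_minus powr_divide field_simps)
    show ?thesis
    proof (cases "1/s \<ge> Y")
      case True
      then show ?thesis using Y[of "1/s"] e by simp
    next
      case False
      then have "(1/s) powr p \<le> Y powr p" using \<open>s > 0\<close> p by (intro powr_mono2) auto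
      moreover have "(1/s) powr p * exp (- b * (1/s)) \<le> (1/s) powr p * 1"
        using b True by (intro mult_left_mono) auto
      ultimately show ?thesis using e by simp
    qed
  qed auto
  then show ?thesis using that[of "max 1 (Y powr p)"] by auto
qed

lemma ek_integrable:
  assumes b: "b > 0" and p: "p > 1"
  shows "integrable lborel (ek p b)"
proof -
  obtain C where C: "C \<ge> 0" "\<And>s. ek p b s \<le> C"
    using ek_bounded[of b p] assms by auto
  have "((\<lambda>x. x powr (-p)) has_integral - (1 powr (-p + 1)) / (-p + 1)) {1..}"
    using p by (intro has_integral_powr_to_inf) auto
  then have "(\<lambda>x. x powr (-p)) absolutely_integrable_on {1..}"
    by (intro nonnegative_absolutely_integrable_1) (auto intro: has_integral_integrable)
  then have "integrable lebesgue (\<lambda>x. indicator {1..} x *\<^sub>R x powr (-p))"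
    by (simp add: set_integrable_def)
  then have i1: "integrable lborel (\<lambda>x. indicator {1..} x *\<^sub>R x powr (-p))"
    by (subst (asm) integrable_completion) auto
  have i2: "integrable lborel (\<lambda>x. C * indicator {0..1::real} x)"
    by (intro integrable_mult_right) simp
  show ?thesis
  proof (rule Bochner_Integration.integrable_bound[OF Bochner_Integration.integrable_add[OF i1 i2]])
    have "ek p b s \<le> indicator {1..} s *\<^sub>R s powr (-p) + C * indicator {0..1::real} s" for s
    proof (cases "s \<ge> 1")
      case True
      then have "ek p b s \<le> s powr (-p) * 1"
        using b unfolding ek_def by (auto intro!: mult_left_mono)
      then show ?thesis using True C(1) by (auto simp: indicator_def)
    next
      case False
      then show ?thesis using C by (cases "s > 0") auto
    qed
    then show "AE s in lborel. norm (ek p b s) \<le> norm (indicator {1..} s *\<^sub>R s powr (-p) + C * indicator {0..1::real} s)"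
      using C(1) by (auto intro!: AE_I2 order_trans[OF _ abs_ge_self])
  qed measurable
qed

lemma ek_tendsto_at_top:
  assumes "p > 0"
  shows "(ek p b \<longlongrightarrow> 0) at_top"
proof -
  have "((\<lambda>s. s powr (- p) * exp (- b / s)) \<longlongrightarrow> 0) at_top"
    using assms by real_asymp
  then show ?thesis
    by (rule Lim_transform_eventually) (auto simp: ek_def eventually_at_top_dense intro!: exI[of _ 0])
qed

lemma ek_integrable_prob:
  assumes "prob_space N" "sets N = sets borel" "b > 0" "p \<ge> 0"
  shows "integrable N (ek p b)"
proof -
  interpret prob_space N by fact
  note [measurable_cong] = assms(2)
  obtain C where C: "C \<ge> 0" "\<And>s. ek p b s \<le> C"
    using ek_bounded[of b p] assms by auto
  show ?thesis
    by (rule integrable_const_bound[where B=C]) (use C in auto)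
qed

text \<open>The space variable enters only through \<open>b\<close>, so spatial derivatives of
  mixtures reduce to this one. The kernel decreases in \<open>b\<close>, hence its value at
  \<open>b / 2\<close> dominates throughout the ball of radius \<open>b / 2\<close>.\<close>

lemma integral_ek_has_derivative:
  assumes N: "prob_space N" "sets N = sets borel" and b: "b > 0" and p: "p \<ge> 0"
  shows "((\<lambda>b. LINT s|N. ek p b s) has_real_derivative - (LINT s|N. ek (p + 1) b s)) (at b)"
proof -
  note [measurable_cong] = N(2)
  have "((\<lambda>b. LINT s|N. ek p b s) has_real_derivative (LINT s|N. - ek (p + 1) b s)) (at b)"
  proof (rule has_field_derivative_integral[where d="b/2" and w="ek (p + 1) (b/2)"])
    show "norm (- ek (p + 1) y s) \<le> ek (p + 1) (b / 2) s" if "y \<in> ball b (b / 2)" for y s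
    proof -
      have "b / 2 \<le> y" using that unfolding mem_ball dist_real_def by linarith
      then show ?thesis using ek_mono by simp
    qed
    show "integrable N (ek p y)" if "y \<in> ball b (b / 2)" for y
    proof -
      have "b / 2 \<le> y" using that unfolding mem_ball dist_real_def by linarith
      then show ?thesis using p b by (intro ek_integrable_prob[OF N]) auto
    qed
    show "integrable N (ek (p + 1) (b / 2))"
      using b p by (intro ek_integrable_prob[OF N]) auto
    show "(\<lambda>s. - ek (p + 1) b s) \<in> borel_measurable N" by measurable
    show "((\<lambda>y. ek p y s) has_real_derivative - ek (p + 1) y s) (at y)" for y s
      by (rule ek_has_derivative_b)
  qed (use b in simp)
  then show ?thesis by simp
qed

text \<open>The derivative of the Gauss kernel in \<open>s\<close>; by the heat equation it is also
  its Laplacian in \<open>x\<close>.\<close>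

definition dgauss :: "'b::euclidean_space \<Rightarrow> real \<Rightarrow> real" where
  "dgauss x s = (4 * pi) powr (- (real DIM('b) / 2)) *
     ((norm x)\<^sup>2 / 4 * ek (real DIM('b) / 2 + 2) ((norm x)\<^sup>2 / 4) s - real DIM('b) / 2 * ek (real DIM('b) / 2 + 1) ((norm x)\<^sup>2 / 4) s)"

lemma gauss_eq_ek:
  "gauss s (x :: 'b::euclidean_space) = (4 * pi) powr (- (real DIM('b) / 2)) * ek (real DIM('b) / 2) ((norm x)\<^sup>2 / 4) s"
  by (auto simp: gauss_def ek_def powr_mult field_simps)

text \<open>It holds at every real \<open>s\<close>, including 0, because of the extension of the
  kernel by 0 and \<open>x \<noteq> 0\<close>.\<close>

lemma gauss_has_derivative:
  fixes x :: "'b::euclidean_space"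
  assumes "x \<noteq> 0"
  shows "((\<lambda>s. gauss s x) has_real_derivative dgauss x s) (at s)"
  unfolding gauss_eq_ek dgauss_def
  by (intro DERIV_cmult ek_has_derivative) (use assms in simp)

lemma axis_norm_sq_derivative:
  fixes y :: "real ^ 'n"
  shows "((\<lambda>h. (norm (y + h *\<^sub>R axis j 1))\<^sup>2 / 4) has_real_derivative (y $ j / 2)) (at 0)"
proof -
  have "(norm (y + h *\<^sub>R axis j 1))\<^sup>2 / 4 = (norm y)\<^sup>2 / 4 + h * (y $ j) / 2 + h\<^sup>2 / 4" for h
    unfolding power2_norm_eq_inner
    by (simp add: inner_add_left inner_add_right inner_axis inner_axis' inner_axis_axis field_simps power2_eq_square)
  then show ?thesis
    by (auto intro!: derivative_eq_intros)
qed

text \<open>The chain rule through \<open>b = (norm x)\<^sup>2 / 4\<close> is applied twice, each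
  derivative in \<open>b\<close> raising the exponent of the kernel by one. Summing over the
  coordinates yields the average of \<open>dgauss\<close>, which is the heat equation under the
  integral.\<close>

lemma gauss_mix_second_partials:
  fixes x :: "real ^ 'n"
  assumes N: "prob_space N" "sets N = sets borel" and x: "x \<noteq> 0"
  shows "has_second_partials (gauss_mix N) x"
    and "laplacian (gauss_mix N) x = (LINT s|N. dgauss x s)"
proof -
  define p where "p = real CARD('n) / 2"
  have p: "p \<ge> 0" by (simp add: p_def)
  define A where "A = (4 * pi) powr (- p)"
  define I where "I q b = (LINT s|N. ek q b s)" for q b
  define f where "f = (gauss_mix N :: real ^ 'n \<Rightarrow> real)"
  have f: "f y = A * I p ((norm y)\<^sup>2 / 4)" if "y \<noteq> 0" for y
    using that by (simp add: f_def gauss_mix_def gauss_eq_ek A_def p_def I_def)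
  have I: "(I q has_real_derivative - I (q + 1) b) (at b)" if "b > 0" "q \<ge> 0" for q b
    unfolding I_def using integral_ek_has_derivative[OF N that] .
  have ev: "\<forall>\<^sub>F h in nhds 0. y + h *\<^sub>R axis j (1::real) \<noteq> 0" if "y \<noteq> 0" for y :: "real ^ 'n" and j
  proof -
    have "((\<lambda>h. y + h *\<^sub>R axis j (1::real)) \<longlongrightarrow> y + 0 *\<^sub>R axis j 1) (at 0)"
      by (intro tendsto_intros)
    then have "\<forall>\<^sub>F h in at 0. y + h *\<^sub>R axis j (1::real) \<noteq> 0"
      by (rule tendsto_imp_eventually_ne) (use that in simp)
    then show ?thesis using that by (simp add: eventually_nhds_conv_at)
  qed
  have Ic: "((\<lambda>h. I q ((norm (y + h *\<^sub>R axis j 1))\<^sup>2 / 4)) has_real_derivative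
      - I (q + 1) ((norm y)\<^sup>2 / 4) * (y $ j / 2)) (at 0)"
    if "y \<noteq> 0" "q \<ge> 0" for y :: "real ^ 'n" and j q
  proof -
    have "(I q has_real_derivative - I (q + 1) ((norm y)\<^sup>2 / 4)) (at ((norm (y + 0 *\<^sub>R axis j 1))\<^sup>2 / 4))"
      using I[of "(norm y)\<^sup>2 / 4" q] that by simp
    from DERIV_chain2[OF this axis_norm_sq_derivative] show ?thesis .
  qed
  have d1: "((\<lambda>h. f (y + h *\<^sub>R axis j 1)) has_real_derivative
      A * (- I (p + 1) ((norm y)\<^sup>2 / 4) * (y $ j / 2))) (at 0)" if "y \<noteq> 0" for y j
  proof -
    have "((\<lambda>h. A * I p ((norm (y + h *\<^sub>R axis j 1))\<^sup>2 / 4)) has_real_derivative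
      A * (- I (p + 1) ((norm y)\<^sup>2 / 4) * (y $ j / 2))) (at 0)"
      by (intro DERIV_cmult Ic that p)
    then show ?thesis
      by (rule has_field_derivative_cong_eventually[THEN iffD1, rotated 2])
        (use ev[OF that, of j] f in \<open>auto simp: eventually_nhds_conv_at elim!: eventually_mono intro: f[OF that, symmetric]\<close>)
  qed
  have pd: "partial_deriv j f y = A * (- I (p + 1) ((norm y)\<^sup>2 / 4) * (y $ j / 2))" if "y \<noteq> 0" for y j
    unfolding partial_deriv_def using d1[OF that] by (rule DERIV_imp_deriv)
  have d2: "((\<lambda>h. partial_deriv j f (x + h *\<^sub>R axis j 1)) has_real_derivative
      A * (I (p + 2) ((norm x)\<^sup>2 / 4) * (x $ j / 2)\<^sup>2 - I (p + 1) ((norm x)\<^sup>2 / 4) / 2)) (at 0)" for j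
  proof -
    have "((\<lambda>h. A * (- I (p + 1) ((norm (x + h *\<^sub>R axis j 1))\<^sup>2 / 4) * ((x $ j + h) / 2))) has_real_derivative
      A * (- (- I (p + 1 + 1) ((norm x)\<^sup>2 / 4) * (x $ j / 2)) * ((x $ j + 0) / 2) + (1 / 2) * (- I (p + 1) ((norm (x + 0 *\<^sub>R axis j 1))\<^sup>2 / 4)))) (at 0)"
      using p by (intro DERIV_cmult DERIV_mult DERIV_minus Ic x) (auto intro!: derivative_eq_intros)
    then have "((\<lambda>h. A * (- I (p + 1) ((norm (x + h *\<^sub>R axis j 1))\<^sup>2 / 4) * ((x $ j + h) / 2))) has_real_derivative
      A * (I (p + 2) ((norm x)\<^sup>2 / 4) * (x $ j / 2)\<^sup>2 - I (p + 1) ((norm x)\<^sup>2 / 4) / 2)) (at 0)"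
      by (simp add: power2_eq_square algebra_simps)
    then show ?thesis
      by (rule has_field_derivative_cong_eventually[THEN iffD1, rotated 2])
        (use ev[OF x, of j] pd in \<open>auto simp: eventually_nhds_conv_at axis_def elim!: eventually_mono intro: pd[OF x, symmetric]\<close>)
  qed
  have "\<forall>\<^sub>F y in nhds x. y \<noteq> 0"
    using x by (intro t1_space_nhds) auto
  then have "\<forall>\<^sub>F y in nhds x. partial_differentiable j f y" for j
    by eventually_elim (auto simp: partial_differentiable_def real_differentiable_def intro: d1)
  moreover have "partial_differentiable j (partial_deriv j f) x" for j
    using d2[of j] by (auto simp: partial_differentiable_def real_differentiable_def)
  ultimately show "has_second_partials (gauss_mix N) x"
    by (auto simp: has_second_partials_def f_def)
  have "(norm x)\<^sup>2 = (\<Sum>j\<in>UNIV. (x $ j)\<^sup>2)"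
    unfolding power2_norm_eq_inner inner_vec_def by (simp add: power2_eq_square)
  then have nx: "(\<Sum>j\<in>UNIV. (x $ j / 2)\<^sup>2) = (norm x)\<^sup>2 / 4"
    by (simp add: power_divide sum_divide_distrib)
  have "laplacian f x = (\<Sum>j\<in>UNIV. A * (I (p + 2) ((norm x)\<^sup>2 / 4) * (x $ j / 2)\<^sup>2 - I (p + 1) ((norm x)\<^sup>2 / 4) / 2))"
    unfolding laplacian_def partial_deriv_def[of _ "partial_deriv _ f"]
    by (intro sum.cong refl DERIV_imp_deriv d2)
  \<comment> \<open>The squares of the coordinates of \<open>x / 2\<close> add up to
    \<open>b\<close>, and one term \<open>1 / 2\<close> per coordinate adds up to
    \<open>p\<close>.\<close>
  also have "\<dots> = A * ((norm x)\<^sup>2 / 4 * I (p + 2) ((norm x)\<^sup>2 / 4) - p * I (p + 1) ((norm x)\<^sup>2 / 4))"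
    by (simp add: sum_distrib_left[symmetric] sum_subtractf nx p_def)
  also have "\<dots> = (LINT s|N. dgauss x s)"
    using x p by (simp add: dgauss_def I_def A_def p_def ek_integrable_prob[OF N])
  finally show "laplacian (gauss_mix N) x = (LINT s|N. dgauss x s)"
    by (simp add: f_def)
qed

subsection \<open>Brownian motion at an independent time\<close>

text \<open>Cells of length \<open>1 / Suc k\<close> cover the interval from 0 to
  \<open>Suc k\<close>; beyond it the value is 0. The path is sampled at the right end of the cell
  because paths are only right-continuous. Written as a finite sum of indicators times fixed-time
  values, it lets measurability and independence act term by term.\<close>

definition disc :: "nat \<Rightarrow> (real \<Rightarrow> 'c::real_vector) \<Rightarrow> real \<Rightarrow> 'c" where
  "disc k y r = (\<Sum>i<(Suc k)\<^sup>2. indicator {real i / Suc k..<(real i + 1) / Suc k} r *\<^sub>R y ((real i + 1) / Suc k))"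

lemma disc_eq:
  assumes "r \<ge> 0"
  shows "disc k y r = (if nat \<lfloor>r * Suc k\<rfloor> < (Suc k)\<^sup>2 then y ((real (nat \<lfloor>r * Suc k\<rfloor>) + 1) / Suc k) else 0)"
proof -
  have *: "r \<in> {real i / Suc k..<(real i + 1) / Suc k} \<longleftrightarrow> i = nat \<lfloor>r * Suc k\<rfloor>" for i
  proof -
    have "r \<in> {real i / Suc k..<(real i + 1) / Suc k} \<longleftrightarrow> real i \<le> r * Suc k \<and> r * Suc k < real i + 1"
      by (auto simp: field_simps)
    also have "\<dots> \<longleftrightarrow> \<lfloor>r * Suc k\<rfloor> = int i" by linarith
    finally show ?thesis using assms by auto
  qed
  have "disc k y r = (\<Sum>i<(Suc k)\<^sup>2. if i = nat \<lfloor>r * Suc k\<rfloor> then y ((real i + 1) / Suc k) else 0)"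
    unfolding disc_def by (intro sum.cong refl) (simp only: indicator_def * split: if_split, simp)
  then show ?thesis by (simp add: sum.delta)
qed

lemma norm_disc_le:
  fixes y :: "real \<Rightarrow> 'c::real_normed_vector"
  assumes "r \<ge> 0" "\<And>s. s \<ge> 0 \<Longrightarrow> norm (y s) \<le> K"
  shows "norm (disc k y r) \<le> K"
  using assms(2)[of "(real (nat \<lfloor>r * Suc k\<rfloor>) + 1) / Suc k"] norm_ge_zero[THEN order_trans, OF assms(2)[OF order_refl]]
  by (auto simp: disc_eq[OF assms(1)])

lemma disc_tendsto:
  fixes y :: "real \<Rightarrow> 'c::real_normed_vector"
  assumes r: "r \<ge> 0" and rc: "continuous (at_right r) y"
  shows "(\<lambda>k. disc k y r) \<longlonglongrightarrow> y r"
proof -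
  define q where "q k = (real (nat \<lfloor>r * Suc k\<rfloor>) + 1) / Suc k" for k
  \<comment> \<open>The left inequality is strict, so that \<open>q k\<close> approaches
    \<open>r\<close> from the right and right-continuity suffices.\<close>
  have q: "r < q k" "q k \<le> r + 1 / Suc k" for k
  proof -
    have "r * Suc k \<ge> 0" using r by simp
    then have "r * Suc k < real (nat \<lfloor>r * Suc k\<rfloor>) + 1" "real (nat \<lfloor>r * Suc k\<rfloor>) \<le> r * Suc k"
      by linarith+
    then have "r < q k" "real (nat \<lfloor>r * Suc k\<rfloor>) / Suc k \<le> r"
      by (simp_all only: q_def pos_less_divide_eq pos_divide_le_eq of_nat_0_less_iff zero_less_Suc)
    then show "r < q k" "q k \<le> r + 1 / Suc k"
      unfolding q_def add_divide_distrib by simp_all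
  qed
  have "q \<longlonglongrightarrow> r"
  proof (rule tendsto_sandwich[of "\<lambda>_. r" _ _ "\<lambda>k. r + 1 / Suc k"])
    have "(\<lambda>k. r + 1 / Suc k) \<longlonglongrightarrow> r + 0"
      by (intro tendsto_intros LIMSEQ_Suc[OF lim_1_over_n])
    then show "(\<lambda>k. r + 1 / Suc k) \<longlonglongrightarrow> r" by simp
  qed (use q in \<open>auto intro: less_imp_le intro!: always_eventually\<close>)
  then have "filterlim q (at_right r) sequentially"
    by (intro tendsto_imp_filterlim_at_right eventuallyI q(1))
  then have "(\<lambda>k. y (q k)) \<longlonglongrightarrow> y r"
    using rc unfolding continuous_within by (rule filterlim_compose[rotated])
  moreover have "\<forall>\<^sub>F k in sequentially. y (q k) = disc k y r"
  proof -
    obtain k0 :: nat where k0: "r < k0" using reals_Archimedean2 by blast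
    have "nat \<lfloor>r * Suc k\<rfloor> < (Suc k)\<^sup>2" if "k \<ge> k0" for k
    proof -
      have "real (nat \<lfloor>r * Suc k\<rfloor>) \<le> r * Suc k" using r by (intro of_nat_floor) simp
      also have "\<dots> < real (Suc k) * Suc k" using that k0 by (intro mult_strict_right_mono) auto
      finally show ?thesis by (simp only: power2_eq_square of_nat_mult[symmetric] of_nat_less_iff)
    qed
    then show ?thesis
      unfolding eventually_sequentially by (intro exI[of _ k0]) (auto simp: disc_eq[OF r] q_def)
  qed
  ultimately show ?thesis by (rule Lim_transform_eventually)
qed

text \<open>Joint measurability in time and outcome is replaced by right-continuity of the paths:
  the composition is a pointwise limit of the sums \<open>disc\<close>.\<close>

lemma measurable_time_change:
  fixes Y :: "real \<Rightarrow> 'a \<Rightarrow> 'c::{banach, second_countable_topology}"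
  assumes [measurable]: "\<And>s. s \<ge> 0 \<Longrightarrow> Y s \<in> borel_measurable N" "R \<in> borel_measurable N"
    and R: "\<And>\<omega>. \<omega> \<in> space N \<Longrightarrow> R \<omega> \<ge> 0"
    and rc: "\<And>\<omega> s. \<omega> \<in> space N \<Longrightarrow> s \<ge> 0 \<Longrightarrow> continuous (at_right s) (\<lambda>s. Y s \<omega>)"
  shows "(\<lambda>\<omega>. Y (R \<omega>) \<omega>) \<in> borel_measurable N"
proof (rule borel_measurable_LIMSEQ_metric)
  show "(\<lambda>\<omega>. disc k (\<lambda>s. Y s \<omega>) (R \<omega>)) \<in> borel_measurable N" for k
    unfolding disc_def by measurable
  show "(\<lambda>k. disc k (\<lambda>s. Y s \<omega>) (R \<omega>)) \<longlonglongrightarrow> Y (R \<omega>) \<omega>" if "\<omega> \<in> space N" for \<omega>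
    by (rule disc_tendsto[OF R rc]) (use that R in auto)
qed

text \<open>This is conditioning on \<open>R\<close> without conditional expectations. For the
  discretised time the identity factorises cell by cell, which needs independence only at fixed
  times; both sides then converge boundedly. On the right this uses that \<open>\<psi>\<close>
  inherits right-continuity from the paths.\<close>

lemma (in prob_space) expectation_time_change:
  fixes Y :: "real \<Rightarrow> 'a \<Rightarrow> 'c::{real_normed_field, banach, second_countable_topology}"
  assumes Ym [measurable]: "\<And>s. s \<ge> 0 \<Longrightarrow> Y s \<in> borel_measurable M"
    and Rm [measurable]: "R \<in> borel_measurable M"
    and R: "\<And>\<omega>. \<omega> \<in> space M \<Longrightarrow> R \<omega> \<ge> 0"
    and rc: "\<And>\<omega> s. \<omega> \<in> space M \<Longrightarrow> s \<ge> 0 \<Longrightarrow> continuous (at_right s) (\<lambda>s. Y s \<omega>)"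
    and K: "\<And>\<omega> s. \<omega> \<in> space M \<Longrightarrow> s \<ge> 0 \<Longrightarrow> norm (Y s \<omega>) \<le> K"
    and indep: "\<And>A s. A \<in> sets borel \<Longrightarrow> s \<ge> 0 \<Longrightarrow>
       expectation (\<lambda>\<omega>. indicator A (R \<omega>) *\<^sub>R Y s \<omega>) = prob {\<omega>\<in>space M. R \<omega> \<in> A} *\<^sub>R expectation (Y s)"
  shows "expectation (\<lambda>\<omega>. Y (R \<omega>) \<omega>) = expectation (\<lambda>\<omega>. expectation (Y (R \<omega>)))"
proof -
  define \<psi> where "\<psi> s = expectation (Y s)" for s
  have intY: "integrable M (Y s)" if "s \<ge> 0" for s
    by (rule integrable_const_bound[where B=K]) (use that K in auto)
  have \<psi>K: "norm (\<psi> s) \<le> K" if "s \<ge> 0" for s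
  proof -
    have "norm (\<psi> s) \<le> expectation (\<lambda>_. K)"
      unfolding \<psi>_def
      by (rule order_trans[OF integral_norm_bound integral_mono]) (use that intY K in auto)
    then show ?thesis by (simp add: prob_space)
  qed
  have \<psi>rc: "continuous (at_right s) \<psi>" if s: "s \<ge> 0" for s
    unfolding continuous_within
  proof (rule tendsto_at_right_sequentially[where b="s + 1"])
    fix S assume S: "\<And>n. s < S n" "\<And>n. S n < s + 1" "decseq S" "S \<longlonglongrightarrow> s"
    show "(\<lambda>n. \<psi> (S n)) \<longlonglongrightarrow> \<psi> s"
      unfolding \<psi>_def
    proof (rule integral_dominated_convergence[where w="\<lambda>_. K"])
      have fl: "filterlim S (at_right s) sequentially"
        by (intro tendsto_imp_filterlim_at_right eventuallyI S)
      show "AE \<omega> in M. (\<lambda>n. Y (S n) \<omega>) \<longlonglongrightarrow> Y s \<omega>"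
        using rc[OF _ s] by (intro AE_I2) (auto simp: continuous_within intro: filterlim_compose[OF _ fl])
      show "AE \<omega> in M. norm (Y (S n) \<omega>) \<le> K" for n
        using K S(1)[of n] s by (intro AE_I2) auto
      show "Y (S n) \<in> borel_measurable M" for n
        using S(1)[of n] s by (intro Ym) auto
    qed (use s in auto)
  qed simp
  have "(\<lambda>k. expectation (\<lambda>\<omega>. disc k (\<lambda>s. Y s \<omega>) (R \<omega>))) \<longlonglongrightarrow> expectation (\<lambda>\<omega>. Y (R \<omega>) \<omega>)"
  proof (rule integral_dominated_convergence[where w="\<lambda>_. K"])
    show "(\<lambda>\<omega>. Y (R \<omega>) \<omega>) \<in> borel_measurable M"
      by (rule measurable_time_change) (use R rc in auto)
    show "(\<lambda>\<omega>. disc k (\<lambda>s. Y s \<omega>) (R \<omega>)) \<in> borel_measurable M" for k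
      unfolding disc_def by measurable
    show "AE \<omega> in M. (\<lambda>k. disc k (\<lambda>s. Y s \<omega>) (R \<omega>)) \<longlonglongrightarrow> Y (R \<omega>) \<omega>"
      by (intro AE_I2 disc_tendsto R rc)
    show "AE \<omega> in M. norm (disc k (\<lambda>s. Y s \<omega>) (R \<omega>)) \<le> K" for k
      by (intro AE_I2 norm_disc_le R K)
  qed simp
  moreover have "(\<lambda>k. expectation (\<lambda>\<omega>. disc k \<psi> (R \<omega>))) \<longlonglongrightarrow> expectation (\<lambda>\<omega>. \<psi> (R \<omega>))"
  proof (rule integral_dominated_convergence[where w="\<lambda>_. K"])
    have *: "\<And>\<omega>. \<omega> \<in> space M \<Longrightarrow> (\<lambda>k. disc k \<psi> (R \<omega>)) \<longlonglongrightarrow> \<psi> (R \<omega>)"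
      by (intro disc_tendsto R \<psi>rc)
    show **: "(\<lambda>\<omega>. disc k \<psi> (R \<omega>)) \<in> borel_measurable M" for k
      unfolding disc_def by measurable
    show "(\<lambda>\<omega>. \<psi> (R \<omega>)) \<in> borel_measurable M"
      by (rule borel_measurable_LIMSEQ_metric[OF **]) (rule *)
    show "AE \<omega> in M. (\<lambda>k. disc k \<psi> (R \<omega>)) \<longlonglongrightarrow> \<psi> (R \<omega>)"
      by (intro AE_I2 *)
    show "AE \<omega> in M. norm (disc k \<psi> (R \<omega>)) \<le> K" for k
      by (intro AE_I2 norm_disc_le R \<psi>K)
  qed simp
  moreover have "expectation (\<lambda>\<omega>. disc k (\<lambda>s. Y s \<omega>) (R \<omega>)) = expectation (\<lambda>\<omega>. disc k \<psi> (R \<omega>))" for k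
  proof -
    have sets: "{real i / Suc k..<(real i + 1) / Suc k} \<in> sets borel" for i by simp
    have i1: "integrable M (\<lambda>\<omega>. indicator {real i / Suc k..<(real i + 1) / Suc k} (R \<omega>) *\<^sub>R Y ((real i + 1) / Suc k) \<omega>)" for i
      by (rule integrable_const_bound[where B=K])
        (use K[of _ "(real i + 1) / Suc k"] norm_ge_zero[THEN order_trans, OF K[OF _ order_refl]] in \<open>auto simp: indicator_def\<close>)
    have i2: "integrable M (\<lambda>\<omega>. indicator {real i / Suc k..<(real i + 1) / Suc k} (R \<omega>) :: real)" for i
      by (rule integrable_const_bound[where B=1]) (auto simp: indicator_def)
    have e: "expectation (\<lambda>\<omega>. indicator A (R \<omega>) :: real) = prob {\<omega>\<in>space M. R \<omega> \<in> A}" if "A \<in> sets borel" for A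
    proof -
      have "expectation (\<lambda>\<omega>. indicator A (R \<omega>) :: real) = expectation (indicator {\<omega>\<in>space M. R \<omega> \<in> A})"
        by (intro Bochner_Integration.integral_cong) (auto simp: indicator_def)
      then show ?thesis using that by simp
    qed
    have "expectation (\<lambda>\<omega>. disc k (\<lambda>s. Y s \<omega>) (R \<omega>)) =
      (\<Sum>i<(Suc k)\<^sup>2. expectation (\<lambda>\<omega>. indicator {real i / Suc k..<(real i + 1) / Suc k} (R \<omega>) *\<^sub>R Y ((real i + 1) / Suc k) \<omega>))"
      unfolding disc_def by (rule Bochner_Integration.integral_sum) (rule i1)
    also have "\<dots> = (\<Sum>i<(Suc k)\<^sup>2. expectation (\<lambda>\<omega>. indicator {real i / Suc k..<(real i + 1) / Suc k} (R \<omega>) *\<^sub>R \<psi> ((real i + 1) / Suc k)))"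
      by (intro sum.cong refl, subst indep[OF sets], simp, subst integral_scaleR_left[OF i2], subst e[OF sets]) (simp only: \<psi>_def)
    also have "\<dots> = expectation (\<lambda>\<omega>. disc k \<psi> (R \<omega>))"
      unfolding disc_def by (rule Bochner_Integration.integral_sum[symmetric]) (intro integrable_scaleR_left i2)
    finally show ?thesis .
  qed
  ultimately show ?thesis
    using LIMSEQ_unique by (fastforce simp: \<psi>_def)
qed

lemma (in prob_space) expectation_indep_indicator:
  fixes Y :: "'a \<Rightarrow> 'c::{real_normed_field, banach, second_countable_topology}"
  assumes ind: "indep_set (sets N1) (sets N2)" and sp: "space N1 = space M" "space N2 = space M"
    and R: "R \<in> borel_measurable N1" and Y: "Y \<in> borel_measurable N2" and int: "integrable M Y"
    and A[measurable]: "A \<in> sets (borel :: 'd::topological_space measure)"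
  shows "expectation (\<lambda>\<omega>. indicator A (R \<omega>) *\<^sub>R Y \<omega>) = prob {\<omega>\<in>space M. R \<omega> \<in> A} *\<^sub>R expectation Y"
proof -
  \<comment> \<open>The indicator is embedded into the field of \<open>Y\<close>, because the
    product formula for independent variables takes both factors in one type.\<close>
  define X where "X \<omega> = (of_real (indicator A (R \<omega>)) :: 'c)" for \<omega>
  have Xm: "X \<in> borel_measurable N1" unfolding X_def using R by measurable
  have sub: "sets N1 \<subseteq> events" "sets N2 \<subseteq> events"
    using ind by (auto simp: indep_sets2_eq)
  have Rm: "R \<in> borel_measurable M" using R sub(1) sp(1) by (auto simp: measurable_def)
  have XM: "X \<in> borel_measurable M" using Xm sub(1) sp(1) by (auto simp: measurable_def)
  have YM: "Y \<in> borel_measurable M" using Y sub(2) sp(2) by (auto simp: measurable_def)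
  have i: "indep_var borel X borel Y"
    unfolding indep_var_eq
  proof (intro conjI XM YM)
    have "sigma_sets (space M) {X -` A \<inter> space M |A. A \<in> sets borel} \<subseteq> sets N1"
      using Xm sp(1) sets.sigma_sets_subset[of "{X -` A \<inter> space M |A. A \<in> sets borel}" N1]
      by (auto simp: measurable_def)
    moreover have "sigma_sets (space M) {Y -` A \<inter> space M |A. A \<in> sets borel} \<subseteq> sets N2"
      using Y sp(2) sets.sigma_sets_subset[of "{Y -` A \<inter> space M |A. A \<in> sets borel}" N2]
      by (auto simp: measurable_def)
    ultimately show "indep_set (sigma_sets (space M) {X -` A \<inter> space M |A. A \<in> sets borel})
        (sigma_sets (space M) {Y -` A \<inter> space M |A. A \<in> sets borel})"
      using ind unfolding indep_sets2_eq by blast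
  qed
  have iX: "integrable M X"
    by (rule integrable_const_bound[where B=1]) (auto simp: X_def indicator_def XM)
  have "expectation (\<lambda>\<omega>. X \<omega> * Y \<omega>) = expectation X * expectation Y"
    by (rule indep_var_lebesgue_integral[OF i iX int])
  moreover have "expectation X = of_real (prob {\<omega>\<in>space M. R \<omega> \<in> A})"
  proof -
    note [measurable] = Rm
    have ev [simp]: "{\<omega>\<in>space M. R \<omega> \<in> A} \<in> events" by measurable
    have "expectation X = expectation (\<lambda>\<omega>. of_real (indicator {\<omega>\<in>space M. R \<omega> \<in> A} \<omega>))"
      by (intro Bochner_Integration.integral_cong) (auto simp: indicator_def X_def)
    also have "\<dots> = of_real (expectation (indicator {\<omega>\<in>space M. R \<omega> \<in> A}))"
      by (rule integral_of_real, rule integrable_real_indicator) (simp_all add: emeasure_eq_measure)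
    finally show ?thesis by simp
  qed
  ultimately show ?thesis by (simp add: X_def scaleR_conv_of_real)
qed

subsection \<open>Iterated subordinators and their inverses\<close>

lemma at_right_continuous_iff: "continuous (at_right x) f \<longleftrightarrow> continuous (at x within {x..}) f"
  for f :: "real \<Rightarrow> 'b::topological_space"
  by (simp add: at_within_Ici_at_right)

lemma iterated_subordinator_path:
  fixes S :: "nat \<Rightarrow> real \<Rightarrow> 'a \<Rightarrow> real"
  assumes S: "\<And>k. k \<ge> 1 \<Longrightarrow> S k 0 \<omega> = 0 \<and> mono_on {0..} (\<lambda>t. S k t \<omega>) \<and> (\<forall>t\<ge>0. continuous (at_right t) (\<lambda>s. S k s \<omega>))"
  shows "iterated_subordinator S r 0 \<omega> = 0 \<and> mono_on {0..} (\<lambda>t. iterated_subordinator S r t \<omega>) \<and>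
    (\<forall>t\<ge>0. continuous (at_right t) (\<lambda>s. iterated_subordinator S r s \<omega>))"
proof (induction r)
  case 0
  then show ?case by (auto simp: mono_on_def)
next
  case (Suc r)
  have S0: "S (Suc r) 0 \<omega> = 0" and Sm: "mono_on {0..} (\<lambda>t. S (Suc r) t \<omega>)"
    and Sc: "\<And>t. t \<ge> 0 \<Longrightarrow> continuous (at t within {t..}) (\<lambda>s. S (Suc r) s \<omega>)"
    using S[of "Suc r"] by (auto simp: at_right_continuous_iff)
  have nn: "S (Suc r) t \<omega> \<ge> 0" if "t \<ge> 0" for t
    using mono_onD[OF Sm, of 0 t] S0 that by simp
  have "mono_on {0..} (\<lambda>t. iterated_subordinator S (Suc r) t \<omega>)"
    using Suc.IH Sm nn by (auto simp: mono_on_def)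
  moreover have "continuous (at_right t) (\<lambda>s. iterated_subordinator S (Suc r) s \<omega>)" if t: "t \<ge> 0" for t
  proof -
    have "continuous (at (S (Suc r) t \<omega>) within {S (Suc r) t \<omega>..}) (\<lambda>s. iterated_subordinator S r s \<omega>)"
      using Suc.IH nn[OF t] by (simp add: at_right_continuous_iff)
    \<comment> \<open>Monotonicity of the inner path sends times to the right of \<open>t\<close> to
      values to the right of \<open>S (Suc r) t \<omega>\<close>, so right-continuity of the outer
      path is enough.\<close>
    then have "continuous (at (S (Suc r) t \<omega>) within (\<lambda>s. S (Suc r) s \<omega>) ` {t..}) (\<lambda>s. iterated_subordinator S r s \<omega>)"
      by (rule continuous_within_subset) (use mono_onD[OF Sm] t in auto)
    from continuous_within_compose2[OF Sc[OF t] this] show ?thesis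
      by (simp add: at_right_continuous_iff)
  qed
  ultimately show ?case using Suc.IH S0 by simp
qed

section \<open>The weighted sum of iterated subordinators and its Laplace transform\<close>

locale clock = prob_space M for M :: "'a measure" +
  fixes m :: nat and \<nu> lam :: "nat \<Rightarrow> real" and H :: "nat \<Rightarrow> nat \<Rightarrow> real \<Rightarrow> 'a \<Rightarrow> real"
  assumes m: "m \<ge> 1"
    and \<nu>: "\<And>j. j \<in> {1..m} \<Longrightarrow> 0 < \<nu> j \<and> \<nu> j < 1"
    and lam: "\<And>j. j \<in> {1..m} \<Longrightarrow> lam j > 0"
    and sub: "\<And>k j. k \<ge> 1 \<Longrightarrow> j \<in> {1..m} \<Longrightarrow> stable_subordinator M (\<nu> j) (H k j)"
    and ind: "indep_vars (\<lambda>_. PiM {0..} (\<lambda>_. borel))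
           (\<lambda>(k, j) \<omega>. \<lambda>s\<in>{0..}. H k j s \<omega>) ({1..} \<times> {1..m})"
begin

definition T :: "nat \<Rightarrow> nat \<Rightarrow> real \<Rightarrow> 'a \<Rightarrow> real" where
  "T j = iterated_subordinator (\<lambda>k. H k j)"

definition path_sets :: "nat \<times> nat \<Rightarrow> 'a set set" where
  "path_sets i = {(case i of (k, j) \<Rightarrow> \<lambda>\<omega>. \<lambda>s\<in>{0..}. H k j s \<omega>) -` A \<inter> space M |A. A \<in> sets (PiM {0..} (\<lambda>_. borel))}"

text \<open>Generated by whole paths: an iterate reads its outer paths at random times, so it
  depends on all their times at once.\<close>

definition history :: "(nat \<times> nat) set \<Rightarrow> 'a measure" where
  "history K = sigma (space M) (\<Union>i\<in>K. path_sets i)"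

lemma indep_path_sets: "indep_sets path_sets ({1..} \<times> {1..m})"
  using ind unfolding indep_vars_def2 path_sets_def[abs_def] by (rule conjunct2)

lemma Int_stable_path_sets: "Int_stable (path_sets i)"
proof (rule Int_stableI)
  fix a b assume "a \<in> path_sets i" "b \<in> path_sets i"
  then obtain A B where A: "A \<in> sets (PiM {0..} (\<lambda>_. borel))" "a = (case i of (k, j) \<Rightarrow> \<lambda>\<omega>. \<lambda>s\<in>{0..}. H k j s \<omega>) -` A \<inter> space M"
    and B: "B \<in> sets (PiM {0..} (\<lambda>_. borel))" "b = (case i of (k, j) \<Rightarrow> \<lambda>\<omega>. \<lambda>s\<in>{0..}. H k j s \<omega>) -` B \<inter> space M"
    by (auto simp: path_sets_def)
  have AB: "A \<inter> B \<in> sets (PiM {0..} (\<lambda>_. borel))" using A(1) B(1) by (rule sets.Int)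
  show "a \<inter> b \<in> path_sets i"
    unfolding path_sets_def A(2) B(2) mem_Collect_eq
    by (rule exI[of _ "A \<inter> B"]) (simp only: AB vimage_Int Int_ac Int_left_absorb simp_thms)
qed

lemma space_history [simp]: "space (history K) = space M"
  by (simp add: history_def space_measure_of_conv)

lemma sets_history: "sets (history K) = sigma_sets (space M) (\<Union>i\<in>K. path_sets i)"
  unfolding history_def by (rule sets_measure_of) (auto simp: path_sets_def)

lemma H_measurable_history:
  assumes "(k, j) \<in> K" "s \<ge> 0"
  shows "H k j s \<in> borel_measurable (history K)"
proof (rule measurableI)
  fix A :: "real set" assume A: "A \<in> sets borel"
  let ?A = "(\<lambda>f. f s) -` A \<inter> space (PiM {0..} (\<lambda>_. borel))"
  have "(\<lambda>f. f s) \<in> measurable (PiM {0..} (\<lambda>_. borel)) borel"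
    by (rule measurable_component_singleton) (use assms in simp)
  then have "?A \<in> sets (PiM {0..} (\<lambda>_. borel))" using A by (rule measurable_sets)
  then have "(\<lambda>\<omega>. \<lambda>s\<in>{0..}. H k j s \<omega>) -` ?A \<inter> space M \<in> path_sets (k, j)"
    unfolding path_sets_def mem_Collect_eq prod.case by (intro exI[of _ ?A] conjI refl)
  moreover have "(\<lambda>\<omega>. \<lambda>s\<in>{0..}. H k j s \<omega>) -` ?A \<inter> space M = H k j s -` A \<inter> space M"
    using assms(2) by (auto simp: space_PiM PiE_def)
  ultimately have "H k j s -` A \<inter> space M \<in> path_sets (k, j)" by simp
  then show "H k j s -` A \<inter> space (history K) \<in> sets (history K)"
    unfolding sets_history space_history by (intro sigma_sets.Basic UN_I[OF assms(1)])
qed simp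

lemma indep_history:
  assumes "disjoint_family_on I J" "\<And>j. j \<in> J \<Longrightarrow> I j \<subseteq> {1..} \<times> {1..m}"
  shows "indep_sets (\<lambda>j. sets (history (I j))) J"
  unfolding sets_history
  by (rule indep_sets_collect_sigma[OF indep_sets_mono_index[OF _ indep_path_sets] Int_stable_path_sets assms(1)])
     (use assms(2) in auto)

lemma indep_set_history:
  assumes "I1 \<inter> I2 = {}" "I1 \<subseteq> {1..} \<times> {1..m}" "I2 \<subseteq> {1..} \<times> {1..m}"
  shows "indep_set (sets (history I1)) (sets (history I2))"
proof -
  have "indep_sets (\<lambda>b. sets (history (case_bool I1 I2 b))) UNIV"
  proof (rule indep_history)
    show "disjoint_family_on (case_bool I1 I2) UNIV"
      unfolding disjoint_family_on_def
    proof (intro ballI impI)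
      fix a b :: bool assume "a \<noteq> b"
      then show "case_bool I1 I2 a \<inter> case_bool I1 I2 b = {}"
        using assms(1) by (cases a; cases b) (simp_all add: Int_commute)
    qed
    show "case_bool I1 I2 b \<subseteq> {1..} \<times> {1..m}" for b
      by (cases b) (use assms in simp_all)
  qed
  moreover have "(\<lambda>b. sets (history (case_bool I1 I2 b))) = case_bool (sets (history I1)) (sets (history I2))"
    by (auto split: bool.splits)
  ultimately show ?thesis by (simp add: indep_set_def)
qed

lemma T_path:
  assumes "j \<in> {1..m}" "\<omega> \<in> space M"
  shows "T j r 0 \<omega> = 0" "mono_on {0..} (\<lambda>t. T j r t \<omega>)" "t \<ge> 0 \<Longrightarrow> continuous (at_right t) (\<lambda>s. T j r s \<omega>)"
    "t \<ge> 0 \<Longrightarrow> 0 \<le> T j r t \<omega>"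
proof -
  have "H k j 0 \<omega> = 0 \<and> mono_on {0..} (\<lambda>t. H k j t \<omega>) \<and> (\<forall>t\<ge>0. continuous (at_right t) (\<lambda>s. H k j s \<omega>))" if "k \<ge> 1" for k
    using sub[OF that assms(1)] assms(2) unfolding stable_subordinator_def by blast
  then have *: "T j r 0 \<omega> = 0 \<and> mono_on {0..} (\<lambda>t. T j r t \<omega>) \<and>
    (\<forall>t\<ge>0. continuous (at_right t) (\<lambda>s. T j r s \<omega>))"
    unfolding T_def by (rule iterated_subordinator_path)
  show "T j r 0 \<omega> = 0" "mono_on {0..} (\<lambda>t. T j r t \<omega>)" "t \<ge> 0 \<Longrightarrow> continuous (at_right t) (\<lambda>s. T j r s \<omega>)"
    using * by blast+
  then show "t \<ge> 0 \<Longrightarrow> 0 \<le> T j r t \<omega>"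
    using mono_onD[of "{0..}" "\<lambda>t. T j r t \<omega>" 0 t] by simp
qed

lemma H_nonneg: "k \<ge> 1 \<Longrightarrow> j \<in> {1..m} \<Longrightarrow> \<omega> \<in> space M \<Longrightarrow> t \<ge> 0 \<Longrightarrow> 0 \<le> H k j t \<omega>"
  using sub[of k j] mono_onD[of "{0..}" "\<lambda>t. H k j t \<omega>" 0 t] unfolding stable_subordinator_def by fastforce

text \<open>The \<open>r\<close>-fold iterate uses only the layers up to \<open>r\<close> of its own
  index \<open>j\<close>. Hence it is independent of the next layer, which drives the induction for
  the transform, and of the iterates with other indices.\<close>

lemma T_measurable_history:
  assumes "j \<in> {1..m}" "s \<ge> 0"
  shows "T j r s \<in> borel_measurable (history ({1..r} \<times> {j}))"
  using assms(2)
proof (induction r arbitrary: s)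
  case 0
  then show ?case by (simp add: T_def)
next
  case (Suc r)
  have mono: "f \<in> borel_measurable (history ({1..Suc r} \<times> {j}))" if "f \<in> borel_measurable (history ({1..r} \<times> {j}))" for f :: "'a \<Rightarrow> real"
  proof -
    have "(\<Union>i\<in>{1..r} \<times> {j}. path_sets i) \<subseteq> (\<Union>i\<in>{1..Suc r} \<times> {j}. path_sets i)"
      by (intro UN_mono) auto
    then have "sets (history ({1..r} \<times> {j})) \<subseteq> sets (history ({1..Suc r} \<times> {j}))"
      unfolding sets_history by (intro sigma_sets_mono') auto
    then show ?thesis using that by (auto simp: measurable_def)
  qed
  have "(\<lambda>\<omega>. T j r (H (Suc r) j s \<omega>) \<omega>) \<in> borel_measurable (history ({1..Suc r} \<times> {j}))"
  proof (rule measurable_time_change[where Y="T j r" and R="H (Suc r) j s"])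
    show "H (Suc r) j s \<in> borel_measurable (history ({1..Suc r} \<times> {j}))"
      using Suc.prems by (intro H_measurable_history) auto
    show "T j r u \<in> borel_measurable (history ({1..Suc r} \<times> {j}))" if "u \<ge> 0" for u
      by (rule mono[OF Suc.IH[OF that]])
    show "0 \<le> H (Suc r) j s \<omega>" if "\<omega> \<in> space (history ({1..Suc r} \<times> {j}))" for \<omega>
      using that by (intro H_nonneg assms(1) Suc.prems) simp_all
    show "continuous (at_right u) (\<lambda>u. T j r u \<omega>)"
      if "\<omega> \<in> space (history ({1..Suc r} \<times> {j}))" "u \<ge> 0" for u \<omega>
      using that by (intro T_path(3) assms(1)) simp_all
  qed
  moreover have "T j (Suc r) s = (\<lambda>\<omega>. T j r (H (Suc r) j s \<omega>) \<omega>)"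
    by (rule ext) (simp add: T_def)
  ultimately show ?case by simp
qed

lemma history_le: "K \<subseteq> {1..} \<times> {1..m} \<Longrightarrow> f \<in> measurable (history K) N \<Longrightarrow> f \<in> measurable M N"
proof -
  assume K: "K \<subseteq> {1..} \<times> {1..m}" and f: "f \<in> measurable (history K) N"
  have "(\<Union>i\<in>K. path_sets i) \<subseteq> events"
    using indep_path_sets K unfolding indep_sets_def by blast
  then have "sets (history K) \<subseteq> events"
    unfolding sets_history by (rule sets.sigma_sets_subset)
  then show ?thesis using f by (auto simp: measurable_def)
qed

lemma T_measurable: "j \<in> {1..m} \<Longrightarrow> s \<ge> 0 \<Longrightarrow> T j r s \<in> borel_measurable M"
  by (rule history_le[OF _ T_measurable_history]) auto

text \<open>The induction peels off the innermost subordinator. Given its value \<open>u\<close>,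
  the remaining iterate contributes \<open>exp (- u * \<mu> powr (\<nu> j ^ r))\<close>, and
  averaging over \<open>u\<close> is the transform of one stable subordinator at
  \<open>\<mu> powr (\<nu> j ^ r)\<close>.\<close>

lemma T_laplace:
  assumes j: "j \<in> {1..m}" and "s \<ge> 0" "\<mu> > 0"
  shows "expectation (\<lambda>\<omega>. exp (- \<mu> * T j r s \<omega>)) = exp (- s * \<mu> powr (\<nu> j ^ r))"
  using assms(2)
proof (induction r arbitrary: s)
  case 0
  then show ?case using \<open>\<mu> > 0\<close> by (simp add: T_def prob_space mult.commute)
next
  case (Suc r)
  let ?a = "\<nu> j ^ r"
  have \<nu>j: "0 < \<nu> j" "\<nu> j < 1" using \<nu>[OF j] by auto
  have "expectation (\<lambda>\<omega>. exp (- \<mu> * T j r (H (Suc r) j s \<omega>) \<omega>)) =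
     expectation (\<lambda>\<omega>. expectation (\<lambda>\<omega>'. exp (- \<mu> * T j r (H (Suc r) j s \<omega>) \<omega>')))"
  proof (rule expectation_time_change[where Y="\<lambda>u \<omega>. exp (- \<mu> * T j r u \<omega>)" and K=1])
    show "H (Suc r) j s \<in> borel_measurable M"
      using sub[of "Suc r" j] j Suc.prems by (auto simp: stable_subordinator_def)
    fix A :: "real set" and u :: real assume A: "A \<in> sets borel" and u: "u \<ge> 0"
    note [measurable] = T_measurable_history[OF j u]
    have i: "indep_set (sets (history ({Suc r} \<times> {j}))) (sets (history ({1..r} \<times> {j})))"
      by (rule indep_set_history) (use j in auto)
    show "expectation (\<lambda>\<omega>. indicator A (H (Suc r) j s \<omega>) *\<^sub>R exp (- \<mu> * T j r u \<omega>)) =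
        prob {\<omega> \<in> space M. H (Suc r) j s \<omega> \<in> A} *\<^sub>R expectation (\<lambda>\<omega>. exp (- \<mu> * T j r u \<omega>))"
    proof (rule expectation_indep_indicator[OF i _ _ _ _ _ A])
      show "H (Suc r) j s \<in> borel_measurable (history ({Suc r} \<times> {j}))"
        using Suc.prems by (intro H_measurable_history) auto
      show "integrable M (\<lambda>\<omega>. exp (- \<mu> * T j r u \<omega>))"
        using T_path(4)[OF j _ u] T_measurable[OF j u] \<open>\<mu> > 0\<close>
        by (intro integrable_const_bound[where B=1]) auto
    qed (simp, simp, measurable)
  qed (use T_path(3,4)[OF j] T_measurable[OF j] H_nonneg[OF _ j] Suc.prems \<open>\<mu> > 0\<close> in \<open>auto intro!: continuous_intros\<close>)
  also have "\<dots> = expectation (\<lambda>\<omega>. exp (- (\<mu> powr ?a) * H (Suc r) j s \<omega>))"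
    by (intro Bochner_Integration.integral_cong refl) (subst Suc.IH, use H_nonneg[OF _ j _ Suc.prems] in \<open>auto simp: mult.commute\<close>)
  also have "\<dots> = exp (- s * (\<mu> powr ?a) powr \<nu> j)"
  \<comment> \<open>A stable subordinator has its transform prescribed for positive times only; time
    0 uses that the path starts at 0.\<close>
  proof (cases "s = 0")
    case True
    have "expectation (\<lambda>\<omega>. exp (- (\<mu> powr ?a) * H (Suc r) j s \<omega>)) = expectation (\<lambda>_. 1)"
      by (intro Bochner_Integration.integral_cong refl)
         (use sub[of "Suc r" j] j True in \<open>auto simp: stable_subordinator_def\<close>)
    then show ?thesis using True by (simp add: prob_space)
  next
    case False
    then show ?thesis using sub[of "Suc r" j] j Suc.prems \<open>\<mu> > 0\<close> by (auto simp: stable_subordinator_def)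
  qed
  finally show ?case
    by (simp add: T_def powr_powr mult.commute)
qed

definition HH :: "nat \<Rightarrow> real \<Rightarrow> 'a \<Rightarrow> real" where
  "HH r = weighted_sum_process m lam \<nu> H r"

definition Phi :: "nat \<Rightarrow> real \<Rightarrow> real" where
  "Phi r \<mu> = (\<Sum>j=1..m. lam j * \<mu> powr (\<nu> j ^ r))"

lemma HH_eq: "HH r s \<omega> = (\<Sum>j=1..m. lam j powr (1 / \<nu> j ^ r) * T j r s \<omega>)"
  by (simp add: HH_def weighted_sum_process_def T_def)

lemma HH_measurable: "s \<ge> 0 \<Longrightarrow> HH r s \<in> borel_measurable M"
  unfolding HH_eq[abs_def] by (intro borel_measurable_sum borel_measurable_times T_measurable) auto

lemma HH_path:
  assumes "\<omega> \<in> space M"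
  shows "HH r 0 \<omega> = 0" "mono_on {0..} (\<lambda>t. HH r t \<omega>)" "t \<ge> 0 \<Longrightarrow> continuous (at_right t) (\<lambda>s. HH r s \<omega>)"
    "t \<ge> 0 \<Longrightarrow> 0 \<le> HH r t \<omega>"
proof -
  show "HH r 0 \<omega> = 0"
    unfolding HH_eq by (intro sum.neutral ballI) (simp only: T_path(1)[OF _ assms] mult_zero_right)
  show "mono_on {0..} (\<lambda>t. HH r t \<omega>)"
    unfolding HH_eq
  proof (intro mono_onI sum_mono mult_left_mono)
    fix a b :: real and j assume "a \<in> {0..}" "b \<in> {0..}" "a \<le> b" "j \<in> {1..m}"
    then show "T j r a \<omega> \<le> T j r b \<omega>"
      using T_path(2)[OF _ assms] by (auto simp: mono_on_def)
  qed simp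
  show "t \<ge> 0 \<Longrightarrow> continuous (at_right t) (\<lambda>s. HH r s \<omega>)"
    unfolding HH_eq by (intro continuous_sum continuous_mult continuous_const T_path(3)[OF _ assms])
  show "t \<ge> 0 \<Longrightarrow> 0 \<le> HH r t \<omega>"
    unfolding HH_eq by (intro sum_nonneg mult_nonneg_nonneg T_path(4)[OF _ assms]) simp_all
qed

text \<open>Different \<open>j\<close> use disjoint sets of paths, so the transform is a product.
  The weight \<open>lam j powr (1 / \<nu> j ^ r)\<close>, raised to the order
  \<open>\<nu> j ^ r\<close> of the iterate, gives back \<open>lam j\<close>.\<close>

lemma HH_laplace:
  assumes s: "s \<ge> 0" and \<mu>: "\<mu> > 0"
  shows "expectation (\<lambda>\<omega>. exp (- \<mu> * HH r s \<omega>)) = exp (- s * Phi r \<mu>)"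
proof -
  let ?c = "\<lambda>j. lam j powr (1 / \<nu> j ^ r)"
  have "indep_vars (\<lambda>_. borel) (\<lambda>j. T j r s) {1..m}"
    unfolding indep_vars_def2
  proof (intro conjI ballI)
    have "indep_sets (\<lambda>j. sets (history ({1..r} \<times> {j}))) {1..m}"
      by (rule indep_history) (auto simp: disjoint_family_on_def)
    then show "indep_sets (\<lambda>j. {T j r s -` A \<inter> space M |A. A \<in> sets borel}) {1..m}"
    proof (rule indep_sets_mono_sets)
      fix j assume "j \<in> {1..m}"
      then show "{T j r s -` A \<inter> space M |A. A \<in> sets borel} \<subseteq> sets (history ({1..r} \<times> {j}))"
        using measurable_sets[OF T_measurable_history[OF _ s, of j r]] by auto
    qed
  qed (use T_measurable s in auto)
  then have i: "indep_vars (\<lambda>_. borel) (\<lambda>j \<omega>. exp (- (\<mu> * ?c j) * T j r s \<omega>)) {1..m}"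
    by (rule indep_vars_compose2) measurable
  have int: "integrable M (\<lambda>\<omega>. exp (- (\<mu> * ?c j) * T j r s \<omega>))" if "j \<in> {1..m}" for j
    using T_path(4)[OF that _ s] T_measurable[OF that s] \<mu>
    by (intro integrable_const_bound[where B=1]) auto
  have "expectation (\<lambda>\<omega>. exp (- \<mu> * HH r s \<omega>)) = expectation (\<lambda>\<omega>. \<Prod>j=1..m. exp (- (\<mu> * ?c j) * T j r s \<omega>))"
    by (simp add: HH_eq exp_sum[symmetric] sum_distrib_left sum_negf mult.assoc)
  also have "\<dots> = (\<Prod>j=1..m. expectation (\<lambda>\<omega>. exp (- (\<mu> * ?c j) * T j r s \<omega>)))"
    by (rule indep_vars_lebesgue_integral) (use i int in auto)
  also have "\<dots> = (\<Prod>j=1..m. exp (- s * (lam j * \<mu> powr (\<nu> j ^ r))))"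
  proof (rule prod.cong[OF refl])
    fix j assume j: "j \<in> {1..m}"
    have "\<mu> * ?c j > 0" using \<mu> lam[OF j] by simp
    then show "expectation (\<lambda>\<omega>. exp (- (\<mu> * ?c j) * T j r s \<omega>)) = exp (- s * (lam j * \<mu> powr (\<nu> j ^ r)))"
      using T_laplace[OF j s, of "\<mu> * ?c j" r] \<mu> lam[OF j] \<nu>[OF j]
      by (simp add: powr_mult powr_powr mult.commute)
  qed
  also have "\<dots> = exp (- s * Phi r \<mu>)"
    by (simp add: Phi_def exp_sum[symmetric] sum_distrib_left sum_negf)
  finally show ?thesis .
qed

end

section \<open>First passage: the tails of the clock\<close>

text \<open>The indicator of \<open>x < t\<close> lies below \<open>exp (\<mu> * (t - x))\<close>,
  and \<open>exp (- \<mu> * x)\<close> lies below that indicator plus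
  \<open>exp (- \<mu> * t)\<close> for \<open>x \<ge> 0\<close>. The freedom in \<mu> is used with
  \<mu> near 0, \<mu> large, \<open>\<mu> = 1\<close> and \<open>\<mu> = 1 / t\<close>.\<close>

lemma laplace_lower_tail:
  assumes D: "prob_space D" "sets D = sets borel" "AE x in D. 0 \<le> x" and \<mu>: "\<mu> > 0"
  shows "measure D {..<t} \<le> exp (\<mu> * t) * (LINT x|D. exp (- \<mu> * x))"
    and "(LINT x|D. exp (- \<mu> * x)) \<le> measure D {..<t} + exp (- \<mu> * t)"
proof -
  interpret D: prob_space D by fact
  note [measurable_cong] = D(2)
  have int: "integrable D (\<lambda>x. exp (- \<mu> * x))"
    by (rule D.integrable_const_bound[where B=1]) (use D(3) \<mu> in auto)
  have int2: "integrable D (\<lambda>x. exp (\<mu> * t) * exp (- \<mu> * x))"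
    using int by (rule integrable_mult_right)
  have inti: "integrable D (indicator {..<t} :: real \<Rightarrow> real)"
    by (rule integrable_real_indicator) (auto simp: D.emeasure_eq_measure)
  have m: "(LINT x|D. indicator {..<t} x) = measure D {..<t}" 
    using sets_eq_imp_space_eq[OF D(2)] by simp
  have "(LINT x|D. indicator {..<t} x) \<le> (LINT x|D. exp (\<mu> * t) * exp (- \<mu> * x))"
    using \<mu> by (intro integral_mono inti int2) (auto simp: indicator_def exp_add[symmetric])
  then show "measure D {..<t} \<le> exp (\<mu> * t) * (LINT x|D. exp (- \<mu> * x))"
    unfolding m by simp
  have "(LINT x|D. exp (- \<mu> * x)) \<le> (LINT x|D. indicator {..<t} x + exp (- \<mu> * t))"
  proof (rule integral_mono_AE)
    show "AE x in D. exp (- \<mu> * x) \<le> indicator {..<t} x + exp (- \<mu> * t)"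
      using D(3)
    proof eventually_elim
      case (elim x)
      then show ?case using \<mu> by (auto simp: indicator_def add_increasing2)
    qed
  qed (use int inti in auto)
  also have "\<dots> = measure D {..<t} + exp (- \<mu> * t)"
    using inti m by (simp add: D.prob_space)
  finally show "(LINT x|D. exp (- \<mu> * x)) \<le> measure D {..<t} + exp (- \<mu> * t)" .
qed

lemma inverse_process_nonneg: "0 \<le> inverse_process S t \<omega>"
  by (auto simp: inverse_process_def intro!: cInf_greatest)

text \<open>Right-continuity gives the strict inequality: a path below the level at \<open>s\<close>
  stays below it for some time after \<open>s\<close>.\<close>

lemma inverse_process_greater_iff:
  assumes "S 0 \<omega> = 0" "mono_on {0..} (\<lambda>s. S s \<omega>)" "\<And>s. s \<ge> 0 \<Longrightarrow> continuous (at_right s) (\<lambda>s. S s \<omega>)"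
    and t: "t > 0" and s: "s \<ge> 0" and ex: "\<exists>s>0. t \<le> S s \<omega>"
  shows "s < inverse_process S t \<omega> \<longleftrightarrow> S s \<omega> < t"
proof -
  define E where "E = {s. 0 < s \<and> t \<le> S s \<omega>}"
  have E: "E \<noteq> {}" using ex by (auto simp: E_def)
  have inv: "inverse_process S t \<omega> = Inf E" using ex by (simp add: inverse_process_def E_def)
  show ?thesis
  proof
    assume less: "S s \<omega> < t"
    have "((\<lambda>s. S s \<omega>) \<longlongrightarrow> S s \<omega>) (at_right s)"
      using assms(3)[OF s] by (simp add: continuous_within)
    then have "\<forall>\<^sub>F s' in at_right s. S s' \<omega> < t"
      using less by (rule order_tendstoD)
    then obtain b where b: "b > s" "\<And>y. y > s \<Longrightarrow> y < b \<Longrightarrow> S y \<omega> < t"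
      unfolding eventually_at_right_field by blast
    \<comment> \<open>The midpoint separates the infimum from \<open>s\<close>; any point strictly
      between \<open>s\<close> and \<open>b\<close> would do.\<close>
    have "(s + b) / 2 \<le> Inf E"
    proof (rule cInf_greatest[OF E])
      fix y assume "y \<in> E"
      then have y: "0 < y" "t \<le> S y \<omega>" by (auto simp: E_def)
      show "(s + b) / 2 \<le> y"
      proof (rule ccontr)
        assume "\<not> (s + b) / 2 \<le> y"
        then have "S y \<omega> \<le> S ((s + b) / 2) \<omega>"
          using assms(2) y s b(1) by (auto simp: mono_on_def)
        moreover have "S ((s + b) / 2) \<omega> < t" by (rule b(2)) (use b(1) in auto)
        ultimately show False using y by simp
      qed
    qed
    then show "s < inverse_process S t \<omega>" using b(1) inv by simp
  next
    assume "s < inverse_process S t \<omega>"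
    show "S s \<omega> < t"
    proof (rule ccontr)
      assume "\<not> S s \<omega> < t"
      then have "s \<in> E" using assms(1) t s by (cases "s = 0") (auto simp: E_def)
      then have "Inf E \<le> s" by (rule cInf_lower) (auto simp: E_def intro!: bdd_belowI[of _ 0])
      then show False using \<open>s < _\<close> inv by simp
    qed
  qed
qed

locale time_changed_bm = clock M m \<nu> lam H
  for M :: "'a measure" and m :: nat and \<nu> lam :: "nat \<Rightarrow> real" and H +
  fixes c :: real and B :: "real \<Rightarrow> 'a \<Rightarrow> real ^ 'n" and L :: "nat \<Rightarrow> real \<Rightarrow> 'a \<Rightarrow> real"
  assumes c: "c > 0"
    and L_def: "\<And>r. L r = inverse_process (weighted_sum_process m lam \<nu> H r)"
    and B: "brownian_motion M B"
    and indep_BL: "\<And>r. r \<ge> 1 \<Longrightarrow> independent_processes M {0..} B {0<..} (L r)"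
begin

lemma L_eq: "L r = inverse_process (HH r)"
  by (simp add: L_def HH_def)

text \<open>Time is divided by \<open>c\<^sup>2\<close> so that the factor \<open>c\<^sup>2\<close>
  of the clock disappears from the tail duality.\<close>

definition eta :: "nat \<Rightarrow> real \<Rightarrow> real measure" where
  "eta r s = distr M borel (HH r (s / c\<^sup>2))"

definition clock_law :: "nat \<Rightarrow> real \<Rightarrow> real measure" where
  "clock_law r t = distr M borel (\<lambda>\<omega>. c\<^sup>2 * L r t \<omega>)"

lemma L_measurable: "r \<ge> 1 \<Longrightarrow> t > 0 \<Longrightarrow> L r t \<in> borel_measurable M"
  using indep_BL[of r] by (simp add: independent_processes_def)

lemma eta_props:
  assumes s: "s \<ge> 0"
  shows "prob_space (eta r s)" "sets (eta r s) = sets borel" "AE x in eta r s. 0 \<le> x"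
    "\<mu> > 0 \<Longrightarrow> (LINT x|eta r s. exp (- \<mu> * x)) = exp (- s * (Phi r \<mu> / c\<^sup>2))"
proof -
  have s': "s / c\<^sup>2 \<ge> 0" using s by simp
  note [measurable] = HH_measurable[OF s', of r]
  show "prob_space (eta r s)" unfolding eta_def by (rule prob_space_distr) measurable
  show "sets (eta r s) = sets borel" by (simp add: eta_def)
  show "AE x in eta r s. 0 \<le> x"
    unfolding eta_def by (subst AE_distr_iff) (auto intro!: AE_I2 HH_path(4) s')
  show "(LINT x|eta r s. exp (- \<mu> * x)) = exp (- s * (Phi r \<mu> / c\<^sup>2))" if "\<mu> > 0"
    unfolding eta_def using HH_laplace[OF s' that, of r] by (subst integral_distr) auto
qed

lemma Phi_pos: "\<mu> > 0 \<Longrightarrow> Phi r \<mu> > 0"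
  unfolding Phi_def using m lam by (intro sum_pos) auto

text \<open>The third claim is first-passage duality: the clock exceeds \<open>s\<close> when the
  sum at time \<open>s / c\<^sup>2\<close> is below \<open>t\<close>. The two events can differ only
  where the level \<open>t\<close> is never reached and \<open>inverse_process\<close> takes its
  default value 0.\<close>

lemma clock_law_props:
  assumes "r \<ge> 1" "t > 0"
  shows "prob_space (clock_law r t)" "sets (clock_law r t) = sets borel"
    "s \<ge> 0 \<Longrightarrow> measure (clock_law r t) {s<..} = measure (eta r s) {..<t}"
    "AE s in clock_law r t. 0 < s"
proof -
  note [measurable] = L_measurable[OF assms]
  show P: "prob_space (clock_law r t)" unfolding clock_law_def by (rule prob_space_distr) measurable
  show S: "sets (clock_law r t) = sets borel" by (simp add: clock_law_def)
  have tail: "measure (clock_law r t) {s<..} = measure (eta r s) {..<t}" if s: "s \<ge> 0" for s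
  proof -
    have c2: "c\<^sup>2 > 0" using c by simp
    have HHm [measurable]: "HH r u \<in> borel_measurable M" if "u \<ge> 0" for u
      using that by (rule HH_measurable)
    have s': "s / c\<^sup>2 \<ge> 0" using s by simp
    note [measurable] = HHm[OF s']
    define U where "U = {\<omega> \<in> space M. HH r (s / c\<^sup>2) \<omega> < t}"
    define V where "V = {\<omega> \<in> space M. s < c\<^sup>2 * L r t \<omega>}"
    have [measurable]: "U \<in> events" "V \<in> events" unfolding U_def V_def by measurable
    have eqU: "measure (eta r s) {..<t} = prob U"
      unfolding eta_def by (subst measure_distr) (auto simp: U_def vimage_def Int_def conj_commute)
    have eqV: "measure (clock_law r t) {s<..} = prob V"
      unfolding clock_law_def by (subst measure_distr) (auto simp: V_def vimage_def Int_def conj_commute)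
    have dich: "(\<omega> \<in> V \<longleftrightarrow> \<omega> \<in> U) \<or> (\<omega> \<in> U \<and> \<omega> \<notin> V \<and> (\<forall>s>0. HH r s \<omega> < t))" if \<omega>: "\<omega> \<in> space M" for \<omega>
    proof (cases "\<exists>s>0. t \<le> HH r s \<omega>")
      case True
      have "s / c\<^sup>2 < inverse_process (HH r) t \<omega> \<longleftrightarrow> HH r (s / c\<^sup>2) \<omega> < t"
        by (rule inverse_process_greater_iff[of "HH r" \<omega>, OF HH_path(1,2,3)[OF \<omega>] assms(2) s' True])
      then have "\<omega> \<in> V \<longleftrightarrow> \<omega> \<in> U"
        using \<omega> c2 by (simp add: U_def V_def L_eq field_simps)
      then show ?thesis ..
    next
      case False
      then have "L r t \<omega> = 0" unfolding L_eq inverse_process_def by (rule if_not_P)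
      moreover have "HH r (s / c\<^sup>2) \<omega> < t"
        using False s s' c HH_path(1)[OF \<omega>] assms(2) by (cases "s = 0") (auto simp: not_le intro!: divide_pos_pos)
      ultimately show ?thesis using False \<omega> s by (auto simp: U_def V_def not_le)
    qed
    have "V \<subseteq> U" using dich by (auto simp: V_def)
    \<comment> \<open>On the exceptional event the sum is below \<open>t\<close> at every time, in
      particular at \<open>n / c\<^sup>2\<close>. The exponential bound with
      \<open>\<mu> = 1\<close> decays in \<open>n\<close>, so the event is null.\<close>
    have bd: "prob (U - V) \<le> exp t * exp (- real n * (Phi r 1 / c\<^sup>2))" if "n > 0" for n
    proof -
      have n0: "real n \<ge> 0" "real n / c\<^sup>2 \<ge> 0" by auto
      note [measurable] = HHm[OF n0(2)]
      have "prob (U - V) \<le> prob {\<omega> \<in> space M. HH r (real n / c\<^sup>2) \<omega> < t}"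
      proof (rule finite_measure_mono)
        have "real n / c\<^sup>2 > 0" using c2 that by simp
        then show "U - V \<subseteq> {\<omega> \<in> space M. HH r (real n / c\<^sup>2) \<omega> < t}"
          using dich by (auto simp: U_def)
      qed measurable
      also have "\<dots> = measure (eta r n) {..<t}"
        unfolding eta_def by (subst measure_distr) (auto simp: vimage_def Int_def conj_commute)
      also have "\<dots> \<le> exp (1 * t) * (LINT x|eta r n. exp (- 1 * x))"
        by (rule laplace_lower_tail(1)[OF eta_props(1,2,3)[OF n0(1)]]) simp
      also have "\<dots> = exp t * exp (- real n * (Phi r 1 / c\<^sup>2))"
        using eta_props(4)[OF n0(1), of 1 r] by simp
      finally show ?thesis .
    qed
    have lim: "(\<lambda>n. exp t * exp (- real n * (Phi r 1 / c\<^sup>2))) \<longlonglongrightarrow> 0"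
    proof -
      define a where "a = Phi r 1 / c\<^sup>2"
      have a: "a > 0" using Phi_pos[of 1 r] c2 by (simp add: a_def)
      have "(\<lambda>n. exp t * exp (- real n * a)) \<longlonglongrightarrow> 0"
        using a by real_asymp
      then show ?thesis by (simp add: a_def)
    qed
    have "prob (U - V) \<le> 0"
      by (rule LIMSEQ_le_const[OF lim]) (intro exI[of _ 1] allI impI bd, simp)
    then have "prob (U - V) = 0" by (simp add: measure_le_0_iff)
    moreover have "prob (U - V) = prob U - prob V"
      by (rule finite_measure_Diff) (use \<open>V \<subseteq> U\<close> in auto)
    ultimately show ?thesis using eqU eqV by simp
  qed
  then show "s \<ge> 0 \<Longrightarrow> measure (clock_law r t) {s<..} = measure (eta r s) {..<t}" by simp
  \<comment> \<open>At time 0 the sum is 0, hence below \<open>t\<close> surely; by duality the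
    clock is almost surely positive.\<close>
  have "measure (eta r 0) {..<t} = prob (space M)"
  proof -
    note [measurable] = HH_measurable[OF order_refl, of r]
    have "measure (eta r 0) {..<t} = prob {\<omega> \<in> space M. HH r 0 \<omega> < t}"
      unfolding eta_def by (subst measure_distr) (auto simp: vimage_def Int_def conj_commute)
    also have "{\<omega> \<in> space M. HH r 0 \<omega> < t} = space M"
      using assms(2) by (auto simp: HH_path(1))
    finally show ?thesis .
  qed
  then have "measure (clock_law r t) {0<..} = 1"
    using tail[of 0] by (simp add: prob_space)
  then show "AE s in clock_law r t. 0 < s"
    using prob_space.AE_prob_1[OF P, of "{0<..}"] by simp
qed

text \<open>The time-change formula is applied to the bounded process
  \<open>iexp (\<xi> \<bullet> B s)\<close>, whose mean at a fixed time is
  \<open>exp (- s * (norm \<xi>)\<^sup>2)\<close>. Independence is used between \<open>L r t\<close>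
  and \<open>B s\<close> at fixed \<open>s\<close>.\<close>

lemma B_at_clock_char:
  assumes "r \<ge> 1" "t > 0"
  shows "(\<lambda>\<omega>. B (c\<^sup>2 * L r t \<omega>) \<omega>) \<in> borel_measurable M"
    and "(LINT x|distr M borel (\<lambda>\<omega>. B (c\<^sup>2 * L r t \<omega>) \<omega>). iexp (\<xi> \<bullet> x)) =
         complex_of_real (LINT s|clock_law r t. exp (- s * (norm \<xi>)\<^sup>2))"
proof -
  note Lm [measurable] = L_measurable[OF assms]
  have Bm: "B s \<in> borel_measurable M" if "s \<ge> 0" for s
    using B that by (simp add: brownian_motion_def)
  have Bc: "continuous (at_right s) (\<lambda>s. B s \<omega>)" if "\<omega> \<in> space M" "s \<ge> 0" for s \<omega>
  proof -
    have "continuous_on {0..} (\<lambda>s. B s \<omega>)" using B that by (simp add: brownian_motion_def)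
    then have "continuous (at s within {0..}) (\<lambda>s. B s \<omega>)"
      using that by (simp add: continuous_on_eq_continuous_within)
    then show ?thesis by (rule continuous_within_subset) (use that in auto)
  qed
  have R0: "0 \<le> c\<^sup>2 * L r t \<omega>" for \<omega>
    by (simp add: L_eq inverse_process_nonneg)
  show m: "(\<lambda>\<omega>. B (c\<^sup>2 * L r t \<omega>) \<omega>) \<in> borel_measurable M"
  proof (rule measurable_time_change[where Y=B and R="\<lambda>\<omega>. c\<^sup>2 * L r t \<omega>"])
    show "(\<lambda>\<omega>. c\<^sup>2 * L r t \<omega>) \<in> borel_measurable M" by measurable
    show "B s \<in> borel_measurable M" if "s \<ge> 0" for s by (rule Bm[OF that])
    show "0 \<le> c\<^sup>2 * L r t \<omega>" for \<omega> by (rule R0)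
    show "continuous (at_right s) (\<lambda>s. B s \<omega>)" if "\<omega> \<in> space M" "s \<ge> 0" for s \<omega>
      by (rule Bc[OF that])
  qed
  define N1 where "N1 = vimage_algebra (space M) (\<lambda>\<omega>. \<lambda>t\<in>{0<..}. L r t \<omega>) (PiM {0<..} (\<lambda>_. borel :: real measure))"
  define N2 where "N2 = vimage_algebra (space M) (\<lambda>\<omega>. \<lambda>s\<in>{0..}. B s \<omega>) (PiM {0..} (\<lambda>_. borel :: (real ^ 'n) measure))"
  have i: "indep_set (sets N1) (sets N2)"
  proof -
    have "indep_set (sets N2) (sets N1)"
      using indep_BL[OF assms(1)] unfolding independent_processes_def N1_def N2_def by blast
    then show ?thesis
      unfolding indep_sets2_eq by (metis Int_commute mult.commute)
  qed
  have sp: "space N1 = space M" "space N2 = space M" by (simp_all add: N1_def N2_def)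
  have LN: "L r t \<in> borel_measurable N1"
  proof -
    have "(\<lambda>\<omega>. (\<lambda>t\<in>{0<..}. L r t \<omega>) t) \<in> borel_measurable N1"
      unfolding N1_def
      by (rule measurable_compose[OF measurable_vimage_algebra1 measurable_component_singleton])
         (use assms in \<open>auto simp: space_PiM PiE_iff extensional_def\<close>)
    then show ?thesis using assms by simp
  qed
  have BN: "B s \<in> borel_measurable N2" if "s \<ge> 0" for s
  proof -
    have "(\<lambda>\<omega>. (\<lambda>s\<in>{0..}. B s \<omega>) s) \<in> borel_measurable N2"
      unfolding N2_def
      by (rule measurable_compose[OF measurable_vimage_algebra1 measurable_component_singleton])
         (use that in \<open>auto simp: space_PiM PiE_iff extensional_def\<close>)
    then show ?thesis using that by simp
  qed
  define Y where "Y s \<omega> = iexp (\<xi> \<bullet> B s \<omega>)" for s \<omega>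
  have YM: "Y s \<in> borel_measurable M" if "s \<ge> 0" for s
    unfolding Y_def using Bm[OF that] by measurable
  have "expectation (\<lambda>\<omega>. Y (c\<^sup>2 * L r t \<omega>) \<omega>) = expectation (\<lambda>\<omega>. expectation (Y (c\<^sup>2 * L r t \<omega>)))"
  proof (rule expectation_time_change[where K=1])
    show "(\<lambda>\<omega>. c\<^sup>2 * L r t \<omega>) \<in> borel_measurable M" by measurable
    show "continuous (at_right s) (\<lambda>s. Y s \<omega>)" if "\<omega> \<in> space M" "0 \<le> s" for \<omega> s
      unfolding Y_def by (intro continuous_intros Bc that)
    fix A :: "real set" and s :: real assume A: "A \<in> sets borel" and s: "0 \<le> s"
    show "expectation (\<lambda>\<omega>. indicator A (c\<^sup>2 * L r t \<omega>) *\<^sub>R Y s \<omega>) =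
      prob {\<omega> \<in> space M. c\<^sup>2 * L r t \<omega> \<in> A} *\<^sub>R expectation (Y s)"
    proof (rule expectation_indep_indicator[OF i sp _ _ _ A])
      show "(\<lambda>\<omega>. c\<^sup>2 * L r t \<omega>) \<in> borel_measurable N1" using LN by measurable
      show "Y s \<in> borel_measurable N2" unfolding Y_def using BN[OF s] by measurable
      show "integrable M (Y s)"
        by (rule integrable_const_bound[where B=1]) (use YM[OF s] in \<open>auto simp: Y_def\<close>)
    qed
  qed (auto simp: YM R0, simp add: Y_def)
  also have "\<dots> = expectation (\<lambda>\<omega>. complex_of_real (exp (- (c\<^sup>2 * L r t \<omega>) * (norm \<xi>)\<^sup>2)))"
  proof -
    have "expectation (Y u) = complex_of_real (exp (- u * (norm \<xi>)\<^sup>2))" if "u \<ge> 0" for u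
      using B that unfolding brownian_motion_def Y_def[abs_def] by blast
    then show ?thesis using R0 by (intro Bochner_Integration.integral_cong refl) blast
  qed
  also have "\<dots> = complex_of_real (LINT s|clock_law r t. exp (- s * (norm \<xi>)\<^sup>2))"
    unfolding clock_law_def by (subst integral_distr) simp_all
  finally show "(LINT x|distr M borel (\<lambda>\<omega>. B (c\<^sup>2 * L r t \<omega>) \<omega>). iexp (\<xi> \<bullet> x)) =
         complex_of_real (LINT s|clock_law r t. exp (- s * (norm \<xi>)\<^sup>2))"
    using m by (subst integral_distr) (simp_all add: Y_def)
qed

lemma B_at_clock_law:
  assumes "r \<ge> 1" "t > 0"
  shows "distr M borel (\<lambda>\<omega>. B (c\<^sup>2 * L r t \<omega>) \<omega>) = density lborel (\<lambda>x. ennreal (gauss_mix (clock_law r t) x))"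
  by (rule distr_eq_gauss_mix[OF _ _ clock_law_props(1,2,4)[OF assms] B_at_clock_char(2)[OF assms]])
     (auto intro!: prob_space_distr B_at_clock_char(1) assms)

end

subsection \<open>Densities of sums of stable subordinators\<close>

text \<open>From \<open>a * u \<le> exp (a * u)\<close> with \<open>a = Re z / 2\<close>. It
  dominates the derivative of the Laplace integrand on a ball around \<open>z\<close>.\<close>

lemma exp_moment_bound:
  assumes z: "0 < Re z" and y: "Re z / 2 \<le> Re y" and u: "0 \<le> u"
  shows "norm (complex_of_real u * exp (- (y * complex_of_real u))) \<le> 2 / Re z"
proof -
  have "norm (complex_of_real u * exp (- (y * complex_of_real u))) = u * exp (- (Re y * u))"
    using u by (simp add: norm_mult)
  also have "\<dots> \<le> u * exp (- (Re z / 2 * u))"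
    using mult_right_mono[OF y u] u by (intro mult_left_mono) auto
  also have "\<dots> \<le> 2 / Re z"
  proof -
    define E where "E = exp (Re z / 2 * u)"
    have "Re z / 2 * u \<le> E" unfolding E_def by (rule order_trans[OF _ exp_ge_add_one_self]) simp
    then have "2 / Re z * (Re z / 2 * u) \<le> 2 / Re z * E" using z by (intro mult_left_mono) simp_all
    moreover have "2 / Re z * (Re z / 2 * u) = u" using z by simp
    ultimately have "u \<le> 2 / Re z * E" by (simp only:)
    moreover have "E > 0" by (simp add: E_def)
    ultimately have "u / E \<le> 2 / Re z" by (simp only: pos_divide_le_eq)
    then show ?thesis by (simp only: E_def exp_minus divide_inverse)
  qed
  finally show ?thesis .
qed

lemma laplace_transform_holomorphic:
  assumes D: "prob_space D" "sets D = sets borel" "AE x in D. 0 \<le> x"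
  shows "(\<lambda>z. LINT x|D. exp (- (z * complex_of_real x))) holomorphic_on {z. 0 < Re z}"
proof -
  interpret D: prob_space D by fact
  note [measurable_cong] = D(2)
  \<comment> \<open>Nonnegativity holds only almost everywhere, while the differentiation lemma asks
    for bounds at every point; \<open>max 0 x\<close> bridges the two.\<close>
  have eq: "(LINT x|D. exp (- (z * complex_of_real x))) = (LINT x|D. exp (- (z * complex_of_real (max 0 x))))" for z
  proof (rule integral_cong_AE)
    show "AE x in D. exp (- (z * complex_of_real x)) = exp (- (z * complex_of_real (max 0 x)))"
      using D(3) by eventually_elim (simp add: max_def)
  qed measurable
  have "((\<lambda>z. LINT x|D. exp (- (z * complex_of_real (max 0 x)))) has_field_derivative
      (LINT x|D. - complex_of_real (max 0 x) * exp (- (z * complex_of_real (max 0 x))))) (at z)" if z: "0 < Re z" for z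
  proof (rule has_field_derivative_integral[where d="Re z / 2" and w="\<lambda>_. 2 / Re z"])
    have Re: "Re y \<ge> Re z / 2" if "y \<in> ball z (Re z / 2)" for y
    proof -
      have "\<bar>Re (z - y)\<bar> \<le> dist z y" unfolding dist_norm by (rule abs_Re_le_cmod)
      then show ?thesis using that by simp
    qed
    show "((\<lambda>y. exp (- (y * complex_of_real (max 0 x)))) has_field_derivative
        - complex_of_real (max 0 x) * exp (- (y * complex_of_real (max 0 x)))) (at y)" for y x
      by (auto intro!: derivative_eq_intros)
    show "norm (- complex_of_real (max 0 x) * exp (- (y * complex_of_real (max 0 x)))) \<le> 2 / Re z"
      if "y \<in> ball z (Re z / 2)" for y x
      using exp_moment_bound[OF z Re[OF that], of "max 0 x"] by simp
    show "integrable D (\<lambda>x. exp (- (y * complex_of_real (max 0 x))))" if "y \<in> ball z (Re z / 2)" for y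
      using Re[OF that] z by (intro D.integrable_const_bound[where B=1]) (auto intro!: AE_I2)
    show "integrable D (\<lambda>_. 2 / Re z)" by simp
    show "(\<lambda>x. - complex_of_real (max 0 x) * exp (- (z * complex_of_real (max 0 x)))) \<in> borel_measurable D"
      by measurable
  qed (use z in simp)
  note der = this
  show ?thesis
    unfolding eq holomorphic_on_def field_differentiable_def
    using has_field_derivative_at_within[OF der] by blast
qed

text \<open>The exponent \<open>2 / \<alpha>\<close> is the one that turns
  \<open>\<bar>x\<bar> powr \<alpha>\<close> into the square needed for integrability in
  \<open>x\<close>; the price is a negative power of \<open>s\<close>. The factor 2 in
  \<open>D\<close> covers both \<open>1 + x\<^sup>2 \<le> 2\<close> near 0 and
  \<open>1 / x\<^sup>2 \<le> 2 / (1 + x\<^sup>2)\<close> elsewhere.\<close>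

lemma exp_decay_bound:
  fixes \<alpha> a :: real
  assumes \<alpha>: "0 < \<alpha>" and a: "a > 0"
  obtains C where "C \<ge> 0" "\<And>s x. s > 0 \<Longrightarrow> exp (- (s * (a * \<bar>x\<bar> powr \<alpha>))) \<le> C * (1 + s powr (- (2 / \<alpha>))) / (1 + x\<^sup>2)"
proof -
  define q where "q = 2 / \<alpha>"
  have q: "q > 0" "\<alpha> * q = 2" using \<alpha> by (auto simp: q_def)
  obtain C where C: "C \<ge> 0" "\<And>s. ek q 1 s \<le> C"
    using ek_bounded[of 1 q] q by auto
  define D where "D = 2 * (1 + C * a powr (- q))"
  have D: "D \<ge> 2" using C by (simp add: D_def)
  have "exp (- (s * (a * \<bar>x\<bar> powr \<alpha>))) \<le> D * (1 + s powr (- q)) / (1 + x\<^sup>2)" if s: "s > 0" for s x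
  proof (cases "\<bar>x\<bar> \<le> 1")
    case True
    then have "x\<^sup>2 \<le> 1" by (simp add: abs_square_le_1)
    have "1 + x\<^sup>2 \<le> 2 * (1 + 0)" using \<open>x\<^sup>2 \<le> 1\<close> by simp
    also have "\<dots> \<le> D * (1 + s powr (- q))" using D by (intro mult_mono) auto
    finally have "1 \<le> D * (1 + s powr (- q)) / (1 + x\<^sup>2)"
      by (subst pos_le_divide_eq) (auto simp: add_pos_nonneg)
    moreover have "exp (- (s * (a * \<bar>x\<bar> powr \<alpha>))) \<le> 1" using s a by simp
    ultimately show ?thesis by linarith
  next
    case False
    define y where "y = s * (a * \<bar>x\<bar> powr \<alpha>)"
    have y: "y > 0" using s a False by (auto simp: y_def)
    have "y powr q * exp (- y) \<le> C"
      using C(2)[of "1 / y"] y by (simp add: ek_def powr_minus powr_divide)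
    then have "exp (- y) \<le> C * y powr (- q)"
      using y by (simp add: powr_minus field_simps)
    also have "y powr (- q) = s powr (- q) * (a powr (- q) * \<bar>x\<bar> powr (- 2))"
      using s a False q(2) by (simp add: y_def powr_mult powr_powr)
    also have "\<bar>x\<bar> powr (- 2) = 1 / x\<^sup>2"
      using False by (simp add: powr_minus powr_numeral field_simps)
    also have "C * (s powr (- q) * (a powr (- q) * (1 / x\<^sup>2))) \<le> C * (s powr (- q) * (a powr (- q) * (2 / (1 + x\<^sup>2))))"
    proof -
      have x1: "1 \<le> x\<^sup>2" using False abs_square_le_1[of x] by linarith
      then have x0: "0 < x\<^sup>2" by linarith
      have "0 < 2 * x\<^sup>2 * (1 + x\<^sup>2)" using x0 by (intro mult_pos_pos) linarith+
      then have "2 / (2 * x\<^sup>2) \<le> 2 / (1 + x\<^sup>2)" using x1 by (intro divide_left_mono) linarith+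
      then have "1 / x\<^sup>2 \<le> 2 / (1 + x\<^sup>2)" by simp
      then show ?thesis using C(1) by (intro mult_left_mono) auto
    qed
    also have "\<dots> = (2 * (C * a powr (- q))) * s powr (- q) / (1 + x\<^sup>2)" by (simp only: times_divide_eq_right mult_ac)
    also have "\<dots> \<le> D * (1 + s powr (- q)) / (1 + x\<^sup>2)"
    proof (rule divide_right_mono, rule mult_mono)
      show "2 * (C * a powr (- q)) \<le> D" by (simp add: D_def)
    qed (use D in simp_all)
    finally show ?thesis by (simp add: y_def)
  qed
  note bound = this
  show ?thesis
  proof (rule that[of D])
    show "0 \<le> D" using D by simp
  qed (rule bound[unfolded q_def])
qed

text \<open>On the negative or positive imaginary half-axis the principal argument is minus or plus
  \<open>pi / 2\<close>. This evaluates the Laplace exponent on the boundary of the right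
  half-plane.\<close>

lemma powr_neg_imaginary:
  fixes \<alpha> \<theta> :: real
  assumes "\<theta> \<noteq> 0"
  shows "(- (\<i> * complex_of_real \<theta>)) powr complex_of_real \<alpha> = \<bar>\<theta>\<bar> powr \<alpha> * cis (- sgn \<theta> * (pi * \<alpha> / 2))"
proof -
  have nz: "- (\<i> * complex_of_real \<theta>) \<noteq> 0" using assms by simp
  have "Ln (- (\<i> * complex_of_real \<theta>)) = complex_of_real (ln \<bar>\<theta>\<bar>) + \<i> * complex_of_real (- sgn \<theta> * pi / 2)"
  proof (rule Ln_unique)
    have "exp (complex_of_real (ln \<bar>\<theta>\<bar>) + \<i> * complex_of_real (- sgn \<theta> * pi / 2)) = \<bar>\<theta>\<bar> * cis (- sgn \<theta> * pi / 2)"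
      unfolding exp_add by (simp only: exp_of_real cis_conv_exp exp_ln zero_less_abs_iff assms not_False_eq_True)
    also have "\<dots> = - (\<i> * complex_of_real \<theta>)"
      using assms by (cases "\<theta> > 0") (auto simp: complex_eq_iff)
    finally show "exp (complex_of_real (ln \<bar>\<theta>\<bar>) + \<i> * complex_of_real (- sgn \<theta> * pi / 2)) = - (\<i> * complex_of_real \<theta>)" .
  next
    have "Im (complex_of_real (ln \<bar>\<theta>\<bar>) + \<i> * complex_of_real (- sgn \<theta> * pi / 2)) = - sgn \<theta> * pi / 2"
      by simp
    moreover have "- pi < - sgn \<theta> * pi / 2" "- sgn \<theta> * pi / 2 \<le> pi"
      using pi_gt_zero assms by (cases "\<theta> > 0"; simp; linarith)+
    ultimately show "- pi < Im (complex_of_real (ln \<bar>\<theta>\<bar>) + \<i> * complex_of_real (- sgn \<theta> * pi / 2))"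
      "Im (complex_of_real (ln \<bar>\<theta>\<bar>) + \<i> * complex_of_real (- sgn \<theta> * pi / 2)) \<le> pi"
      by simp_all
  qed
  note L = this
  have "(- (\<i> * complex_of_real \<theta>)) powr complex_of_real \<alpha> =
     exp (complex_of_real \<alpha> * (complex_of_real (ln \<bar>\<theta>\<bar>) + \<i> * complex_of_real (- sgn \<theta> * pi / 2)))"
    using nz unfolding powr_def L by (rule if_not_P)
  also have "complex_of_real \<alpha> * (complex_of_real (ln \<bar>\<theta>\<bar>) + \<i> * complex_of_real (- sgn \<theta> * pi / 2)) =
     complex_of_real (\<alpha> * ln \<bar>\<theta>\<bar>) + \<i> * complex_of_real (- sgn \<theta> * (pi * \<alpha> / 2))"
    by (simp add: algebra_simps)
  also have "exp \<dots> = \<bar>\<theta>\<bar> powr \<alpha> * cis (- sgn \<theta> * (pi * \<alpha> / 2))"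
  proof -
    have "\<bar>\<theta>\<bar> powr \<alpha> = exp (\<alpha> * ln \<bar>\<theta>\<bar>)" using assms by (simp add: powr_def)
    then show ?thesis by (simp only: exp_add exp_of_real cis_conv_exp)
  qed
  finally show ?thesis .
qed

lemma Re_of_real_mult_cis: "Re (complex_of_real a * cis b) = a * cos b"
  by simp

section \<open>The characteristic exponent\<close>

text \<open>The lower bound \<kappa> is a parameter of its own, instead of the minimum of the
  cosines, so that one value can be used for all \<open>r\<close> although the orders vary.\<close>

locale subordinator_laws =
  fixes m :: nat and lam \<alpha> :: "nat \<Rightarrow> real" and \<eta> :: "real \<Rightarrow> real measure" and \<kappa> :: real
  assumes m: "m \<ge> 1"
    and lam: "\<And>j. j \<in> {1..m} \<Longrightarrow> lam j > 0"
    and \<alpha>: "\<And>j. j \<in> {1..m} \<Longrightarrow> 0 < \<alpha> j \<and> \<alpha> j < 1"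
    and \<kappa>: "\<kappa> > 0" "\<And>j. j \<in> {1..m} \<Longrightarrow> \<kappa> \<le> cos (pi * \<alpha> j / 2)"
    and prob: "\<And>s. s > 0 \<Longrightarrow> prob_space (\<eta> s)" and sets_eta: "\<And>s. s > 0 \<Longrightarrow> sets (\<eta> s) = sets borel"
    and nonneg: "\<And>s. s > 0 \<Longrightarrow> AE x in \<eta> s. 0 \<le> x"
    and laplace: "\<And>s \<mu>. s > 0 \<Longrightarrow> \<mu> > 0 \<Longrightarrow>
       (LINT x|\<eta> s. exp (- \<mu> * x)) = exp (- s * (\<Sum>j=1..m. lam j * \<mu> powr \<alpha> j))"
begin

definition phi :: "real \<Rightarrow> real" where
  "phi \<mu> = (\<Sum>j=1..m. lam j * \<mu> powr \<alpha> j)"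

text \<open>This is \<open>phi\<close> continued to \<open>- \<i> * \<theta>\<close>, so that the
  characteristic function of \<open>\<eta> s\<close> is
  \<open>exp (- s * cphi \<theta>)\<close>.\<close>

definition cphi :: "real \<Rightarrow> complex" where
  "cphi \<theta> = (\<Sum>j=1..m. complex_of_real (lam j * \<bar>\<theta>\<bar> powr \<alpha> j) * cis (- sgn \<theta> * (pi * \<alpha> j / 2)))"

text \<open>Both sides are holomorphic on the right half-plane and agree on the positive reals,
  which accumulate at 1.\<close>

lemma complex_laplace:
  fixes z :: complex
  assumes s: "s > 0" and z: "Re z > 0"
  shows "(LINT x|\<eta> s. exp (- (z * complex_of_real x))) = exp (- s * (\<Sum>j=1..m. lam j * z powr \<alpha> j))"
proof -
  let ?f = "\<lambda>z. (LINT x|\<eta> s. exp (- (z * complex_of_real x))) - exp (- s * (\<Sum>j=1..m. lam j * z powr complex_of_real (\<alpha> j)))"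
  let ?S = "{z. 0 < Re z}" and ?U = "{z. 0 < Re z \<and> Im z = 0}"
  have "?f z = 0"
  proof (rule analytic_continuation[of ?f ?S ?U 1])
    have "x \<notin> \<real>\<^sub>\<le>\<^sub>0" if "0 < Re x" for x
      using that by (auto simp: complex_nonpos_Reals_iff)
    then show "?f holomorphic_on ?S"
      by (intro holomorphic_intros laplace_transform_holomorphic prob sets_eta nonneg s) auto
    show "open ?S" by (rule open_halfspace_Re_gt)
    show "connected ?S" by (rule convex_connected[OF convex_halfspace_Re_gt])
    show "1 islimpt ?U"
    proof (subst islimpt_approachable, intro allI impI)
      fix e :: real assume "e > 0"
      then show "\<exists>x'\<in>?U. x' \<noteq> 1 \<and> dist x' 1 < e"
        by (intro bexI[of _ "complex_of_real (1 + e / 2)"]) (auto simp: dist_norm)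
    qed
    show "?f w = 0" if "w \<in> ?U" for w
    proof -
      define \<mu> where "\<mu> = Re w"
      have w: "w = complex_of_real \<mu>" "\<mu> > 0" using that by (auto simp: complex_eq_iff \<mu>_def)
      have pw: "complex_of_real \<mu> powr complex_of_real (\<alpha> j) = complex_of_real (\<mu> powr \<alpha> j)" for j
        using w(2) by (intro powr_of_real) auto
      have "(LINT x|\<eta> s. exp (- (w * complex_of_real x))) = (LINT x|\<eta> s. complex_of_real (exp (- \<mu> * x)))"
        by (intro Bochner_Integration.integral_cong refl) (simp add: w(1) exp_of_real[symmetric])
      also have "\<dots> = complex_of_real (LINT x|\<eta> s. exp (- \<mu> * x))"
        by (rule integral_complex_of_real)
      also have "\<dots> = complex_of_real (exp (- s * (\<Sum>j=1..m. lam j * \<mu> powr \<alpha> j)))"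
        by (simp only: laplace[OF s w(2)])
      also have "\<dots> = exp (- s * (\<Sum>j=1..m. lam j * w powr complex_of_real (\<alpha> j)))"
        by (simp add: w(1) pw exp_of_real[symmetric])
      finally have e: "(LINT x|\<eta> s. exp (- (w * complex_of_real x))) = exp (- s * (\<Sum>j=1..m. lam j * w powr complex_of_real (\<alpha> j)))" .
      show ?thesis unfolding e by (rule diff_self)
    qed
  qed (use z in auto)
  then show ?thesis unfolding of_real_minus by (rule eq_iff_diff_eq_0[THEN iffD2])
qed

text \<open>The imaginary axis is approached from inside the half-plane along \<open>z k\<close>.
  For \<theta> = 0 the limit point is on the branch cut of \<open>powr\<close>, hence the separate
  case.\<close>

lemma char_eta:
  assumes s: "s > 0"
  shows "char (\<eta> s) \<theta> = exp (- s * cphi \<theta>)"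
proof (cases "\<theta> = 0")
  case True
  interpret prob_space "\<eta> s" by (rule prob[OF s])
  have "cphi 0 = 0" by (simp add: cphi_def)
  moreover have "char (\<eta> s) 0 = 1" by (simp add: char_def prob_space)
  ultimately show ?thesis using True by simp
next
  case False
  interpret prob_space "\<eta> s" by (rule prob[OF s])
  note [measurable_cong] = sets_eta[OF s]
  define z where "z k = complex_of_real (1 / Suc k) - \<i> * complex_of_real \<theta>" for k
  have z: "z \<longlonglongrightarrow> - (\<i> * complex_of_real \<theta>)"
  proof -
    have "z \<longlonglongrightarrow> complex_of_real 0 - \<i> * complex_of_real \<theta>"
      unfolding z_def by (intro tendsto_intros LIMSEQ_Suc[OF lim_1_over_n])
    then show ?thesis by simp
  qed
  have lim1: "(\<lambda>k. LINT x|\<eta> s. exp (- (z k * complex_of_real x))) \<longlonglongrightarrow> (LINT x|\<eta> s. exp (- (- (\<i> * complex_of_real \<theta>) * complex_of_real x)))"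
  proof (rule integral_dominated_convergence[where w="\<lambda>_. 1"])
    show "AE x in \<eta> s. (\<lambda>k. exp (- (z k * complex_of_real x))) \<longlonglongrightarrow> exp (- (- (\<i> * complex_of_real \<theta>) * complex_of_real x))"
      by (intro AE_I2 tendsto_intros z)
    show "AE x in \<eta> s. norm (exp (- (z k * complex_of_real x))) \<le> 1" for k
      using nonneg[OF s] by eventually_elim (simp add: z_def)
    show "(\<lambda>x. exp (- (z k * complex_of_real x))) \<in> borel_measurable (\<eta> s)" for k by measurable
    show "(\<lambda>x. exp (- (- (\<i> * complex_of_real \<theta>) * complex_of_real x))) \<in> borel_measurable (\<eta> s)" by measurable
  qed simp
  have z0: "Re (z k) > 0" for k by (simp add: z_def)
  have eq: "(LINT x|\<eta> s. exp (- (z k * complex_of_real x))) = exp (- s * (\<Sum>j=1..m. lam j * z k powr \<alpha> j))" for k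
    using complex_laplace[OF s z0, of k] by (simp only: of_real_minus)
  have nn: "- (\<i> * complex_of_real \<theta>) \<notin> \<real>\<^sub>\<le>\<^sub>0" using False by (auto simp: complex_nonpos_Reals_iff)
  have pw: "(\<lambda>k. z k powr complex_of_real (\<alpha> j)) \<longlonglongrightarrow> (- (\<i> * complex_of_real \<theta>)) powr complex_of_real (\<alpha> j)" for j
    by (intro tendsto_powr_complex z tendsto_const nn)
  have lim2: "(\<lambda>k. exp (- s * (\<Sum>j=1..m. lam j * z k powr complex_of_real (\<alpha> j)))) \<longlonglongrightarrow>
      exp (- s * (\<Sum>j=1..m. lam j * (- (\<i> * complex_of_real \<theta>)) powr complex_of_real (\<alpha> j)))"
    by (intro tendsto_exp tendsto_mult tendsto_const tendsto_sum pw)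
  have "(LINT x|\<eta> s. exp (- (- (\<i> * complex_of_real \<theta>) * complex_of_real x))) =
     exp (- s * (\<Sum>j=1..m. lam j * (- (\<i> * complex_of_real \<theta>)) powr complex_of_real (\<alpha> j)))"
    by (rule LIMSEQ_unique[OF lim1]) (simp only: eq lim2[unfolded of_real_minus] of_real_minus)
  also have "\<dots> = exp (- s * cphi \<theta>)"
    unfolding powr_neg_imaginary[OF False] cphi_def by (simp add: mult.assoc)
  also have "(LINT x|\<eta> s. exp (- (- (\<i> * complex_of_real \<theta>) * complex_of_real x))) = char (\<eta> s) \<theta>"
    unfolding char_def by (intro Bochner_Integration.integral_cong refl) (simp add: mult.assoc)
  finally show ?thesis by (simp only: of_real_minus)
qed

text \<open>The phase of the \<open>j\<close>-th term has modulus at most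
  \<open>pi * \<alpha> j / 2\<close>, below a right angle, so its real part is at least \<kappa>
  times its modulus.\<close>

lemma Re_cphi:
  "Re (cphi \<theta>) \<ge> \<kappa> * (\<Sum>j=1..m. lam j * \<bar>\<theta>\<bar> powr \<alpha> j)"
proof -
  have "\<kappa> * (lam j * \<bar>\<theta>\<bar> powr \<alpha> j) \<le> lam j * \<bar>\<theta>\<bar> powr \<alpha> j * cos (- sgn \<theta> * (pi * \<alpha> j / 2))" if "j \<in> {1..m}" for j
  proof -
    have "cos (- sgn \<theta> * (pi * \<alpha> j / 2)) \<ge> cos (pi * \<alpha> j / 2)"
      by (cases \<theta> "0::real" rule: linorder_cases) simp_all
    then have c: "\<kappa> \<le> cos (- sgn \<theta> * (pi * \<alpha> j / 2))" by (rule order_trans[OF \<kappa>(2)[OF that]])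
    have "0 \<le> lam j * \<bar>\<theta>\<bar> powr \<alpha> j" by (intro mult_nonneg_nonneg less_imp_le[OF lam[OF that]] powr_ge_zero)
    from mult_left_mono[OF c this] show ?thesis by (subst mult.commute[of \<kappa>])
  qed
  note le = this
  have "Re (cphi \<theta>) = (\<Sum>j=1..m. lam j * \<bar>\<theta>\<bar> powr \<alpha> j * cos (- sgn \<theta> * (pi * \<alpha> j / 2)))"
    unfolding cphi_def Re_sum by (intro sum.cong refl) (rule Re_of_real_mult_cis)
  then show ?thesis
    unfolding sum_distrib_left by (simp only:) (rule sum_mono, rule le)
qed

lemma norm_char_eta:
  assumes s: "s > 0"
  shows "norm (char (\<eta> s) \<theta>) \<le> exp (- (s * (\<kappa> * (\<Sum>j=1..m. lam j * \<bar>\<theta>\<bar> powr \<alpha> j))))"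
  using mult_left_mono[OF Re_cphi, of s \<theta>] s by (simp add: char_eta)

text \<open>Only the first term of the exponent is kept, which already makes the characteristic
  function integrable in \<theta>.\<close>

lemma char_eta_bound:
  "\<exists>C q. C \<ge> 0 \<and> q \<ge> 0 \<and> (\<forall>s>0. \<forall>\<theta>. norm (char (\<eta> s) \<theta>) \<le> C * (1 + s powr (- q)) / (1 + \<theta>\<^sup>2))"
proof -
  have j1: "1 \<in> {1..m}" using m by simp
  have a: "0 < \<alpha> 1" "\<kappa> * lam 1 > 0" using \<alpha>[OF j1] lam[OF j1] \<kappa>(1) by auto
  obtain C where C: "C \<ge> 0" "\<And>s x. s > 0 \<Longrightarrow> exp (- (s * (\<kappa> * lam 1 * \<bar>x\<bar> powr \<alpha> 1))) \<le> C * (1 + s powr (- (2 / \<alpha> 1))) / (1 + x\<^sup>2)"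
    using exp_decay_bound[OF a] by blast
  have "norm (char (\<eta> s) \<theta>) \<le> C * (1 + s powr (- (2 / \<alpha> 1))) / (1 + \<theta>\<^sup>2)" if s: "s > 0" for s \<theta>
  proof -
    have "lam 1 * \<bar>\<theta>\<bar> powr \<alpha> 1 \<le> (\<Sum>j=1..m. lam j * \<bar>\<theta>\<bar> powr \<alpha> j)"
      using lam j1 by (intro member_le_sum) (auto intro!: mult_nonneg_nonneg less_imp_le[OF lam])
    then have "s * (\<kappa> * lam 1 * \<bar>\<theta>\<bar> powr \<alpha> 1) \<le> s * (\<kappa> * (\<Sum>j=1..m. lam j * \<bar>\<theta>\<bar> powr \<alpha> j))"
      using s \<kappa>(1) by (simp add: mult.assoc)
    then have "exp (- (s * (\<kappa> * (\<Sum>j=1..m. lam j * \<bar>\<theta>\<bar> powr \<alpha> j)))) \<le> exp (- (s * (\<kappa> * lam 1 * \<bar>\<theta>\<bar> powr \<alpha> 1)))"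
      by (simp only: exp_le_cancel_iff neg_le_iff_le)
    from order_trans[OF order_trans[OF norm_char_eta[OF s] this] C(2)[OF s]] show ?thesis .
  qed
  note bound = this
  have "0 \<le> 2 / \<alpha> 1" using a by simp
  with C(1) bound show ?thesis by blast
qed

end

section \<open>Fourier inversion for integrable characteristic functions\<close>

definition inv_char :: "real measure \<Rightarrow> real \<Rightarrow> real" where
  "inv_char D \<tau> = Re (LINT \<theta>|lborel. iexp (- (\<theta> * \<tau>)) * char D \<theta>) / (2 * pi)"

context real_distribution
begin

lemma integrable_iexp_char:
  assumes "integrable lborel (char M)"
  shows "integrable lborel (\<lambda>\<theta>. iexp (- (\<theta> * \<tau>)) * char M \<theta>)"
  by (rule Bochner_Integration.integrable_bound[OF assms]) (auto simp: norm_mult)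

lemma isCont_inv_char:
  assumes i: "integrable lborel (char M)"
  shows "isCont (inv_char M) \<tau>"
  unfolding continuous_at_sequentially comp_def
proof safe
  fix S assume S: "S \<longlonglongrightarrow> \<tau>"
  have "(\<lambda>n. LINT \<theta>|lborel. iexp (- (\<theta> * S n)) * char M \<theta>) \<longlonglongrightarrow> (LINT \<theta>|lborel. iexp (- (\<theta> * \<tau>)) * char M \<theta>)"
  proof (rule integral_dominated_convergence[where w="\<lambda>\<theta>. norm (char M \<theta>)"])
    show "AE \<theta> in lborel. (\<lambda>n. iexp (- (\<theta> * S n)) * char M \<theta>) \<longlonglongrightarrow> iexp (- (\<theta> * \<tau>)) * char M \<theta>"
      by (intro AE_I2 tendsto_intros S)
    show "integrable lborel (\<lambda>\<theta>. norm (char M \<theta>))" using i by (rule integrable_norm)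
  qed (simp_all add: norm_mult)
  then show "(\<lambda>n. inv_char M (S n)) \<longlonglongrightarrow> inv_char M \<tau>"
    unfolding inv_char_def by (intro tendsto_divide tendsto_const tendsto_Re) simp_all
qed

text \<open>In Levy's inversion formula the factor \<open>F\<close> is the Fourier transform of the
  indicator of \<open>{a..b}\<close>. Integrability of the characteristic function removes the
  truncation and allows the order of integration to be exchanged.\<close>

lemma measure_Ioc_inv_char:
  assumes i: "integrable lborel (char M)" and ab: "a \<le> b" and na: "measure M {a} = 0" "measure M {b} = 0"
  shows "measure M {a<..b} = (LINT \<tau>|lborel. inv_char M \<tau> * indicator {a..b} \<tau>)"
proof -
  define F where "F t = (iexp (-(t * a)) - iexp (-(t * b))) / (\<i> * t)" for t :: real
  have [measurable]: "F \<in> borel_measurable borel" unfolding F_def by measurable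
  have F_bound: "norm (F t) \<le> b - a" if "t \<noteq> 0" for t
    using Levy_Inversion_aux2[of "-b" "-a" t] ab that by (simp add: F_def)
  have F_int: "has_bochner_integral lborel (\<lambda>\<tau>. indicator {a..b} \<tau> *\<^sub>R iexp (- (t * \<tau>))) (F t)" if "t \<noteq> 0" for t
  proof -
    have "((\<lambda>\<tau>. \<i> * iexp (- (t * \<tau>)) / t) has_vector_derivative iexp (- (t * \<tau>))) (at \<tau> within {a..b})" for \<tau>
    proof -
      have "((\<lambda>z. \<i> * exp (- (\<i> * of_real t * z)) / t) has_field_derivative exp (- (\<i> * of_real t * of_real \<tau>))) (at (of_real \<tau>))"
        using that by (auto intro!: derivative_eq_intros)
      from has_vector_derivative_real_field[OF this] show ?thesis
        by (simp add: mult.assoc has_vector_derivative_at_within)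
    qed
    then have "has_bochner_integral lborel (\<lambda>\<tau>. indicator {a..b} \<tau> *\<^sub>R iexp (- (t * \<tau>))) (\<i> * iexp (- (t * b)) / t - \<i> * iexp (- (t * a)) / t)"
      by (intro has_bochner_integral_FTC_Icc ab) (auto intro!: continuous_intros)
    moreover have "\<i> * iexp (- (t * b)) / t - \<i> * iexp (- (t * a)) / t = F t"
      using that by (simp add: F_def field_simps)
    ultimately show ?thesis by simp
  qed
  have iF: "integrable lborel (\<lambda>t. F t * char M t)"
  proof (rule Bochner_Integration.integrable_bound[OF integrable_mult_right[OF integrable_norm[OF i], of "b - a"]])
    show "AE t in lborel. norm (F t * char M t) \<le> norm ((b - a) * norm (char M t))"
      using AE_lborel_singleton[of "0::real"]
      by eventually_elim (use ab F_bound in \<open>simp add: norm_mult mult_right_mono\<close>)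
  qed measurable
  have int2: "integrable (lborel \<Otimes>\<^sub>M lborel) (\<lambda>(t, \<tau>). (indicator {a..b} \<tau> *\<^sub>R iexp (- (t * \<tau>))) * char M t)"
  proof (rule lborel_pair.Fubini_integrable)
    have "(LINT \<tau>|lborel. norm (indicator {a..b} \<tau> *\<^sub>R iexp (- (t * \<tau>)) * char M t)) = (b - a) * norm (char M t)" for t
      using ab by (simp add: norm_mult)
    then show "integrable lborel (\<lambda>t. LINT \<tau>|lborel. norm (case (t, \<tau>) of (t, \<tau>) \<Rightarrow> indicator {a..b} \<tau> *\<^sub>R iexp (- (t * \<tau>)) * char M t))"
      using integrable_mult_right[OF integrable_norm[OF i], of "b - a"] by simp
    show "AE t in lborel. integrable lborel (\<lambda>\<tau>. case (t, \<tau>) of (t, \<tau>) \<Rightarrow> indicator {a..b} \<tau> *\<^sub>R iexp (- (t * \<tau>)) * char M t)"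
      using AE_lborel_singleton[of "0::real"]
    proof eventually_elim
      case (elim t)
      show ?case
        unfolding prod.case using F_int[OF elim] unfolding has_bochner_integral_iff
        by (intro integrable_mult_left) simp
    qed
  qed measurable
  have "(LINT t|lborel. F t * char M t) = (LINT t|lborel. LINT \<tau>|lborel. (indicator {a..b} \<tau> *\<^sub>R iexp (- (t * \<tau>))) * char M t)"
  proof (rule integral_cong_AE)
    show "AE t in lborel. F t * char M t = (LINT \<tau>|lborel. (indicator {a..b} \<tau> *\<^sub>R iexp (- (t * \<tau>))) * char M t)"
      using AE_lborel_singleton[of "0::real"]
    proof eventually_elim
      case (elim t)
      then have "integrable lborel (\<lambda>\<tau>. indicator {a..b} \<tau> *\<^sub>R iexp (- (t * \<tau>)))"
        "(LINT \<tau>|lborel. indicator {a..b} \<tau> *\<^sub>R iexp (- (t * \<tau>))) = F t"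
        using F_int unfolding has_bochner_integral_iff by blast+
      then show ?case by (subst Bochner_Integration.integral_mult_left) (simp_all only: simp_thms)
    qed
  qed measurable
  also have "\<dots> = (LINT \<tau>|lborel. LINT t|lborel. (indicator {a..b} \<tau> *\<^sub>R iexp (- (t * \<tau>))) * char M t)"
    using lborel_pair.Fubini_integral[OF int2] by simp
  also have "\<dots> = (LINT \<tau>|lborel. indicator {a..b} \<tau> *\<^sub>R (LINT t|lborel. iexp (- (t * \<tau>)) * char M t))"
    by (simp only: mult_scaleR_left integral_scaleR_right)
  finally have F_eq: "(LINT t|lborel. F t * char M t) = (LINT \<tau>|lborel. indicator {a..b} \<tau> *\<^sub>R (LINT t|lborel. iexp (- (t * \<tau>)) * char M t))" .
  have int3: "integrable lborel (\<lambda>\<tau>. indicator {a..b} \<tau> *\<^sub>R (LINT t|lborel. iexp (- (t * \<tau>)) * char M t))"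
    using lborel_pair.integrable_snd[OF int2] by (simp only: mult_scaleR_left integral_scaleR_right)
  have "(\<lambda>n. LINT t|lborel. indicator {- real n<..<real n} t *\<^sub>R (F t * char M t)) \<longlonglongrightarrow> (LINT t|lborel. F t * char M t)"
  proof (rule integral_dominated_convergence[where w="\<lambda>t. norm (F t * char M t)"])
    show "AE t in lborel. (\<lambda>n. indicator {- real n<..<real n} t *\<^sub>R (F t * char M t)) \<longlonglongrightarrow> F t * char M t"
    proof (rule AE_I2)
      fix t :: real
      obtain n0 :: nat where "\<bar>t\<bar> < real n0" using reals_Archimedean2 by blast
      then have "\<forall>n\<ge>n0. indicator {- real n<..<real n} t *\<^sub>R (F t * char M t) = F t * char M t"
        by (auto simp: indicator_def)
      then show "(\<lambda>n. indicator {- real n<..<real n} t *\<^sub>R (F t * char M t)) \<longlonglongrightarrow> F t * char M t"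
        by (intro tendsto_eventually) (auto simp: eventually_sequentially)
    qed
    show "integrable lborel (\<lambda>t. norm (F t * char M t))" using iF by (rule integrable_norm)
  qed (auto simp: indicator_def)
  moreover have "(CLBINT t=-real n..real n. F t * char M t) = (LINT t|lborel. indicator {- real n<..<real n} t *\<^sub>R (F t * char M t))" for n
    by (simp add: interval_lebesgue_integral_def set_lebesgue_integral_def)
  ultimately have "(\<lambda>n. 1 / (2 * pi) * (CLBINT t=-real n..real n. F t * char M t)) \<longlonglongrightarrow> 1 / (2 * pi) * (LINT t|lborel. F t * char M t)"
    by (intro tendsto_mult tendsto_const) simp
  moreover have "(\<lambda>n. 1 / (2 * pi) * (CLBINT t=-real n..real n. F t * char M t)) \<longlonglongrightarrow> complex_of_real (measure M {a<..b})"
    using Levy_Inversion[OF ab na] unfolding F_def by simp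
  ultimately have "complex_of_real (measure M {a<..b}) = 1 / (2 * pi) * (LINT t|lborel. F t * char M t)"
    using LIMSEQ_unique by blast
  then have "measure M {a<..b} = Re (1 / (2 * pi) * (LINT t|lborel. F t * char M t))"
    by (metis Re_complex_of_real)
  also have "\<dots> = Re (LINT t|lborel. F t * char M t) / (2 * pi)"
    by (simp add: Re_divide_of_real flip: of_real_mult)
  also have "Re (LINT t|lborel. F t * char M t) = (LINT \<tau>|lborel. Re (indicator {a..b} \<tau> *\<^sub>R (LINT t|lborel. iexp (- (t * \<tau>)) * char M t)))"
    unfolding F_eq by (rule integral_Re[symmetric]) (rule int3)
  also have "\<dots> / (2 * pi) = (LINT \<tau>|lborel. inv_char M \<tau> * indicator {a..b} \<tau>)"
    unfolding inv_char_def
    by (subst Bochner_Integration.integral_divide_zero[symmetric]) (auto intro!: Bochner_Integration.integral_cong)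
  finally show ?thesis .
qed

text \<open>Inversion gives \<open>cdf M - G\<close> equal at any two points that are not atoms,
  where \<open>G\<close> is a primitive of \<open>inv_char M\<close>. Atoms are countable, so such
  points accumulate at every \<open>x\<close> from the right, and right-continuity extends the
  equality to all \<open>x\<close>. The sign then follows from monotonicity of the distribution
  function.\<close>

lemma
  assumes i: "integrable lborel (char M)"
  shows cdf_has_derivative_inv_char: "(cdf M has_real_derivative inv_char M x) (at x)"
    and inv_char_nonneg: "0 \<le> inv_char M x"
    and density_inv_char: "M = density lborel (\<lambda>x. ennreal (inv_char M x))"
proof -
  have [measurable]: "inv_char M \<in> borel_measurable borel"
    by (rule borel_measurable_continuous_onI) (auto intro: isCont_inv_char[OF i] continuous_at_imp_continuous_on)
  obtain G where G: "\<And>x. (G has_real_derivative inv_char M x) (at x)"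
    using einterval_antiderivative[of "-\<infinity>" "\<infinity>" "inv_char M"] isCont_inv_char[OF i]
    by (auto simp: has_real_derivative_iff_has_vector_derivative)
  have eq: "cdf M b - G b = cdf M a - G a" if "measure M {a} = 0" "measure M {b} = 0" "a < b" for a b
  proof -
    have "cdf M b - cdf M a = (LINT \<tau>|lborel. inv_char M \<tau> * indicator {a..b} \<tau>)"
      using that by (simp add: cdf_diff_eq measure_Ioc_inv_char[OF i])
    also have "\<dots> = G b - G a"
      by (rule integral_FTC_Icc_real) (use that G isCont_inv_char[OF i] in auto)
    finally show ?thesis by simp
  qed
  then have eq': "cdf M b - G b = cdf M a - G a" if "measure M {a} = 0" "measure M {b} = 0" for a b
    using that by (metis linorder_less_linear)
  have approx: "\<exists>S. (\<forall>n. measure M {S n} = 0) \<and> filterlim S (at_right x) sequentially" for x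
  proof -
    have "\<exists>y. y \<in> {x<..<x + 1 / Suc n} \<and> measure M {y} = 0" for n
    proof (rule ccontr)
      assume "\<not> ?thesis"
      then have "{x<..<x + 1 / Suc n} \<subseteq> {x. measure M {x} > 0}"
        by (auto simp: zero_less_measure_iff)
      then have "countable {x<..<x + 1 / Suc n}" using countable_atoms by (rule countable_subset)
      moreover have "uncountable {x<..<x + 1 / Suc n}" by (subst uncountable_open_interval) simp
      ultimately show False by simp
    qed
    then obtain S where S: "\<And>n. S n \<in> {x<..<x + 1 / Suc n}" "\<And>n. measure M {S n} = 0" by metis
    have "S \<longlonglongrightarrow> x"
    proof (rule tendsto_sandwich[of "\<lambda>_. x" _ _ "\<lambda>n. x + 1 / Suc n"])
      show "\<forall>\<^sub>F n in sequentially. x \<le> S n" "\<forall>\<^sub>F n in sequentially. S n \<le> x + 1 / Suc n"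
        using S(1) by (auto intro!: always_eventually simp: less_imp_le)
      have "(\<lambda>n. x + 1 / Suc n) \<longlonglongrightarrow> x + 0"
        by (intro tendsto_intros LIMSEQ_Suc[OF lim_1_over_n])
      then show "(\<lambda>n. x + 1 / Suc n) \<longlonglongrightarrow> x" by simp
    qed simp
    then have "filterlim S (at_right x) sequentially"
      using S(1) by (intro tendsto_imp_filterlim_at_right) auto
    then show ?thesis using S(2) by blast
  qed
  obtain x0 where x0: "measure M {x0} = 0" using approx[of 0] by blast
  have K: "cdf M x = (cdf M x0 - G x0) + G x" for x
  proof -
    obtain S where S: "\<And>n. measure M {S n} = 0" "filterlim S (at_right x) sequentially" using approx by blast
    have "((\<lambda>y. cdf M y - G y) \<longlongrightarrow> cdf M x - G x) (at_right x)"
      using cdf_is_right_cont[of x] DERIV_isCont[OF G[of x]]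
      by (intro tendsto_diff) (auto simp: continuous_within isCont_def intro: filterlim_mono[OF _ order_refl at_le])
    then have "(\<lambda>n. cdf M (S n) - G (S n)) \<longlonglongrightarrow> cdf M x - G x"
      using S(2) by (rule filterlim_compose)
    moreover have "(\<lambda>n. cdf M (S n) - G (S n)) = (\<lambda>n. cdf M x0 - G x0)"
      using eq'[OF x0 S(1)] by (intro ext)
    ultimately have "cdf M x - G x = cdf M x0 - G x0"
      using LIMSEQ_unique[OF _ tendsto_const] by auto
    then show ?thesis by simp
  qed
  have der: "(cdf M has_real_derivative inv_char M x) (at x)" for x
  proof -
    have "((\<lambda>x. (cdf M x0 - G x0) + G x) has_real_derivative 0 + inv_char M x) (at x)"
      by (intro DERIV_add DERIV_const G)
    moreover have "(\<lambda>x. (cdf M x0 - G x0) + G x) = cdf M" using K by (intro ext) (rule sym)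
    ultimately show ?thesis by simp
  qed
  then show "(cdf M has_real_derivative inv_char M x) (at x)" .
  have nn: "0 \<le> inv_char M x" for x
    by (rule mono_on_imp_deriv_nonneg[OF _ der[of x], of UNIV]) (auto simp: mono_on_def cdf_nondecreasing)
  then show "0 \<le> inv_char M x" .
  show "M = density lborel (\<lambda>x. ennreal (inv_char M x))"
  proof (rule measure_eqI_lessThan)
    fix x :: real
    show "emeasure M {x<..} < \<infinity>" by (simp add: emeasure_eq_measure less_top[symmetric])
    have "emeasure M {x<..} = ennreal (1 - cdf M x)"
    proof -
      have "{x<..} = space M - {..x}" by auto
      then show ?thesis using prob_compl[of "{..x}"] by (simp add: emeasure_eq_measure cdf_def)
    qed
    also have "\<dots> = (\<integral>\<^sup>+y. ennreal (inv_char M y) * indicator {x ..} y \<partial>lborel)"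
      by (rule nn_integral_FTC_atLeast[symmetric]) (use der nn cdf_lim_at_top_prob in auto)
    also have "\<dots> = (\<integral>\<^sup>+y. ennreal (inv_char M y) * indicator {x <..} y \<partial>lborel)"
      by (intro nn_integral_cong_AE) (use AE_lborel_singleton[of x] in \<open>eventually_elim, auto simp: indicator_def\<close>)
    also have "\<dots> = emeasure (density lborel (\<lambda>x. ennreal (inv_char M x))) {x<..}"
      by (simp add: emeasure_density)
    finally show "emeasure M {x<..} = emeasure (density lborel (\<lambda>x. ennreal (inv_char M x))) {x<..}" .
  qed simp_all
qed

end

section \<open>Bounds on the densities of the subordinator\<close>

lemma norm_integral_le_of_bound:
  fixes f :: "real \<Rightarrow> complex"
  assumes "continuous_on {a..b} f" "continuous_on {a..b} g" "\<And>x. x \<in> {a..b} \<Longrightarrow> norm (f x) \<le> g x"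
  shows "norm (integral {a..b} f) \<le> integral {a..b} g"
  by (rule Henstock_Kurzweil_Integration.integral_norm_bound_integral)
     (use assms in \<open>simp_all add: integrable_continuous_real\<close>)

context subordinator_laws
begin

lemma real_distribution_eta: "s > 0 \<Longrightarrow> real_distribution (\<eta> s)"
  by (intro real_distribution.intro prob real_distribution_axioms.intro sets_eta)

lemma cphi_measurable [measurable]: "cphi \<in> borel_measurable borel"
  unfolding cphi_def cis_conv_exp by measurable

text \<open>Written with \<open>cphi\<close> and not with \<open>char (\<eta> s)\<close>: the
  formula is visibly measurable in \<open>s\<close> and \<tau> jointly, whereas nothing is assumed
  about the dependence of \<open>\<eta> s\<close> on \<open>s\<close>.\<close>

definition dens :: "real \<Rightarrow> real \<Rightarrow> real" where
  "dens s \<tau> = Re (LINT \<theta>|lborel. iexp (- (\<theta> * \<tau>)) * exp (- s * cphi \<theta>)) / (2 * pi)"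

lemma dens_measurable [measurable]: "(\<lambda>(s, \<tau>). dens s \<tau>) \<in> borel_measurable (borel \<Otimes>\<^sub>M borel)"
  unfolding dens_def by measurable

lemma dens_measurable' [measurable]:
  assumes [measurable]: "f \<in> borel_measurable M" "g \<in> borel_measurable M"
  shows "(\<lambda>w. dens (f w) (g w)) \<in> borel_measurable M"
proof -
  have "(\<lambda>w. (f w, g w)) \<in> measurable M (borel \<Otimes>\<^sub>M borel)" by measurable
  from measurable_compose[OF this dens_measurable] show ?thesis by simp
qed

lemma dens_eq: "s > 0 \<Longrightarrow> dens s = inv_char (\<eta> s)"
  by (rule ext) (simp only: dens_def inv_char_def char_eta)

lemma integrable_inverse_1_plus_sq: "integrable lborel (\<lambda>x::real. 1 / (1 + x\<^sup>2))"
  using integrable_inverse_1_plus_square by (simp add: set_integrable_def inverse_eq_divide)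

lemma char_eta_integrable:
  assumes s: "s > 0"
  shows "integrable lborel (char (\<eta> s))"
proof -
  obtain C q where C: "C \<ge> 0" "q \<ge> 0" "\<And>s \<theta>. s > 0 \<Longrightarrow> norm (char (\<eta> s) \<theta>) \<le> C * (1 + s powr (- q)) / (1 + \<theta>\<^sup>2)"
    using char_eta_bound by blast
  interpret real_distribution "\<eta> s" by (rule real_distribution_eta[OF s])
  show ?thesis
  proof (rule Bochner_Integration.integrable_bound[OF integrable_mult_right[OF integrable_inverse_1_plus_sq, of "C * (1 + s powr (- q))"]])
    show "AE \<theta> in lborel. norm (char (\<eta> s) \<theta>) \<le> norm (C * (1 + s powr (- q)) * (1 / (1 + \<theta>\<^sup>2)))"
    proof (rule AE_I2)
      fix \<theta>
      have "norm (char (\<eta> s) \<theta>) \<le> C * (1 + s powr (- q)) * (1 / (1 + \<theta>\<^sup>2))" using C(3)[OF s] by simp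
      also have "\<dots> \<le> norm (C * (1 + s powr (- q)) * (1 / (1 + \<theta>\<^sup>2)))" unfolding real_norm_def by (rule abs_ge_self)
      finally show "norm (char (\<eta> s) \<theta>) \<le> norm (C * (1 + s powr (- q)) * (1 / (1 + \<theta>\<^sup>2)))" .
    qed
  qed simp
qed

lemma dens_nonneg: "s > 0 \<Longrightarrow> 0 \<le> dens s \<tau>"
  using real_distribution.inv_char_nonneg[OF real_distribution_eta char_eta_integrable] by (simp add: dens_eq)

lemma dens_isCont: "s > 0 \<Longrightarrow> isCont (dens s) \<tau>"
  using real_distribution.isCont_inv_char[OF real_distribution_eta char_eta_integrable] by (simp add: dens_eq)

lemma eta_eq_density: "s > 0 \<Longrightarrow> \<eta> s = density lborel (\<lambda>x. ennreal (dens s x))"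
  using real_distribution.density_inv_char[OF real_distribution_eta char_eta_integrable] by (simp add: dens_eq)

lemma dens_bound:
  "\<exists>C q. C \<ge> 0 \<and> q \<ge> 0 \<and> (\<forall>s>0. \<forall>\<tau>. \<bar>dens s \<tau>\<bar> \<le> C * (1 + s powr (- q)))"
proof -
  obtain C q where C: "C \<ge> 0" "q \<ge> 0" "\<And>s \<theta>. s > 0 \<Longrightarrow> norm (char (\<eta> s) \<theta>) \<le> C * (1 + s powr (- q)) / (1 + \<theta>\<^sup>2)"
    using char_eta_bound by blast
  define I where "I = (LINT x|lborel. 1 / (1 + x\<^sup>2 :: real))"
  have I0: "I \<ge> 0" unfolding I_def by (intro Bochner_Integration.integral_nonneg) simp
  have b: "\<bar>dens s \<tau>\<bar> \<le> (C * I) * (1 + s powr (- q))" if s: "s > 0" for s \<tau>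
  proof -
    let ?J = "LINT \<theta>|lborel. iexp (- (\<theta> * \<tau>)) * char (\<eta> s) \<theta>"
    have "norm ?J \<le> (LINT \<theta>|lborel. C * (1 + s powr (- q)) * (1 / (1 + \<theta>\<^sup>2)))"
    proof (rule Bochner_Integration.integral_norm_bound_integral)
      show "integrable lborel (\<lambda>\<theta>. iexp (- (\<theta> * \<tau>)) * char (\<eta> s) \<theta>)"
        by (rule real_distribution.integrable_iexp_char[OF real_distribution_eta[OF s] char_eta_integrable[OF s]])
      show "integrable lborel (\<lambda>\<theta>. C * (1 + s powr (- q)) * (1 / (1 + \<theta>\<^sup>2)))"
        by (rule integrable_mult_right[OF integrable_inverse_1_plus_sq])
      show "norm (iexp (- (\<theta> * \<tau>)) * char (\<eta> s) \<theta>) \<le> C * (1 + s powr (- q)) * (1 / (1 + \<theta>\<^sup>2))" for \<theta>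
        using C(3)[OF s, of \<theta>] by (simp add: norm_mult)
    qed
    also have "\<dots> = C * (1 + s powr (- q)) * I" unfolding I_def by (rule integral_mult_right_zero)
    finally have J: "norm ?J \<le> C * I * (1 + s powr (- q))" by (simp only: mult_ac)
    have "\<bar>dens s \<tau>\<bar> = \<bar>Re ?J\<bar> / (2 * pi)" by (simp add: dens_eq[OF s] inv_char_def)
    also have "\<dots> \<le> \<bar>Re ?J\<bar> / 1" using pi_gt3 by (intro divide_left_mono) auto
    also have "\<dots> \<le> norm ?J" by (simp add: abs_Re_le_cmod)
    finally show ?thesis using J by linarith
  qed
  have "0 \<le> C * I" using C(1) I0 by simp
  with C(2) b show ?thesis by blast
qed

text \<open>The 2 comes from the boundary terms, each at most 1. The remaining integrand is at most
  \<open>s * S' \<theta> * R \<theta>\<close>, the derivative of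
  \<open>- R \<theta> / \<kappa>\<close>, and integrates to at most \<open>1 / \<kappa>\<close>,
  whatever \<open>s\<close> is. The interval avoids 0, where
  \<open>\<theta> powr (\<alpha> j - 1)\<close> is singular, and \<sigma> lets both half-lines share
  the argument.\<close>

lemma oscillatory_bound:
  assumes s: "s > 0" and p: "p \<noteq> 0" and \<sigma>: "\<sigma> = 1 \<or> \<sigma> = -1" and e: "0 < e" "e \<le> T"
  shows "norm (integral {e..T} (\<lambda>\<theta>. iexp (p * \<theta>) * char (\<eta> s) (\<sigma> * \<theta>))) \<le> (2 + 1 / \<kappa>) / \<bar>p\<bar>"
proof -
  define c where "c j = cis (- \<sigma> * (pi * \<alpha> j / 2))" for j
  define \<Psi> where "\<Psi> \<theta> = (\<Sum>j=1..m. complex_of_real (lam j * \<theta> powr \<alpha> j) * c j)" for \<theta>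
  define \<Psi>' where "\<Psi>' \<theta> = (\<Sum>j=1..m. complex_of_real (lam j * (\<alpha> j * \<theta> powr (\<alpha> j - 1))) * c j)" for \<theta>
  define F where "F \<theta> = iexp (p * \<theta>) * exp (- s * \<Psi> \<theta>)" for \<theta>
  define S where "S \<theta> = (\<Sum>j=1..m. lam j * \<theta> powr \<alpha> j)" for \<theta>
  define S' where "S' \<theta> = (\<Sum>j=1..m. lam j * (\<alpha> j * \<theta> powr (\<alpha> j - 1)))" for \<theta>
  define R where "R \<theta> = exp (- (s * (\<kappa> * S \<theta>)))" for \<theta>
  have char: "char (\<eta> s) (\<sigma> * \<theta>) = exp (- s * \<Psi> \<theta>)" if "\<theta> > 0" for \<theta>
  proof -
    have "cphi (\<sigma> * \<theta>) = \<Psi> \<theta>"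
      unfolding cphi_def \<Psi>_def c_def using \<sigma> that by (auto simp: abs_mult sgn_mult)
    then show ?thesis by (simp add: char_eta[OF s])
  qed
  have normF: "norm (F \<theta>) \<le> R \<theta>" if "\<theta> > 0" for \<theta>
  proof -
    have "norm (F \<theta>) = norm (char (\<eta> s) (\<sigma> * \<theta>))" by (simp add: F_def norm_mult char[OF that])
    also have "\<dots> \<le> R \<theta>"
      using norm_char_eta[OF s, of "\<sigma> * \<theta>"] \<sigma> that by (auto simp: R_def S_def abs_mult)
    finally show ?thesis .
  qed
  have R1: "R \<theta> \<le> 1" if "\<theta> > 0" for \<theta>
  proof -
    have "0 \<le> S \<theta>" unfolding S_def by (intro sum_nonneg mult_nonneg_nonneg less_imp_le[OF lam] powr_ge_zero)
    then show ?thesis using s \<kappa>(1) by (simp add: R_def)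
  qed
  have powr_der: "((\<lambda>\<theta>. \<theta> powr \<alpha> j) has_real_derivative \<alpha> j * \<theta> powr (\<alpha> j - 1)) (at \<theta>)" if "\<theta> > 0" for \<theta> j
    using has_real_derivative_powr[OF that] .
  have \<Psi>_der: "(\<Psi> has_vector_derivative \<Psi>' \<theta>) (at \<theta>)" if "\<theta> > 0" for \<theta>
  proof -
    have "((\<lambda>\<theta>. complex_of_real (lam j * \<theta> powr \<alpha> j) * c j) has_vector_derivative
        complex_of_real (lam j * (\<alpha> j * \<theta> powr (\<alpha> j - 1))) * c j) (at \<theta>)" for j
    proof -
      have "((\<lambda>\<theta>. lam j * \<theta> powr \<alpha> j) has_real_derivative lam j * (\<alpha> j * \<theta> powr (\<alpha> j - 1))) (at \<theta>)"
        by (rule DERIV_cmult[OF powr_der[OF that]])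
      then show ?thesis
        by (intro has_vector_derivative_mult_left has_vector_derivative_of_real)
           (simp only: has_real_derivative_iff_has_vector_derivative)
    qed
    then show ?thesis unfolding \<Psi>_def[abs_def] \<Psi>'_def by (intro has_vector_derivative_sum)
  qed
  have F_der: "(F has_vector_derivative (\<i> * p * F \<theta> - s * \<Psi>' \<theta> * F \<theta>)) (at \<theta>)" if "\<theta> > 0" for \<theta>
  proof -
    have "((\<lambda>\<theta>. \<i> * complex_of_real p * complex_of_real \<theta> - s * \<Psi> \<theta>) has_vector_derivative (\<i> * p - s * \<Psi>' \<theta>)) (at \<theta>)"
    proof (intro has_vector_derivative_diff has_vector_derivative_mult_right \<Psi>_der[OF that])
      have "((\<lambda>\<theta>. complex_of_real \<theta>) has_vector_derivative 1) (at \<theta>)"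
        using has_vector_derivative_of_real[of id 1 "at \<theta>"] by (simp add: has_vector_derivative_id id_def)
      from has_vector_derivative_mult_right[OF this, of "\<i> * p"]
      show "((\<lambda>\<theta>. \<i> * complex_of_real p * complex_of_real \<theta>) has_vector_derivative \<i> * p) (at \<theta>)" by simp
    qed
    from field_vector_diff_chain_at[OF this DERIV_exp]
    have "(exp \<circ> (\<lambda>\<theta>. \<i> * complex_of_real p * complex_of_real \<theta> - s * \<Psi> \<theta>) has_vector_derivative
       (\<i> * p - s * \<Psi>' \<theta>) * exp (\<i> * complex_of_real p * complex_of_real \<theta> - s * \<Psi> \<theta>)) (at \<theta>)" .
    moreover have "exp \<circ> (\<lambda>\<theta>. \<i> * complex_of_real p * complex_of_real \<theta> - s * \<Psi> \<theta>) = F"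
      by (rule ext) (simp add: F_def exp_add[symmetric] mult.assoc)
    moreover have "exp (\<i> * complex_of_real p * complex_of_real \<theta> - s * \<Psi> \<theta>) = F \<theta>"
      by (simp add: F_def exp_add[symmetric] mult.assoc)
    ultimately show ?thesis by (simp only: left_diff_distrib)
  qed
  have cF: "continuous_on {e..T} F"
    by (rule continuous_at_imp_continuous_on) (use e in \<open>auto intro!: has_vector_derivative_continuous[OF F_der]\<close>)
  have c\<Psi>': "continuous_on {e..T} \<Psi>'"
    unfolding \<Psi>'_def using e by (intro continuous_intros) auto
  have cPF: "continuous_on {e..T} (\<lambda>\<theta>. s * \<Psi>' \<theta> * F \<theta>)"
    by (intro continuous_on_mult continuous_on_const c\<Psi>' cF)
  have "((\<lambda>\<theta>. \<i> * p * F \<theta> - s * \<Psi>' \<theta> * F \<theta>) has_integral (F T - F e)) {e..T}"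
    by (rule fundamental_theorem_of_calculus[OF e(2)])
       (rule has_vector_derivative_at_within[OF F_der], use e in simp)
  then have e1: "integral {e..T} (\<lambda>\<theta>. \<i> * p * F \<theta> - s * \<Psi>' \<theta> * F \<theta>) = F T - F e"
    by (rule integral_unique)
  have e2: "integral {e..T} (\<lambda>\<theta>. \<i> * p * F \<theta> - s * \<Psi>' \<theta> * F \<theta>) =
      integral {e..T} (\<lambda>\<theta>. \<i> * p * F \<theta>) - integral {e..T} (\<lambda>\<theta>. s * \<Psi>' \<theta> * F \<theta>)"
    by (intro Henstock_Kurzweil_Integration.integral_diff integrable_continuous_real cPF continuous_on_mult continuous_on_const cF)
  have e3: "integral {e..T} (\<lambda>\<theta>. \<i> * p * F \<theta>) = \<i> * p * integral {e..T} F"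
    by (rule Henstock_Kurzweil_Integration.integral_mult_right)
  have "\<i> * p * integral {e..T} F = F T - F e + integral {e..T} (\<lambda>\<theta>. s * \<Psi>' \<theta> * F \<theta>)"
    using e2 unfolding e1 e3 by simp
  moreover have pI: "\<bar>p\<bar> * norm (integral {e..T} F) = norm (\<i> * p * integral {e..T} F)"
    by (simp add: norm_mult)
  ultimately have "\<bar>p\<bar> * norm (integral {e..T} F) = norm (F T - F e + integral {e..T} (\<lambda>\<theta>. s * \<Psi>' \<theta> * F \<theta>))"
    by (simp only:)
  also have "\<dots> \<le> norm (F T) + norm (F e) + norm (integral {e..T} (\<lambda>\<theta>. s * \<Psi>' \<theta> * F \<theta>))"
    by (intro order_trans[OF norm_triangle_ineq] add_right_mono norm_triangle_ineq4)
  also have "\<dots> \<le> 1 + 1 + 1 / \<kappa>"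
  proof (intro add_mono)
    show "norm (F T) \<le> 1" "norm (F e) \<le> 1"
      by (rule order_trans[OF normF R1]; use e in linarith)+
    have R_der: "((\<lambda>\<theta>. - R \<theta> / \<kappa>) has_vector_derivative s * S' \<theta> * R \<theta>) (at \<theta> within {e..T})" if "\<theta> > 0" for \<theta>
    proof -
      have "(S has_real_derivative S' \<theta>) (at \<theta>)"
        unfolding S_def[abs_def] S'_def by (intro DERIV_sum DERIV_cmult powr_der that)
      then have "((\<lambda>\<theta>. - R \<theta> / \<kappa>) has_real_derivative s * S' \<theta> * R \<theta>) (at \<theta>)"
        unfolding R_def[abs_def] using \<kappa>(1) by (auto intro!: derivative_eq_intros)
      then show ?thesis
        unfolding has_real_derivative_iff_has_vector_derivative by (rule has_vector_derivative_at_within)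
    qed
    have "((\<lambda>\<theta>. s * S' \<theta> * R \<theta>) has_integral (- R T / \<kappa> - - R e / \<kappa>)) {e..T}"
      by (rule fundamental_theorem_of_calculus[OF e(2)]) (use e R_der in auto)
    then have intR: "integral {e..T} (\<lambda>\<theta>. s * S' \<theta> * R \<theta>) = (R e - R T) / \<kappa>"
      by (simp add: integral_unique diff_divide_distrib)
    have "norm (integral {e..T} (\<lambda>\<theta>. s * \<Psi>' \<theta> * F \<theta>)) \<le> integral {e..T} (\<lambda>\<theta>. s * S' \<theta> * R \<theta>)"
    proof (rule norm_integral_le_of_bound[OF cPF])
      show "continuous_on {e..T} (\<lambda>\<theta>. s * S' \<theta> * R \<theta>)"
        unfolding S'_def R_def S_def using e by (intro continuous_intros) auto
      fix \<theta> assume "\<theta> \<in> {e..T}"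
      then have \<theta>: "\<theta> > 0" using e by auto
      have "norm (\<Psi>' \<theta>) \<le> (\<Sum>j=1..m. norm (complex_of_real (lam j * (\<alpha> j * \<theta> powr (\<alpha> j - 1))) * c j))"
        unfolding \<Psi>'_def by (rule norm_sum)
      also have "\<dots> = S' \<theta>"
        unfolding S'_def
      proof (rule sum.cong[OF refl])
        fix j assume j: "j \<in> {1..m}"
        have "0 \<le> lam j * (\<alpha> j * \<theta> powr (\<alpha> j - 1))" using lam[OF j] \<alpha>[OF j] by simp
        then show "norm (complex_of_real (lam j * (\<alpha> j * \<theta> powr (\<alpha> j - 1))) * c j) = lam j * (\<alpha> j * \<theta> powr (\<alpha> j - 1))"
          unfolding norm_mult c_def norm_cis norm_of_real by simp
      qed
      finally have "norm (\<Psi>' \<theta>) \<le> S' \<theta>" .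
      then show "norm (s * \<Psi>' \<theta> * F \<theta>) \<le> s * S' \<theta> * R \<theta>"
        using normF[OF \<theta>] s order_trans[OF norm_ge_zero \<open>norm (\<Psi>' \<theta>) \<le> S' \<theta>\<close>]
        unfolding norm_mult norm_of_real by (intro mult_mono mult_nonneg_nonneg) auto
    qed
    also have "\<dots> \<le> 1 / \<kappa>"
      unfolding intR
    proof (rule divide_right_mono)
      have "0 \<le> R T" by (simp add: R_def)
      then show "R e - R T \<le> 1" using R1[OF e(1)] by linarith
    qed (use \<kappa>(1) in simp)
    finally show "norm (integral {e..T} (\<lambda>\<theta>. s * \<Psi>' \<theta> * F \<theta>)) \<le> 1 / \<kappa>" .
  qed
  finally have "\<bar>p\<bar> * norm (integral {e..T} F) \<le> 2 + 1 / \<kappa>" by simp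
  then have "norm (integral {e..T} F) \<le> (2 + 1 / \<kappa>) / \<bar>p\<bar>"
    using p by (subst pos_le_divide_eq) (simp_all add: mult.commute)
  moreover have "integral {e..T} F = integral {e..T} (\<lambda>\<theta>. iexp (p * \<theta>) * char (\<eta> s) (\<sigma> * \<theta>))"
    by (rule Henstock_Kurzweil_Integration.integral_cong) (use e char in \<open>simp add: F_def\<close>)
  ultimately show ?thesis by simp
qed

lemma half_line_bound:
  assumes s: "s > 0" and p: "p \<noteq> 0" and \<sigma>: "\<sigma> = 1 \<or> \<sigma> = -1"
    and i: "integrable lborel (\<lambda>\<theta>. iexp (p * \<theta>) * char (\<eta> s) (\<sigma> * \<theta>))"
  shows "norm (LINT \<theta>|lborel. indicator {0<..} \<theta> *\<^sub>R (iexp (p * \<theta>) * char (\<eta> s) (\<sigma> * \<theta>))) \<le> (2 + 1 / \<kappa>) / \<bar>p\<bar>"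
proof -
  define f where "f \<theta> = iexp (p * \<theta>) * char (\<eta> s) (\<sigma> * \<theta>)" for \<theta>
  have fi: "integrable lborel f" using i unfolding f_def[abs_def] .
  have "(\<lambda>n. LINT \<theta>|lborel. indicator {1 / Suc n..Suc n} \<theta> *\<^sub>R f \<theta>) \<longlonglongrightarrow> (LINT \<theta>|lborel. indicator {0<..} \<theta> *\<^sub>R f \<theta>)"
  proof (rule integral_dominated_convergence[where w="\<lambda>\<theta>. norm (f \<theta>)"])
    show "AE \<theta> in lborel. (\<lambda>n. indicator {1 / Suc n..Suc n} \<theta> *\<^sub>R f \<theta>) \<longlonglongrightarrow> indicator {0<..} \<theta> *\<^sub>R f \<theta>"
    proof (rule AE_I2)
      fix \<theta> :: real
      have "\<forall>\<^sub>F n in sequentially. indicator {1 / Suc n..Suc n} \<theta> = (indicator {0<..} \<theta> :: real)"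
      proof (cases "\<theta> > 0")
        case True
        obtain n0 :: nat where n0: "max \<theta> (1 / \<theta>) < real n0" using reals_Archimedean2 by blast
        have "1 / real (Suc n) \<le> \<theta> \<and> \<theta> \<le> real (Suc n)" if "n \<ge> n0" for n
        proof -
          have "1 / \<theta> \<le> real (Suc n)" "\<theta> \<le> real (Suc n)" using n0 that by auto
          then show ?thesis using True by (simp add: field_simps)
        qed
        then show ?thesis using True by (auto simp: eventually_sequentially intro!: exI[of _ n0])
      next
        case False
        have "\<not> 1 / real (Suc n) \<le> \<theta>" for n
        proof -
          have "0 < 1 / real (Suc n)" by simp
          then show ?thesis using False by linarith
        qed
        then show ?thesis using False by (intro always_eventually) auto
      qed
      then show "(\<lambda>n. indicator {1 / Suc n..Suc n} \<theta> *\<^sub>R f \<theta>) \<longlonglongrightarrow> indicator {0<..} \<theta> *\<^sub>R f \<theta>"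
        by (intro tendsto_eventually) (auto elim: eventually_mono)
    qed
    show "integrable lborel (\<lambda>\<theta>. norm (f \<theta>))" using fi by (rule integrable_norm)
    show "(\<lambda>\<theta>. indicator {0<..} \<theta> *\<^sub>R f \<theta>) \<in> borel_measurable lborel"
      using borel_measurable_integrable[OF fi] by measurable
    show "(\<lambda>\<theta>. indicator {1 / Suc n..Suc n} \<theta> *\<^sub>R f \<theta>) \<in> borel_measurable lborel" for n
      using borel_measurable_integrable[OF fi] by measurable
    show "AE \<theta> in lborel. norm (indicator {1 / Suc n..Suc n} \<theta> *\<^sub>R f \<theta>) \<le> norm (f \<theta>)" for n
      by (intro AE_I2) (simp add: indicator_def)
  qed
  then have lim: "(\<lambda>n. norm (LINT \<theta>|lborel. indicator {1 / Suc n..Suc n} \<theta> *\<^sub>R f \<theta>)) \<longlonglongrightarrow> norm (LINT \<theta>|lborel. indicator {0<..} \<theta> *\<^sub>R f \<theta>)"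
    by (rule tendsto_norm)
  have "norm (LINT \<theta>|lborel. indicator {1 / Suc n..Suc n} \<theta> *\<^sub>R f \<theta>) \<le> (2 + 1 / \<kappa>) / \<bar>p\<bar>" for n
  proof -
    have "set_integrable lborel {1 / Suc n..Suc n} f"
      unfolding set_integrable_def by (rule integrable_mult_indicator[OF _ fi]) simp
    then have "(LINT \<theta>|lborel. indicator {1 / Suc n..Suc n} \<theta> *\<^sub>R f \<theta>) = integral {1 / Suc n..Suc n} f"
      using set_borel_integral_eq_integral(2) unfolding set_lebesgue_integral_def by blast
    moreover have "norm (integral {1 / Suc n..Suc n} f) \<le> (2 + 1 / \<kappa>) / \<bar>p\<bar>"
      unfolding f_def 
    proof (rule oscillatory_bound[OF s p \<sigma>])
      have "1 / real (Suc n) \<le> 1" "1 \<le> real (Suc n)" by simp_all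
      then show "1 / real (Suc n) \<le> real (Suc n)" by linarith
    qed simp
    ultimately show ?thesis by simp
  qed
  then have "norm (LINT \<theta>|lborel. indicator {0<..} \<theta> *\<^sub>R f \<theta>) \<le> (2 + 1 / \<kappa>) / \<bar>p\<bar>"
    by (intro LIMSEQ_le_const2[OF lim]) blast
  then show ?thesis by (simp add: f_def)
qed

text \<open>One integration by parts; the bound is uniform in \<open>s\<close> because
  \<open>|d/d\<theta> exp (- s * cphi \<theta>)|\<close> is dominated by the derivative of a monotone function.\<close>

lemma dens_le_inverse:
  assumes s: "s > 0" and \<tau>: "\<tau> > 0"
  shows "\<bar>dens s \<tau>\<bar> \<le> (2 + 1 / \<kappa>) / \<tau>"
proof -
  define f where "f \<theta> = iexp (- (\<theta> * \<tau>)) * char (\<eta> s) \<theta>" for \<theta>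
  have fi: "integrable lborel f"
    unfolding f_def by (rule real_distribution.integrable_iexp_char[OF real_distribution_eta[OF s] char_eta_integrable[OF s]])
  have fi': "integrable lborel (\<lambda>\<theta>. f (- \<theta>))"
    using lborel_integrable_real_affine[OF fi, of "-1" 0] by simp
  have fpos: "f = (\<lambda>\<theta>. iexp ((- \<tau>) * \<theta>) * char (\<eta> s) (1 * \<theta>))"
    by (rule ext) (simp add: f_def mult.commute)
  have fneg: "(\<lambda>\<theta>. f (- \<theta>)) = (\<lambda>\<theta>. iexp (\<tau> * \<theta>) * char (\<eta> s) ((-1) * \<theta>))"
    by (rule ext) (simp add: f_def mult.commute)
  have ip: "integrable lborel (\<lambda>\<theta>. indicator {0<..} \<theta> *\<^sub>R f \<theta>)"
    by (rule integrable_mult_indicator[OF _ fi]) simp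
  have ineg: "integrable lborel (\<lambda>\<theta>. indicator {..<0} \<theta> *\<^sub>R f \<theta>)"
    by (rule integrable_mult_indicator[OF _ fi]) simp
  have "(LINT \<theta>|lborel. f \<theta>) = (LINT \<theta>|lborel. indicator {0<..} \<theta> *\<^sub>R f \<theta> + indicator {..<0} \<theta> *\<^sub>R f \<theta>)"
  proof (rule integral_cong_AE)
    show "AE \<theta> in lborel. f \<theta> = indicator {0<..} \<theta> *\<^sub>R f \<theta> + indicator {..<0} \<theta> *\<^sub>R f \<theta>"
      using AE_lborel_singleton[of "0::real"] by eventually_elim (auto simp: indicator_def)
  qed (use fi ip ineg in \<open>simp_all add: borel_measurable_integrable\<close>)
  also have "\<dots> = (LINT \<theta>|lborel. indicator {0<..} \<theta> *\<^sub>R f \<theta>) + (LINT \<theta>|lborel. indicator {..<0} \<theta> *\<^sub>R f \<theta>)"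
    by (rule Bochner_Integration.integral_add[OF ip ineg])
  also have "(LINT \<theta>|lborel. indicator {..<0} \<theta> *\<^sub>R f \<theta>) = (LINT \<theta>|lborel. indicator {0<..} \<theta> *\<^sub>R f (- \<theta>))"
    using lborel_integral_real_affine[of "-1" "\<lambda>\<theta>. indicator {..<0} \<theta> *\<^sub>R f \<theta>" 0]
    by (simp add: indicator_def cong: if_cong)
  finally have E: "(LINT \<theta>|lborel. f \<theta>) = (LINT \<theta>|lborel. indicator {0<..} \<theta> *\<^sub>R f \<theta>) + (LINT \<theta>|lborel. indicator {0<..} \<theta> *\<^sub>R f (- \<theta>))" .
  have "norm (LINT \<theta>|lborel. f \<theta>) \<le> (2 + 1 / \<kappa>) / \<bar>- \<tau>\<bar> + (2 + 1 / \<kappa>) / \<bar>\<tau>\<bar>"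
    unfolding E
  proof (rule order_trans[OF norm_triangle_ineq], rule add_mono)
    show "norm (LINT \<theta>|lborel. indicator {0<..} \<theta> *\<^sub>R f \<theta>) \<le> (2 + 1 / \<kappa>) / \<bar>- \<tau>\<bar>"
      unfolding fpos by (rule half_line_bound[OF s]) (use \<tau> fi[unfolded fpos] in simp_all)
    have "norm (LINT \<theta>|lborel. indicator {0<..} \<theta> *\<^sub>R (iexp (\<tau> * \<theta>) * char (\<eta> s) ((-1) * \<theta>))) \<le> (2 + 1 / \<kappa>) / \<bar>\<tau>\<bar>"
      by (rule half_line_bound[OF s]) (use \<tau> fi'[unfolded fneg] in simp_all)
    then show "norm (LINT \<theta>|lborel. indicator {0<..} \<theta> *\<^sub>R f (- \<theta>)) \<le> (2 + 1 / \<kappa>) / \<bar>\<tau>\<bar>"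
      using fun_cong[OF fneg] by (simp only:)
  qed
  then have "norm (LINT \<theta>|lborel. f \<theta>) \<le> (2 + 1 / \<kappa>) / \<tau> + (2 + 1 / \<kappa>) / \<tau>"
    using \<tau> by simp
  then have J: "norm (LINT \<theta>|lborel. f \<theta>) \<le> 2 * ((2 + 1 / \<kappa>) / \<tau>)" by linarith
  have "\<bar>dens s \<tau>\<bar> = \<bar>Re (LINT \<theta>|lborel. f \<theta>)\<bar> / (2 * pi)" by (simp add: dens_eq[OF s] inv_char_def f_def)
  \<comment> \<open>Replacing \<open>2 * pi\<close> by 2 is enough to cancel the factor 2 that the
    two half-lines produce.\<close>
  also have "\<dots> \<le> \<bar>Re (LINT \<theta>|lborel. f \<theta>)\<bar> / 2" using pi_gt3 by (intro divide_left_mono) auto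
  also have "\<dots> \<le> norm (LINT \<theta>|lborel. f \<theta>) / 2" by (intro divide_right_mono abs_Re_le_cmod) simp
  finally show ?thesis using J by linarith
qed

end

subsection \<open>Caputo derivatives of averages over the inverse\<close>

lemma has_bochner_integral_exp_atLeast:
  assumes a: "(a::real) > 0"
  shows "has_bochner_integral lborel (\<lambda>t. indicator {0..} t * exp (- (a * t))) (1 / a)"
proof (rule has_bochner_integral_nn_integral)
  have "((\<lambda>t. - exp (- (a * t)) / a) \<longlongrightarrow> 0) at_top"
    using a by real_asymp
  then have "(\<integral>\<^sup>+t. ennreal (exp (- (a * t))) * indicator {0..} t \<partial>lborel) = 0 - (- exp (- (a * 0)) / a)"
    using a by (intro nn_integral_FTC_atLeast) (auto intro!: derivative_eq_intros)
  also have "(\<integral>\<^sup>+t. ennreal (exp (- (a * t))) * indicator {0..} t \<partial>lborel) =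
     (\<integral>\<^sup>+t. ennreal (indicator {0..} t * exp (- (a * t))) \<partial>lborel)"
    by (intro nn_integral_cong) (simp add: indicator_def)
  finally show "(\<integral>\<^sup>+t. ennreal (indicator {0..} t * exp (- (a * t))) \<partial>lborel) = ennreal (1 / a)"
    by simp
qed (use a in auto)

lemma has_bochner_integral_Gamma:
  fixes \<beta> \<mu> :: real
  assumes \<beta>: "\<beta> > 0" and \<mu>: "\<mu> > 0"
  shows "has_bochner_integral lborel (\<lambda>x. indicator {0<..} x * (x powr (\<beta> - 1) * exp (- (\<mu> * x)))) (Gamma \<beta> * \<mu> powr (- \<beta>))"
proof -
  let ?f = "\<lambda>x::real. indicator {0<..} x * (x powr (\<beta> - 1) * exp (- x))"
  have hk: "((\<lambda>t. t powr (\<beta> - 1) / exp t) has_integral Gamma \<beta>) {0..}"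
    by (rule Gamma_integral_real[OF \<beta>])
  then have "(\<lambda>t. t powr (\<beta> - 1) / exp t) absolutely_integrable_on {0..}"
    by (intro nonnegative_absolutely_integrable_1 has_integral_integrable[OF hk]) simp
  then have "integrable lebesgue (\<lambda>t. indicator {0..} t *\<^sub>R (t powr (\<beta> - 1) / exp t))"
    unfolding set_integrable_def .
  then have si: "set_integrable lborel {0..} (\<lambda>t. t powr (\<beta> - 1) / exp t)"
    unfolding set_integrable_def by (subst (asm) integrable_completion) auto
  have "(LINT t:{0..}|lborel. t powr (\<beta> - 1) / exp t) = Gamma \<beta>"
    using set_borel_integral_eq_integral(2)[OF si] integral_unique[OF hk] by simp
  then have "has_bochner_integral lborel (\<lambda>t. indicator {0..} t *\<^sub>R (t powr (\<beta> - 1) / exp t)) (Gamma \<beta>)"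
    using si unfolding set_integrable_def set_lebesgue_integral_def has_bochner_integral_iff by blast
  also have "(\<lambda>t. indicator {0..} t *\<^sub>R (t powr (\<beta> - 1) / exp t)) = ?f"
    by (rule ext) (auto simp: indicator_def exp_minus divide_inverse)
  finally have "has_bochner_integral lborel (\<lambda>x. ?f (0 + \<mu> * x)) (Gamma \<beta> /\<^sub>R \<bar>\<mu>\<bar>)"
    using \<mu> by (subst (asm) lborel_has_bochner_integral_real_affine_iff[of \<mu> _ _ 0]) auto
  then have "has_bochner_integral lborel (\<lambda>x. \<mu> powr (1 - \<beta>) * ?f (0 + \<mu> * x)) (\<mu> powr (1 - \<beta>) * (Gamma \<beta> /\<^sub>R \<bar>\<mu>\<bar>))"
    by (rule has_bochner_integral_mult_right)
  moreover have "\<mu> powr (1 - \<beta>) * (Gamma \<beta> /\<^sub>R \<bar>\<mu>\<bar>) = Gamma \<beta> * \<mu> powr (- \<beta>)"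
    using \<mu> by (simp add: powr_diff powr_minus field_simps)
  moreover have "\<mu> powr (1 - \<beta>) * ?f (0 + \<mu> * x) = indicator {0<..} x * (x powr (\<beta> - 1) * exp (- (\<mu> * x)))" for x
  proof (cases "x > 0")
    case True
    have "\<mu> powr (1 - \<beta>) * (\<mu> * x) powr (\<beta> - 1) = (\<mu> powr (1 - \<beta>) * \<mu> powr (\<beta> - 1)) * x powr (\<beta> - 1)"
      using \<mu> True by (simp add: powr_mult)
    also have "\<mu> powr (1 - \<beta>) * \<mu> powr (\<beta> - 1) = 1"
      using \<mu> by (simp add: powr_add[symmetric])
    finally have "\<mu> powr (1 - \<beta>) * (\<mu> * x) powr (\<beta> - 1) = x powr (\<beta> - 1)" by simp
    then show ?thesis using True \<mu> by (simp add: mult.assoc[symmetric])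
  next
    case False
    then have "\<not> 0 < \<mu> * x" using \<mu> by (simp add: zero_less_mult_iff)
    then show ?thesis using False by simp
  qed
  ultimately show ?thesis by (simp only:)
qed

text \<open>Fubini applied to \<open>f l\<close> as the integral of \<open>f1\<close> up to
  \<open>l\<close>. Since the tails of the clock are known, this is the entry point for every
  computation with its law.\<close>

lemma integral_by_tail:
  fixes f f1 :: "real \<Rightarrow> real"
  assumes N: "prob_space N" "sets N = sets borel"
    and der: "\<And>s. (f has_real_derivative f1 s) (at s)" and cont: "\<And>s. isCont f1 s"
    and zero: "\<And>s. s \<le> 0 \<Longrightarrow> f s = 0" "\<And>s. s \<le> 0 \<Longrightarrow> f1 s = 0" and int: "integrable lborel f1"
  shows "integrable lborel (\<lambda>s. f1 s * measure N {s<..})"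
    and "(LINT l|N. f l) = (LINT s|lborel. f1 s * measure N {s<..})"
proof -
  interpret N: prob_space N by fact
  interpret pair_sigma_finite N lborel ..
  note [measurable_cong] = N(2)
  have [measurable]: "f1 \<in> borel_measurable borel" using borel_measurable_integrable[OF int] by simp
  have sp: "space N = UNIV" using sets_eq_imp_space_eq[OF N(2)] by simp
  have fl: "f l = (LINT s|lborel. f1 s * (if s < l then 1 else 0))" for l
  proof (cases "l \<le> 0")
    case True
    then have "(\<lambda>s. f1 s * (if s < l then 1 else 0)) = (\<lambda>_. 0)" using zero(2) by auto
    then show ?thesis using zero(1)[OF True] by simp
  next
    case False
    then have "(LINT s|lborel. f1 s * indicator {0..l} s) = f l - f 0"
      by (intro integral_FTC_Icc_real der cont) auto
    moreover have "(LINT s|lborel. f1 s * indicator {0..l} s) = (LINT s|lborel. f1 s * (if s < l then 1 else 0))"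
    proof (rule integral_cong_AE)
      show "AE s in lborel. f1 s * indicator {0..l} s = f1 s * (if s < l then 1 else 0)"
        using AE_lborel_singleton[of l]
      proof eventually_elim
        case (elim s)
        then show ?case using zero(2)[of s] by (auto simp: indicator_def)
      qed
    qed measurable
    ultimately show ?thesis using zero(1)[of 0] by simp
  qed
  have dom: "integrable (N \<Otimes>\<^sub>M lborel) (\<lambda>(l, s). f1 s * (if s < l then 1 else 0))"
  proof (rule Fubini_integrable)
    have i: "integrable lborel (\<lambda>s. f1 s * (if s < l then 1 else 0))" for l
      by (rule Bochner_Integration.integrable_bound[OF int]) auto
    then show "AE l in N. integrable lborel (\<lambda>s. case (l, s) of (l, s) \<Rightarrow> f1 s * (if s < l then 1 else 0))" by simp
    have "norm (LINT s|lborel. norm (f1 s * (if s < l then 1 else 0))) \<le> (LINT s|lborel. norm (f1 s))" for l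
    proof -
      have "(LINT s|lborel. norm (f1 s * (if s < l then 1 else 0))) \<le> (LINT s|lborel. norm (f1 s))"
        by (intro integral_mono integrable_norm i int) auto
      then show ?thesis by (simp add: Bochner_Integration.integral_nonneg)
    qed
    then show "integrable N (\<lambda>l. LINT s|lborel. norm (case (l, s) of (l, s) \<Rightarrow> f1 s * (if s < l then 1 else 0)))"
      unfolding prod.case by (intro N.integrable_const_bound[where B="LINT s|lborel. norm (f1 s)"] AE_I2) measurable
  qed measurable
  have inner: "(LINT l|N. f1 s * (if s < l then 1 else 0)) = f1 s * measure N {s<..}" for s
  proof -
    have "(LINT l|N. (if s < l then 1 else 0 :: real)) = (LINT l|N. indicator {s<..} l)"
      by (intro Bochner_Integration.integral_cong) (auto simp: indicator_def)
    then show ?thesis using sp by simp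
  qed
  have "(LINT l|N. f l) = (LINT l|N. LINT s|lborel. f1 s * (if s < l then 1 else 0))" by (simp only: fl)
  also have "\<dots> = (LINT s|lborel. LINT l|N. f1 s * (if s < l then 1 else 0))"
    using Fubini_integral[OF dom] by simp
  finally show "(LINT l|N. f l) = (LINT s|lborel. f1 s * measure N {s<..})" by (simp only: inner)
  show "integrable lborel (\<lambda>s. f1 s * measure N {s<..})"
    using integrable_snd[OF dom] by (simp only: inner)
qed

section \<open>Uniqueness for Laplace transforms\<close>

lemma AE_zero_imp_zero:
  assumes cont: "continuous_on {0<..} F" and ae: "AE t in lborel. 0 < t \<longrightarrow> F t = (0::real)" and t: "(t::real) > 0"
  shows "F t = 0"
proof (rule ccontr)
  assume nz: "F t \<noteq> 0"
  let ?S = "{0<..} \<inter> F -` (- {0})"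
  have op: "open ?S" by (rule continuous_open_preimage[OF cont]) auto
  have "AE x in lborel. x \<notin> ?S" using ae by eventually_elim auto
  then have "?S \<in> null_sets lborel"
    using op by (subst (asm) AE_iff_null_sets[symmetric]) auto
  then have "negligible ?S"
    using null_sets_completionI[of ?S lborel] by (simp add: negligible_iff_null_sets)
  moreover have "?S \<noteq> {}" using nz t by auto
  ultimately show False using open_not_negligible[OF op] by blast
qed

text \<open>Lerch's theorem. With \<open>y = exp (- t)\<close> the hypothesis says that all moments of \<open>F\<close> vanish; the factor
  \<open>y * (1 - y)\<close> makes \<open>F (- ln y)\<close> continuous on \<open>{0..1}\<close>, so that Weierstrass' theorem applies.\<close>

lemma lerch:
  fixes F :: "real \<Rightarrow> real"
  assumes cont: "continuous_on {0<..} F" and bd: "\<And>t. t > 0 \<Longrightarrow> \<bar>F t\<bar> \<le> C * (1 + t)"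
    and zero: "\<And>k::nat. k \<ge> 1 \<Longrightarrow> (LINT t|lborel. indicator {0<..} t * (exp (- (real k * t)) * F t)) = 0"
    and t: "t > 0"
  shows "F t = 0"
proof -
  define G where "G t = indicator {0<..} t * F t" for t
  have Gm [measurable]: "G \<in> borel_measurable borel"
    using borel_measurable_continuous_on_indicator[OF _ cont] unfolding G_def[abs_def] by simp
  have C0: "C \<ge> 0" using order_trans[OF abs_ge_zero bd[of 1]] by simp
  have Gint: "integrable lborel (\<lambda>t. exp (- (real k * t)) * G t)" if k: "k \<ge> 1" for k :: nat
  proof (rule Bochner_Integration.integrable_bound)
    show "integrable lborel (\<lambda>t. (2 * C) * (indicator {0..} t * exp (- ((1/2) * t))))"
      using has_bochner_integral_exp_atLeast[of "1/2"] by (intro integrable_mult_right) (simp add: has_bochner_integral_iff)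
    show "AE t in lborel. norm (exp (- (real k * t)) * G t) \<le> norm ((2 * C) * (indicator {0..} t * exp (- ((1/2) * t))))"
    proof (rule AE_I2)
      fix t :: real
      show "norm (exp (- (real k * t)) * G t) \<le> norm ((2 * C) * (indicator {0..} t * exp (- ((1/2) * t))))"
      proof (cases "t > 0")
        case True
        have "1 + t \<le> 2 * exp (t / 2)" using exp_ge_add_one_self[of "t/2"] by linarith
        have "exp (- (real k * t)) \<le> exp (- t)" using k True by simp
        then have "exp (- (real k * t)) * \<bar>F t\<bar> \<le> exp (- t) * (C * (1 + t))"
          using bd[OF True] by (intro mult_mono) auto
        also have "\<dots> \<le> exp (- t) * (C * (2 * exp (t / 2)))"
          using \<open>1 + t \<le> 2 * exp (t / 2)\<close> C0 by (intro mult_left_mono) auto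
        also have "\<dots> = 2 * C * (exp (- t) * exp (t / 2))" by simp
        also have "exp (- t) * exp (t / 2) = exp (- ((1/2) * t))" by (simp add: exp_add[symmetric])
        finally show ?thesis using True C0 by (simp add: G_def abs_mult)
      qed (use C0 in \<open>simp add: G_def\<close>)
    qed
  qed measurable
  have Gzero: "(LINT t|lborel. exp (- (real k * t)) * G t) = 0" if "k \<ge> 1" for k :: nat
    using zero[OF that] by (simp add: G_def mult_ac)
  define P where "P y = y * (1 - y) * F (- ln y)" for y
  have Pbd: "\<bar>P y\<bar> \<le> C * (y * (1 - y) * (1 - ln y))" if "0 < y" "y < 1" for y
  proof -
    have "\<bar>P y\<bar> = y * (1 - y) * \<bar>F (- ln y)\<bar>" using that by (simp add: P_def abs_mult)
    also have "\<dots> \<le> y * (1 - y) * (C * (1 + - ln y))"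
      using that by (intro mult_left_mono bd) auto
    finally show ?thesis by (simp add: mult_ac)
  qed
  have Pcont: "continuous_on {0..1} P"
    unfolding continuous_on_eq_continuous_within
  proof
    fix y :: real assume y: "y \<in> {0..1}"
    consider "y = 0" | "y = 1" | "0 < y" "y < 1" using y by fastforce
    then show "continuous (at y within {0..1}) P"
    proof cases
      case 1
      have "(P \<longlongrightarrow> 0) (at_right 0)"
      proof (rule Lim_null_comparison)
        show "\<forall>\<^sub>F y in at_right 0. norm (P y) \<le> C * (y * (1 - y) * (1 - ln y))"
          unfolding eventually_at_right_field using Pbd by (intro exI[of _ 1]) simp
        show "((\<lambda>y. C * (y * (1 - y) * (1 - ln y))) \<longlongrightarrow> 0) (at_right 0)" by real_asymp
      qed
      then show ?thesis using 1 by (simp add: continuous_within at_within_Icc_at_right P_def)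
    next
      case 2
      have "(P \<longlongrightarrow> 0) (at_left 1)"
      proof (rule Lim_null_comparison)
        show "\<forall>\<^sub>F y in at_left 1. norm (P y) \<le> C * (y * (1 - y) * (1 - ln y))"
          unfolding eventually_at_left_field using Pbd by (intro exI[of _ 0]) simp
        show "((\<lambda>y. C * (y * (1 - y) * (1 - ln y))) \<longlongrightarrow> 0) (at_left 1)" by real_asymp
      qed
      then show ?thesis using 2 by (simp add: continuous_within at_within_Icc_at_left P_def)
    next
      case 3
      have "isCont F (- ln y)"
        using cont 3 by (simp add: continuous_on_eq_continuous_at)
      moreover have "isCont (\<lambda>y. - ln y) y" using 3 by (intro isCont_minus isCont_ln) simp
      ultimately have "isCont (\<lambda>y. F (- ln y)) y" by (rule isCont_o2[rotated])
      then have "isCont P y" unfolding P_def[abs_def] by simp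
      then show ?thesis by (rule continuous_at_imp_continuous_at_within)
    qed
  qed
  \<comment> \<open>\<open>F\<close> is tested against its own weighted version \<open>P\<close>.
    Polynomial approximation of \<open>P\<close> shows \<open>I = 0\<close>, while \<open>I\<close>
    is also the integral of the square of \<open>F\<close> with a positive weight.\<close>
  define I where "I = (LINT t|lborel. exp (- t) * (G t * P (exp (- t))))"
  define K where "K = (LINT t|lborel. norm (exp (- t) * G t))"
  have Pb: "\<exists>B. \<forall>y\<in>{0..1}. norm (P y) \<le> B"
    using compact_continuous_image[OF Pcont compact_Icc, THEN compact_imp_bounded] unfolding bounded_iff by auto
  then obtain B where B: "\<And>y. y \<in> {0..1} \<Longrightarrow> norm (P y) \<le> B" by blast
  have G1: "integrable lborel (\<lambda>t. exp (- t) * G t)" using Gint[of 1] by simp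
  have GPm [measurable]: "(\<lambda>t. G t * P (exp (- t))) \<in> borel_measurable borel"
  proof -
    have "(\<lambda>t. G t * P (exp (- t))) = (\<lambda>t. G t * (exp (- t) * (1 - exp (- t)) * G t))"
      by (rule ext) (simp add: P_def G_def indicator_def)
    then show ?thesis by simp
  qed
  have iGP: "integrable lborel (\<lambda>t. exp (- t) * (G t * P (exp (- t))))"
  proof (rule Bochner_Integration.integrable_bound[OF integrable_mult_right[OF G1, of B]])
    show "AE t in lborel. norm (exp (- t) * (G t * P (exp (- t)))) \<le> norm (B * (exp (- t) * G t))"
    proof (rule AE_I2)
      fix t
      show "norm (exp (- t) * (G t * P (exp (- t)))) \<le> norm (B * (exp (- t) * G t))"
      proof (cases "t > 0")
        case True
        then have "\<bar>P (exp (- t))\<bar> \<le> \<bar>B\<bar>" using B[of "exp (- t)"] by simp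
        then have "\<bar>G t\<bar> * exp (- t) * \<bar>P (exp (- t))\<bar> \<le> \<bar>G t\<bar> * exp (- t) * \<bar>B\<bar>" by (intro mult_left_mono) auto
        then show ?thesis by (simp add: abs_mult mult_ac)
      qed (simp add: G_def)
    qed
  qed measurable
  have small: "\<bar>I\<bar> \<le> e * K" if e: "e > 0" for e
  proof -
    obtain g where g: "real_polynomial_function g" "\<And>y. y \<in> {0..1} \<Longrightarrow> \<bar>P y - g y\<bar> < e"
      using Stone_Weierstrass_real_polynomial_function[OF compact_Icc Pcont e] by blast
    then obtain a n where gs: "g = (\<lambda>x. \<Sum>i\<le>n. a i * x ^ i)" using real_polynomial_function_iff_sum by blast
    \<comment> \<open>The additional factor \<open>exp (- t)\<close> shifts the exponents to
      \<open>Suc i\<close>, so that even the constant monomial falls under the hypothesis for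
      \<open>k \<ge> 1\<close>.\<close>
    have eq: "exp (- t) * (G t * g (exp (- t))) = (\<Sum>i\<le>n. a i * (exp (- (real (Suc i) * t)) * G t))" for t
    proof -
      have "exp (- t) * exp (- t) ^ i = exp (- (real (Suc i) * t))" for i
        by (simp add: exp_of_nat_mult[symmetric] exp_add[symmetric] algebra_simps)
      then show ?thesis unfolding gs by (simp add: sum_distrib_left mult_ac)
    qed
    have ig: "integrable lborel (\<lambda>t. exp (- t) * (G t * g (exp (- t))))"
      unfolding eq by (intro Bochner_Integration.integrable_sum integrable_mult_right Gint) simp
    have "(LINT t|lborel. exp (- t) * (G t * g (exp (- t)))) = (\<Sum>i\<le>n. a i * (LINT t|lborel. exp (- (real (Suc i) * t)) * G t))"
      unfolding eq by (subst Bochner_Integration.integral_sum) (intro integrable_mult_right Gint, simp, simp)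
    also have "\<dots> = 0" by (intro sum.neutral ballI) (subst Gzero, simp_all)
    finally have "I = (LINT t|lborel. exp (- t) * (G t * P (exp (- t))) - exp (- t) * (G t * g (exp (- t))))"
      unfolding I_def by (subst Bochner_Integration.integral_diff[OF iGP ig]) simp
    also have "\<bar>\<dots>\<bar> \<le> (LINT t|lborel. e * norm (exp (- t) * G t))"
    proof (subst real_norm_def[symmetric], rule Bochner_Integration.integral_norm_bound_integral)
      show "integrable lborel (\<lambda>t. exp (- t) * (G t * P (exp (- t))) - exp (- t) * (G t * g (exp (- t))))"
        by (rule Bochner_Integration.integrable_diff[OF iGP ig])
      show "integrable lborel (\<lambda>t. e * norm (exp (- t) * G t))" using G1 by (intro integrable_mult_right integrable_norm)
      fix t :: real
      show "norm (exp (- t) * (G t * P (exp (- t))) - exp (- t) * (G t * g (exp (- t)))) \<le> e * norm (exp (- t) * G t)"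
      proof (cases "t > 0")
        case True
        have "exp (- t) * (G t * P (exp (- t))) - exp (- t) * (G t * g (exp (- t))) = (exp (- t) * G t) * (P (exp (- t)) - g (exp (- t)))"
          by (simp add: algebra_simps)
        moreover have "\<bar>exp (- t) * G t\<bar> * \<bar>P (exp (- t)) - g (exp (- t))\<bar> \<le> \<bar>exp (- t) * G t\<bar> * e"
          using g(2)[of "exp (- t)"] True by (intro mult_left_mono) auto
        ultimately show ?thesis by (simp only: real_norm_def abs_mult mult.commute)
      qed (simp add: G_def)
    qed
    also have "\<dots> = e * K" unfolding K_def by simp
    finally show ?thesis .
  qed
  have "I = 0"
  proof (rule ccontr)
    assume "I \<noteq> 0"
    have K0: "K \<ge> 0" unfolding K_def by (intro Bochner_Integration.integral_nonneg) simp
    \<comment> \<open>This accuracy bounds \<open>I\<close> by half of itself; the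
      \<open>+ 1\<close> covers \<open>K = 0\<close>.\<close>
    have "\<bar>I\<bar> \<le> \<bar>I\<bar> / (2 * (K + 1)) * K" using K0 \<open>I \<noteq> 0\<close> by (intro small) simp
    also have "\<dots> = \<bar>I\<bar> * (K / (2 * (K + 1)))" by simp
    also have "\<dots> \<le> \<bar>I\<bar> * (1 / 2)" using K0 by (intro mult_left_mono) (simp_all add: divide_simps)
    finally show False using \<open>I \<noteq> 0\<close> by simp
  qed
  moreover have GP: "exp (- t) * (G t * P (exp (- t))) = indicator {0<..} t * (exp (- t) * exp (- t) * (1 - exp (- t)) * (F t)\<^sup>2)" for t
    by (simp add: P_def G_def indicator_def power2_eq_square)
  ultimately have "(LINT t|lborel. indicator {0<..} t * (exp (- t) * exp (- t) * (1 - exp (- t)) * (F t)\<^sup>2)) = 0"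
    by (simp only: I_def)
  then have "AE t in lborel. indicator {0<..} t * (exp (- t) * exp (- t) * (1 - exp (- t)) * (F t)\<^sup>2) = 0"
    using iGP unfolding GP by (subst (asm) integral_nonneg_eq_0_iff_AE) (auto simp: indicator_def)
  then have "AE t in lborel. 0 < t \<longrightarrow> F t = 0"
    by eventually_elim auto
  from AE_zero_imp_zero[OF cont this t] show ?thesis .
qed

section \<open>Fractional integrals whose order tends to 1\<close>

lemma integrable_powr_singularity:
  fixes a t :: real
  assumes "a < 1" "t > 0"
  shows "integrable lborel (\<lambda>\<tau>. indicator {0<..<t} \<tau> * (t - \<tau>) powr (- a))"
proof -
  have "((\<lambda>x. x powr (- a)) has_integral (t powr (- a + 1) / (- a + 1))) {0..t}"
    using assms by (intro has_integral_powr_from_0) auto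
  then have "(\<lambda>x. x powr (- a)) absolutely_integrable_on {0..t}"
    by (intro nonnegative_absolutely_integrable_1) (auto intro: has_integral_integrable)
  then have "integrable lborel (\<lambda>x. indicator {0..t} x *\<^sub>R x powr (- a))"
    unfolding set_integrable_def by (subst (asm) integrable_completion) auto
  then have "integrable lborel (\<lambda>x. indicator {0..t} (t + (-1) * x) *\<^sub>R (t + (-1) * x) powr (- a))"
    by (rule lborel_integrable_real_affine) simp
  then show ?thesis
    by (rule Bochner_Integration.integrable_bound) (auto simp: indicator_def)
qed

text \<open>Subtracting the constant \<open>t powr - a r\<close> from the kernel compensates the singularity of the
  bound \<open>C / \<tau>\<close> at \<open>0\<close>.\<close>

lemma caputo_limit:
  fixes v :: "nat \<Rightarrow> real \<Rightarrow> real" and a :: "nat \<Rightarrow> real"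
  assumes t: "t > 0"
    and vm: "\<And>r. v r \<in> borel_measurable borel"
    and vi: "\<And>r. integrable lborel (\<lambda>\<tau>. indicator {0<..<t} \<tau> * v r \<tau>)"
    and vi': "\<And>r. integrable lborel (\<lambda>\<tau>. indicator {0<..<t} \<tau> * (v r \<tau> * (t - \<tau>) powr (- a r)))"
    and vb: "\<And>r \<tau>. \<tau> > 0 \<Longrightarrow> \<bar>v r \<tau>\<bar> \<le> C / \<tau>"
    and lim: "(\<lambda>r. LINT \<tau>|lborel. indicator {0<..<t} \<tau> * v r \<tau>) \<longlonglongrightarrow> w"
    and a: "a \<longlonglongrightarrow> 0" "\<And>r. 0 < a r" "\<And>r. a r < 1"
  shows "(\<lambda>r. 1 / Gamma (1 - a r) * (LINT \<tau>|lborel. indicator {0<..<t} \<tau> * (v r \<tau> * (t - \<tau>) powr (- a r)))) \<longlonglongrightarrow> w"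
proof -
  note [measurable] = vm
  define E where "E r \<tau> = indicator {0<..<t} \<tau> * (v r \<tau> * ((t - \<tau>) powr (- a r) - t powr (- a r)))" for r \<tau>
  have C0: "C \<ge> 0" using order_trans[OF abs_ge_zero vb[of 1]] by simp
  have kernel: "0 \<le> (t - \<tau>) powr (- b) - t powr (- b) \<and>
      (t - \<tau>) powr (- b) - t powr (- b) \<le> \<tau> / t * (t - \<tau>) powr (- b)" if \<tau>: "\<tau> \<in> {0<..<t}" and b: "0 < b" "b < 1" for \<tau> b
  proof -
    define x where "x = (t - \<tau>) / t"
    have x: "0 < x" "x < 1" using \<tau> t by (auto simp: x_def)
    have tt: "t powr (- b) = (t - \<tau>) powr (- b) * x powr b"
      using \<tau> t by (simp add: x_def powr_divide powr_minus field_simps)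
    \<comment> \<open>The factor \<open>\<tau> / t\<close> obtained from
      \<open>1 - x powr b \<le> 1 - x\<close> is what cancels the bound
      \<open>C / \<tau>\<close>.\<close>
    have "x \<le> x powr b" using powr_mono'[of b 1 x] x b by simp
    moreover have "x powr b \<le> 1" using x b by (intro powr_le1) simp_all
    moreover have "1 - x = \<tau> / t" using t by (simp add: x_def field_simps)
    ultimately have "0 \<le> 1 - x powr b" "1 - x powr b \<le> \<tau> / t" by linarith+
    then have "0 \<le> (t - \<tau>) powr (- b) * (1 - x powr b)" "(t - \<tau>) powr (- b) * (1 - x powr b) \<le> (t - \<tau>) powr (- b) * (\<tau> / t)"
      by (simp, intro mult_left_mono, simp_all)
    then show ?thesis unfolding tt by (simp add: algebra_simps)
  qed
  \<comment> \<open>From \<open>r0\<close> on the orders stay below 1/2, so the single kernel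
    \<open>1 + (t - \<tau>) powr (- (1/2))\<close> dominates all of them.\<close>
  obtain r0 where r0: "\<And>r. r \<ge> r0 \<Longrightarrow> a r < 1 / 2"
    using order_tendstoD(2)[OF a(1), of "1/2"] by (auto simp: eventually_sequentially)
  have Ebd: "norm (E r \<tau>) \<le> C / t * (indicator {0<..<t} \<tau> * (1 + (t - \<tau>) powr (- (1/2))))" if r: "r \<ge> r0" for r \<tau>
  proof (cases "\<tau> \<in> {0<..<t}")
    case True
    have k: "0 \<le> (t - \<tau>) powr (- a r) - t powr (- a r)" "(t - \<tau>) powr (- a r) - t powr (- a r) \<le> \<tau> / t * (t - \<tau>) powr (- a r)"
      using kernel[OF True a(2,3), of r] by auto
    have "norm (E r \<tau>) = \<bar>v r \<tau>\<bar> * ((t - \<tau>) powr (- a r) - t powr (- a r))"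
      using True k by (simp add: E_def abs_mult)
    also have "\<dots> \<le> C / \<tau> * (\<tau> / t * (t - \<tau>) powr (- a r))"
      using True k vb[of \<tau> r] C0 by (intro mult_mono) auto
    also have "\<dots> = C / t * (t - \<tau>) powr (- a r)" using True by simp
    also have "(t - \<tau>) powr (- a r) \<le> 1 + (t - \<tau>) powr (- (1/2))"
    proof (cases "t - \<tau> \<le> 1")
      case True
      then have "(t - \<tau>) powr (- a r) \<le> (t - \<tau>) powr (- (1/2))"
        using \<open>\<tau> \<in> {0<..<t}\<close> r0[OF r] by (intro powr_mono') auto
      then show ?thesis by simp
    next
      case False
      then have "(t - \<tau>) powr (- a r) \<le> (t - \<tau>) powr 0"
        using a(2)[of r] by (intro powr_mono) auto
      then show ?thesis using False by (simp add: add_increasing2)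
    qed
    finally show ?thesis using True C0 t by (simp add: mult_left_mono divide_right_mono)
  qed (simp add: E_def)
  have Elim: "(\<lambda>r. E r \<tau>) \<longlonglongrightarrow> 0" for \<tau>
  proof (cases "\<tau> \<in> {0<..<t}")
    case True
    have "(\<lambda>r. (t - \<tau>) powr (- a r) - t powr (- a r)) \<longlonglongrightarrow> (t - \<tau>) powr (- 0) - t powr (- 0)"
      using True by (intro tendsto_intros a(1)) auto
    then have l: "(\<lambda>r. (t - \<tau>) powr (- a r) - t powr (- a r)) \<longlonglongrightarrow> 0" using True by simp
    have "(\<lambda>r. v r \<tau> * ((t - \<tau>) powr (- a r) - t powr (- a r))) \<longlonglongrightarrow> 0"
    proof (rule Lim_null_comparison)
      show "(\<lambda>r. C / \<tau> * \<bar>(t - \<tau>) powr (- a r) - t powr (- a r)\<bar>) \<longlonglongrightarrow> 0"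
        using tendsto_mult_right_zero[OF tendsto_rabs_zero[OF l], of "C / \<tau>"] .
      show "\<forall>\<^sub>F r in sequentially. norm (v r \<tau> * ((t - \<tau>) powr (- a r) - t powr (- a r))) \<le> C / \<tau> * \<bar>(t - \<tau>) powr (- a r) - t powr (- a r)\<bar>"
        unfolding real_norm_def abs_mult using True by (intro always_eventually allI mult_right_mono vb abs_ge_zero) simp
    qed
    then show ?thesis using True by (simp add: E_def)
  qed (simp add: E_def)
  have idom: "integrable lborel (\<lambda>\<tau>. C / t * (indicator {0<..<t} \<tau> * (1 + (t - \<tau>) powr (- (1/2)))))"
    using integrable_powr_singularity[of "1/2" t] t
    by (intro integrable_mult_right) (simp add: distrib_left)
  have "(\<lambda>r. LINT \<tau>|lborel. E (r + r0) \<tau>) \<longlonglongrightarrow> (LINT \<tau>::real|lborel. (0::real))"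
  proof (rule integral_dominated_convergence[OF _ _ idom])
    show "AE \<tau> in lborel. (\<lambda>r. E (r + r0) \<tau>) \<longlonglongrightarrow> 0"
      by (intro AE_I2 LIMSEQ_ignore_initial_segment Elim)
    show "AE \<tau> in lborel. norm (E (r + r0) \<tau>) \<le> C / t * (indicator {0<..<t} \<tau> * (1 + (t - \<tau>) powr (- (1/2))))" for r
      by (intro AE_I2 Ebd) simp
    show "(\<lambda>\<tau>. E (r + r0) \<tau>) \<in> borel_measurable lborel" for r
      unfolding E_def by measurable
  qed simp
  then have Eint: "(\<lambda>r. LINT \<tau>|lborel. E r \<tau>) \<longlonglongrightarrow> 0"
    using LIMSEQ_offset[of "\<lambda>r. LINT \<tau>|lborel. E r \<tau>" r0] by simp
  have split: "(LINT \<tau>|lborel. indicator {0<..<t} \<tau> * (v r \<tau> * (t - \<tau>) powr (- a r))) =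
      t powr (- a r) * (LINT \<tau>|lborel. indicator {0<..<t} \<tau> * v r \<tau>) + (LINT \<tau>|lborel. E r \<tau>)" for r
  proof -
    have eq: "E r \<tau> = indicator {0<..<t} \<tau> * (v r \<tau> * (t - \<tau>) powr (- a r)) - t powr (- a r) * (indicator {0<..<t} \<tau> * v r \<tau>)" for \<tau>
      by (simp add: E_def algebra_simps)
    show ?thesis
      unfolding eq by (subst Bochner_Integration.integral_diff[OF vi' integrable_mult_right[OF vi]]) simp
  qed
  have "(\<lambda>r. 1 / Gamma (1 - a r) * (t powr (- a r) * (LINT \<tau>|lborel. indicator {0<..<t} \<tau> * v r \<tau>) + (LINT \<tau>|lborel. E r \<tau>)))
     \<longlonglongrightarrow> 1 / Gamma (1 - 0) * (t powr (- 0) * w + 0)"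
    using t by (intro tendsto_intros a(1) lim Eint) (auto simp: nonpos_Ints_def)
  then show ?thesis using t by (simp add: split)
qed

section \<open>Averages over the inverse and their time derivative\<close>

text \<open>Models \<open>g s = gauss s x\<close> for a fixed \<open>x \<noteq> 0\<close>.
  Integrability of \<open>g1\<close> against every negative power of \<open>s\<close> is there to
  absorb the blow-up permitted by \<open>dens_bound\<close>.\<close>

locale inverse_average = subordinator_laws m lam \<alpha> \<eta> \<kappa>
  for m lam \<alpha> \<eta> \<kappa> +
  fixes N :: "real \<Rightarrow> real measure" and g g1 g2 :: "real \<Rightarrow> real"
  assumes N: "\<And>t. t > 0 \<Longrightarrow> prob_space (N t)" "\<And>t. t > 0 \<Longrightarrow> sets (N t) = sets borel"
    and tail: "\<And>t s. t > 0 \<Longrightarrow> s > 0 \<Longrightarrow> measure (N t) {s<..} = measure (\<eta> s) {..<t}"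
    and g_der: "\<And>s. (g has_real_derivative g1 s) (at s)" and g1_der: "\<And>s. (g1 has_real_derivative g2 s) (at s)"
    and g2_cont: "\<And>s. isCont g2 s"
    and g_zero: "\<And>s. s \<le> 0 \<Longrightarrow> g s = 0" "\<And>s. s \<le> 0 \<Longrightarrow> g1 s = 0" "\<And>s. s \<le> 0 \<Longrightarrow> g2 s = 0"
    and g1_int: "\<And>q. q \<ge> 0 \<Longrightarrow> integrable lborel (\<lambda>s. g1 s * s powr (- q))"
    and g1_int0: "integrable lborel g1" and g2_int: "integrable lborel g2"
    and g1_lim: "(g1 \<longlongrightarrow> 0) at_top"
begin

definition u :: "real \<Rightarrow> real" where "u t = (LINT s|N t. g s)"
definition v :: "real \<Rightarrow> real" where "v t = (LINT s|lborel. g1 s * dens s t)"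

lemma g1_cont: "isCont g1 s" using g1_der DERIV_isCont by blast

lemma g1_measurable [measurable]: "g1 \<in> borel_measurable borel"
  and g2_measurable [measurable]: "g2 \<in> borel_measurable borel"
  using borel_measurable_integrable[OF g1_int0] borel_measurable_integrable[OF g2_int] by simp_all

text \<open>A majorant that does not depend on \<open>t\<close>, from which integrability,
  continuity and boundedness of \<open>v\<close> all follow.\<close>

lemma dominated: "\<exists>h. integrable lborel h \<and> (\<forall>s t. \<bar>g1 s * dens s t\<bar> \<le> h s)"
proof -
  obtain C q where C: "C \<ge> 0" "q \<ge> 0" "\<And>s \<tau>. s > 0 \<Longrightarrow> \<bar>dens s \<tau>\<bar> \<le> C * (1 + s powr (- q))"
    using dens_bound by blast
  define h where "h s = C * (\<bar>g1 s\<bar> + \<bar>g1 s * s powr (- q)\<bar>)" for s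
  have "integrable lborel h"
    unfolding h_def using g1_int0 g1_int[OF C(2)] by (intro integrable_mult_right Bochner_Integration.integrable_add integrable_abs)
  moreover have "\<bar>g1 s * dens s t\<bar> \<le> h s" for s t
  proof (cases "s > 0")
    case True
    have "\<bar>g1 s * dens s t\<bar> \<le> \<bar>g1 s\<bar> * (C * (1 + s powr (- q)))"
      unfolding abs_mult by (intro mult_left_mono C(3)[OF True]) simp
    also have "\<dots> = h s" by (simp add: h_def abs_mult algebra_simps)
    finally show ?thesis .
  next
    case False
    then show ?thesis using g_zero(2)[of s] by (simp add: h_def)
  qed
  ultimately show ?thesis by blast
qed

lemma int_g1_dens: "integrable lborel (\<lambda>s. g1 s * dens s t)"
proof -
  obtain h where h: "integrable lborel h" "\<And>s t. \<bar>g1 s * dens s t\<bar> \<le> h s" using dominated by blast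
  show ?thesis
  proof (rule Bochner_Integration.integrable_bound[OF h(1)])
    show "AE s in lborel. norm (g1 s * dens s t) \<le> norm (h s)"
      using h(2) by (intro AE_I2) (simp add: order_trans[OF _ abs_ge_self])
  qed measurable
qed

lemma v_measurable [measurable]: "v \<in> borel_measurable borel"
  unfolding v_def by measurable

lemma v_cont: "isCont v t"
  unfolding continuous_at_sequentially comp_def v_def
proof safe
  fix S assume S: "S \<longlonglongrightarrow> t"
  obtain h where h: "integrable lborel h" "\<And>s t. \<bar>g1 s * dens s t\<bar> \<le> h s" using dominated by blast
  show "(\<lambda>n. LINT s|lborel. g1 s * dens s (S n)) \<longlonglongrightarrow> (LINT s|lborel. g1 s * dens s t)"
  proof (rule integral_dominated_convergence[OF _ _ h(1)])
    show "AE s in lborel. (\<lambda>n. g1 s * dens s (S n)) \<longlonglongrightarrow> g1 s * dens s t"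
    proof (rule AE_I2)
      fix s :: real
      show "(\<lambda>n. g1 s * dens s (S n)) \<longlonglongrightarrow> g1 s * dens s t"
      proof (cases "s > 0")
        case True
        show ?thesis
          by (intro tendsto_mult tendsto_const isCont_tendsto_compose[OF dens_isCont[OF True] S])
      qed (use g_zero(2)[of s] in simp)
    qed
    show "AE s in lborel. norm (g1 s * dens s (S n)) \<le> h s" for n
      using h(2) by (intro AE_I2) simp
  qed measurable
qed

lemma v_bounded: "\<exists>V\<ge>0. \<forall>t. \<bar>v t\<bar> \<le> V"
proof -
  obtain h where h: "integrable lborel h" "\<And>s t. \<bar>g1 s * dens s t\<bar> \<le> h s" using dominated by blast
  have "\<bar>v t\<bar> \<le> (LINT s|lborel. h s)" for t
    unfolding v_def real_norm_def[symmetric]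
    by (rule Bochner_Integration.integral_norm_bound_integral[OF int_g1_dens h(1)]) (simp add: h(2))
  moreover from order_trans[OF abs_ge_zero this] have "0 \<le> (LINT s|lborel. h s)" .
  ultimately show ?thesis by blast
qed

text \<open>The constant depends on the orders only through \<kappa>. This is the uniform bound that
  \<open>caputo_limit\<close> requires.\<close>

lemma v_le_inverse:
  assumes t: "t > 0"
  shows "\<bar>v t\<bar> \<le> (2 + 1 / \<kappa>) * (LINT s|lborel. \<bar>g1 s\<bar>) / t"
proof -
  have "\<bar>v t\<bar> \<le> (LINT s|lborel. (2 + 1 / \<kappa>) / t * \<bar>g1 s\<bar>)"
    unfolding v_def real_norm_def[symmetric]
  proof (rule Bochner_Integration.integral_norm_bound_integral[OF int_g1_dens])
    show "integrable lborel (\<lambda>s. (2 + 1 / \<kappa>) / t * norm (g1 s))"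
      using g1_int0 by (intro integrable_mult_right integrable_norm)
    show "norm (g1 s * dens s t) \<le> (2 + 1 / \<kappa>) / t * norm (g1 s)" for s
    proof (cases "s > 0")
      case True
      show ?thesis
        unfolding real_norm_def abs_mult
        by (subst mult.commute) (intro mult_right_mono dens_le_inverse[OF True t] abs_ge_zero)
    qed (use g_zero(2)[of s] in simp)
  qed
  then show ?thesis by simp
qed

lemma eta_space: "s > 0 \<Longrightarrow> space (\<eta> s) = UNIV"
  using sets_eq_imp_space_eq[OF sets_eta] by simp

lemma measure_eta:
  assumes s: "s > 0" and t: "t > 0"
  shows "measure (\<eta> s) {..<t} = (LINT \<tau>|lborel. indicator {0..t} \<tau> * dens s \<tau>)"
proof -
  interpret prob_space "\<eta> s" by (rule prob[OF s])
  note sets_eta[OF s, simp, measurable_cong]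
  have "AE x in \<eta> s. x \<noteq> t"
    unfolding eta_eq_density[OF s] by (subst AE_density) (use AE_lborel_singleton[of t] in \<open>auto elim: eventually_mono\<close>)
  with nonneg[OF s] have "AE x in \<eta> s. x \<in> {..<t} \<longleftrightarrow> x \<in> {0..t}"
    by eventually_elim auto
  then have "measure (\<eta> s) {..<t} = measure (\<eta> s) {0..t}"
    by (intro finite_measure_eq_AE) simp_all
  also have "\<dots> = (LINT x|\<eta> s. indicator {0..t} x)" by (simp add: eta_space[OF s])
  also have "\<dots> = (LINT \<tau>|lborel. dens s \<tau> *\<^sub>R indicator {0..t} \<tau>)"
    by (subst eta_eq_density[OF s], rule integral_density) (use dens_nonneg[OF s] in auto)
  finally show ?thesis by (simp add: mult.commute)
qed

text \<open>Since \<open>dens s\<close> is a probability density, weights between 0 and 1 leave at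
  most \<open>\<bar>g1 s\<bar>\<close> for the outer integral. The weights used are indicators of
  time intervals and the Laplace weight.\<close>

lemma Fubini_g1_dens:
  fixes w :: "real \<Rightarrow> real"
  assumes [measurable]: "w \<in> borel_measurable borel" and w: "\<And>\<tau>. 0 \<le> w \<tau> \<and> w \<tau> \<le> 1"
  shows "integrable lborel (\<lambda>\<tau>. w \<tau> * v \<tau>)"
    and "(LINT \<tau>|lborel. w \<tau> * v \<tau>) = (LINT s|lborel. g1 s * (LINT \<tau>|lborel. w \<tau> * dens s \<tau>))"
proof -
  have wd: "integrable lborel (\<lambda>\<tau>. w \<tau> * dens s \<tau>)" "(LINT \<tau>|lborel. w \<tau> * dens s \<tau>) \<le> 1" "0 \<le> (LINT \<tau>|lborel. w \<tau> * dens s \<tau>)" if s: "s > 0" for s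
  proof -
    interpret prob_space "\<eta> s" by (rule prob[OF s])
    note sets_eta[OF s, simp, measurable_cong]
    have iw: "integrable (\<eta> s) w" by (rule integrable_const_bound[where B=1]) (use w in auto)
    have "(LINT x|\<eta> s. w x) \<le> (LINT x|\<eta> s. 1)" using w by (intro integral_mono iw) auto
    then have le: "(LINT x|\<eta> s. w x) \<le> 1" by (simp add: prob_space)
    have e: "(LINT x|\<eta> s. w x) = (LINT \<tau>|lborel. dens s \<tau> *\<^sub>R w \<tau>)"
      by (subst eta_eq_density[OF s], rule integral_density) (use dens_nonneg[OF s] in auto)
    have "integrable lborel (\<lambda>\<tau>. dens s \<tau> *\<^sub>R w \<tau>)"
      using iw by (subst (asm) eta_eq_density[OF s], subst (asm) integrable_density) (use dens_nonneg[OF s] in auto)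
    then show "integrable lborel (\<lambda>\<tau>. w \<tau> * dens s \<tau>)" by (simp add: mult.commute)
    show "(LINT \<tau>|lborel. w \<tau> * dens s \<tau>) \<le> 1" using le e by (simp add: mult.commute)
    show "0 \<le> (LINT \<tau>|lborel. w \<tau> * dens s \<tau>)"
      using w dens_nonneg[OF s] by (intro Bochner_Integration.integral_nonneg) simp
  qed
  have int: "integrable (lborel \<Otimes>\<^sub>M lborel) (\<lambda>(s, \<tau>). g1 s * (w \<tau> * dens s \<tau>))"
  proof (rule lborel_pair.Fubini_integrable)
    have i: "integrable lborel (\<lambda>\<tau>. g1 s * (w \<tau> * dens s \<tau>))" for s
    proof (cases "s > 0")
      case True then show ?thesis using wd(1) by (intro integrable_mult_right)
    qed (use g_zero(2)[of s] in simp)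
    then show "AE s in lborel. integrable lborel (\<lambda>\<tau>. case (s, \<tau>) of (s, \<tau>) \<Rightarrow> g1 s * (w \<tau> * dens s \<tau>))" by simp
    have n: "norm (LINT \<tau>|lborel. norm (g1 s * (w \<tau> * dens s \<tau>))) \<le> norm (g1 s)" for s
    proof (cases "s > 0")
      case True
      have "(LINT \<tau>|lborel. norm (g1 s * (w \<tau> * dens s \<tau>))) = \<bar>g1 s\<bar> * (LINT \<tau>|lborel. w \<tau> * dens s \<tau>)"
        using w dens_nonneg[OF True] by (simp add: abs_mult)
      also have "\<bar>\<dots>\<bar> \<le> \<bar>g1 s\<bar> * 1"
        unfolding abs_mult using wd(2,3)[OF True] by (intro mult_mono) auto
      finally show ?thesis by simp
    qed (use g_zero(2)[of s] in simp)
    show "integrable lborel (\<lambda>s. LINT \<tau>|lborel. norm (case (s, \<tau>) of (s, \<tau>) \<Rightarrow> g1 s * (w \<tau> * dens s \<tau>)))"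
      unfolding prod.case by (rule Bochner_Integration.integrable_bound[OF g1_int0]) (use n in \<open>auto intro!: AE_I2\<close>)
  qed measurable
  have sw: "(LINT s|lborel. g1 s * (w \<tau> * dens s \<tau>)) = w \<tau> * v \<tau>" for \<tau>
    unfolding v_def by (subst integral_mult_right_zero[symmetric]) (simp add: mult_ac)
  show "integrable lborel (\<lambda>\<tau>. w \<tau> * v \<tau>)"
    using lborel_pair.integrable_snd[OF int] by (simp only: sw)
  have "(LINT \<tau>|lborel. w \<tau> * v \<tau>) = (LINT \<tau>|lborel. LINT s|lborel. g1 s * (w \<tau> * dens s \<tau>))" by (simp only: sw)
  also have "\<dots> = (LINT s|lborel. LINT \<tau>|lborel. g1 s * (w \<tau> * dens s \<tau>))"
    using lborel_pair.Fubini_integral[OF int] by simp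
  finally show "(LINT \<tau>|lborel. w \<tau> * v \<tau>) = (LINT s|lborel. g1 s * (LINT \<tau>|lborel. w \<tau> * dens s \<tau>))" by simp
qed

text \<open>The average becomes an integral against tails of \<open>N t\<close>, duality turns these
  into distribution functions of \<open>\<eta> s\<close> at \<open>t\<close>, and Fubini exposes
  \<open>v\<close> as the integrand in time.\<close>

lemma u_eq:
  assumes t: "t > 0"
  shows "u t = (LINT \<tau>|lborel. indicator {0..t} \<tau> * v \<tau>)"
proof -
  have "u t = (LINT s|lborel. g1 s * measure (N t) {s<..})"
    unfolding u_def by (rule integral_by_tail(2)[OF N(1)[OF t] N(2)[OF t] g_der g1_cont g_zero(1,2) g1_int0])
  also have "\<dots> = (LINT s|lborel. g1 s * (LINT \<tau>|lborel. indicator {0..t} \<tau> * dens s \<tau>))"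
  proof (intro Bochner_Integration.integral_cong refl)
    fix s show "g1 s * measure (N t) {s<..} = g1 s * (LINT \<tau>|lborel. indicator {0..t} \<tau> * dens s \<tau>)"
      by (cases "s > 0") (simp_all add: tail[OF t] measure_eta[OF _ t] g_zero(2))
  qed
  also have "\<dots> = (LINT \<tau>|lborel. indicator {0..t} \<tau> * v \<tau>)"
    by (rule Fubini_g1_dens(2)[symmetric]) (auto simp: indicator_def)
  finally show ?thesis .
qed

lemma u_eq_open:
  assumes t: "t > 0"
  shows "u t = (LINT \<tau>|lborel. indicator {0<..<t} \<tau> * v \<tau>)"
  unfolding u_eq[OF t]
proof (rule integral_cong_AE)
  show "AE \<tau> in lborel. indicator {0..t} \<tau> * v \<tau> = indicator {0<..<t} \<tau> * v \<tau>"
    using AE_lborel_singleton[of 0] AE_lborel_singleton[of t] by eventually_elim (auto simp: indicator_def)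
qed measurable

lemma u_has_derivative:
  assumes t: "t > 0"
  shows "(u has_real_derivative v t) (at t)"
proof -
  obtain V where V: "\<And>x. (V has_real_derivative v x) (at x)"
    using einterval_antiderivative[of "-\<infinity>" "\<infinity>" v] v_cont
    by (auto simp: has_real_derivative_iff_has_vector_derivative)
  have "u s = V s - V 0" if "s > 0" for s
  proof -
    have "(LINT \<tau>|lborel. v \<tau> * indicator {0..s} \<tau>) = V s - V 0"
      by (rule integral_FTC_Icc_real) (use that V v_cont in auto)
    then show ?thesis by (simp add: u_eq[OF that] mult.commute)
  qed
  then have eq: "\<And>s. s \<in> {0<..} \<Longrightarrow> V s - V 0 = u s" by simp
  have "((\<lambda>s. V s - V 0) has_real_derivative v t - 0) (at t)"
    by (intro DERIV_diff V DERIV_const)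
  then have "((\<lambda>s. V s - V 0) has_real_derivative v t) (at t)" by simp
  then show ?thesis
    by (rule has_field_derivative_transform_within_open[where S="{0<..}"]) (use t eq in auto)
qed

lemma int_caputo:
  assumes "a < 1" and t: "t > 0"
  shows "integrable lborel (\<lambda>\<tau>. indicator {0<..<t} \<tau> * (v \<tau> * (t - \<tau>) powr (- a)))"
proof -
  obtain V where V: "V \<ge> 0" "\<And>t. \<bar>v t\<bar> \<le> V" using v_bounded by blast
  show ?thesis
  proof (rule Bochner_Integration.integrable_bound[OF integrable_mult_right[OF integrable_powr_singularity[OF assms], of V]])
    show "AE \<tau> in lborel. norm (indicator {0<..<t} \<tau> * (v \<tau> * (t - \<tau>) powr (- a))) \<le> norm (V * (indicator {0<..<t} \<tau> * (t - \<tau>) powr (- a)))"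
      using V by (intro AE_I2) (simp add: abs_mult indicator_def mult_right_mono)
  qed measurable
qed

lemma caputo_u:
  assumes "a < 1" and t: "t > 0"
  shows "caputo_differentiable a u t"
    and "caputo_deriv a u t = 1 / Gamma (1 - a) * (LINT \<tau>|lborel. indicator {0<..<t} \<tau> * (v \<tau> * (t - \<tau>) powr (- a)))"
proof -
  have d: "deriv u s = v s" if "s > 0" for s using u_has_derivative[OF that] by (rule DERIV_imp_deriv)
  have eq: "indicator {0<..<t} s *\<^sub>R (deriv u s / (t - s) powr a) = indicator {0<..<t} s * (v s * (t - s) powr (- a))" for s
    by (simp add: indicator_def d powr_minus divide_inverse)
  show "caputo_differentiable a u t"
    unfolding caputo_differentiable_def set_integrable_def eq
  proof (intro conjI ballI)
    show "u differentiable at s" if "s \<in> {0<..<t}" for s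
      unfolding real_differentiable_def by (rule exI, rule u_has_derivative) (use that in simp)
  qed (rule int_caputo[OF assms])
  show "caputo_deriv a u t = 1 / Gamma (1 - a) * (LINT \<tau>|lborel. indicator {0<..<t} \<tau> * (v \<tau> * (t - \<tau>) powr (- a)))"
    unfolding caputo_deriv_def set_lebesgue_integral_def eq ..
qed

section \<open>Laplace transforms of both sides of the fractional equation\<close>

text \<open>The Caputo derivative of \<open>u\<close> of order \<open>a\<close> without its
  normalisation \<open>1 / Gamma (1 - a)\<close>.\<close>

definition conv :: "real \<Rightarrow> real \<Rightarrow> real" where
  "conv a t = (LINT \<tau>|lborel. indicator {0<..<t} \<tau> * (v \<tau> * (t - \<tau>) powr (- a)))"

lemma laplace_v:
  assumes \<mu>: "\<mu> > 0"
  shows "integrable lborel (\<lambda>t. indicator {0<..} t * exp (- (\<mu> * t)) * v t)"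
    and "(LINT t|lborel. indicator {0<..} t * exp (- (\<mu> * t)) * v t) = (LINT s|lborel. g1 s * exp (- s * phi \<mu>))"
proof -
  let ?w = "\<lambda>t. indicator {0<..} t * exp (- (\<mu> * t))"
  have w: "0 \<le> ?w \<tau> \<and> ?w \<tau> \<le> 1" for \<tau> using \<mu> by (simp add: indicator_def)
  have wm: "?w \<in> borel_measurable borel" by measurable
  show "integrable lborel (\<lambda>t. ?w t * v t)" by (rule Fubini_g1_dens(1)[OF wm w])
  have "(LINT t|lborel. ?w t * v t) = (LINT s|lborel. g1 s * (LINT \<tau>|lborel. ?w \<tau> * dens s \<tau>))"
    by (rule Fubini_g1_dens(2)[OF wm w])
  also have "\<dots> = (LINT s|lborel. g1 s * exp (- s * phi \<mu>))"
  proof (intro Bochner_Integration.integral_cong refl)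
    fix s show "g1 s * (LINT \<tau>|lborel. ?w \<tau> * dens s \<tau>) = g1 s * exp (- s * phi \<mu>)"
    proof (cases "s > 0")
      case True
      note sets_eta[OF True, simp, measurable_cong]
      have "(LINT \<tau>|lborel. ?w \<tau> * dens s \<tau>) = (LINT \<tau>|lborel. dens s \<tau> *\<^sub>R ?w \<tau>)" by (simp add: mult.commute)
      also have "\<dots> = (LINT x|density lborel (\<lambda>x. ennreal (dens s x)). ?w x)"
        by (rule integral_density[symmetric]) (use dens_nonneg[OF True] in auto)
      also have "\<dots> = (LINT x|\<eta> s. ?w x)" by (simp only: eta_eq_density[OF True, symmetric])
      also have "\<dots> = (LINT x|\<eta> s. exp (- \<mu> * x))"
      proof (rule integral_cong_AE)
        have "AE x in \<eta> s. x \<noteq> 0"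
          unfolding eta_eq_density[OF True] by (subst AE_density) (use AE_lborel_singleton[of "0::real"] in \<open>auto elim: eventually_mono\<close>)
        with nonneg[OF True] show "AE x in \<eta> s. ?w x = exp (- \<mu> * x)"
          by eventually_elim (simp add: indicator_def)
      qed measurable
      finally have e: "(LINT \<tau>|lborel. ?w \<tau> * dens s \<tau>) = (LINT x|\<eta> s. exp (- \<mu> * x))" .
      show ?thesis unfolding e laplace[OF True \<mu>] phi_def ..
    qed (use g_zero(2)[of s] in simp)
  qed
  finally show "(LINT t|lborel. ?w t * v t) = (LINT s|lborel. g1 s * exp (- s * phi \<mu>))" .
qed

text \<open>Boundedness of \<open>v\<close> gives growth like \<open>t powr (1 - a)\<close>; it is
  coarsened to the linear growth allowed in \<open>lerch\<close>.\<close>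

lemma conv_bound:
  assumes a: "0 < a" "a < 1" and V: "\<And>t. \<bar>v t\<bar> \<le> V" and t: "t > 0"
  shows "\<bar>conv a t\<bar> \<le> V / (1 - a) * (1 + t)"
proof -
  have V0: "V \<ge> 0" using order_trans[OF abs_ge_zero V] .
  have nn: "(LINT \<tau>|lborel. indicator {0<..<t} \<tau> * (t - \<tau>) powr (- a)) = t powr (1 - a) / (1 - a)"
  proof -
    have hk: "((\<lambda>x. x powr (- a)) has_integral (t powr (- a + 1) / (- a + 1))) {0..t}"
      using a t by (intro has_integral_powr_from_0) auto
    then have "(\<lambda>x. x powr (- a)) absolutely_integrable_on {0..t}"
      by (intro nonnegative_absolutely_integrable_1) (auto intro: has_integral_integrable)
    then have si: "set_integrable lborel {0..t} (\<lambda>x. x powr (- a))"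
      unfolding set_integrable_def by (subst (asm) integrable_completion) auto
    have "t powr (1 - a) / (1 - a) = (LINT x|lborel. indicator {0..t} x *\<^sub>R x powr (- a))"
      using set_borel_integral_eq_integral(2)[OF si] integral_unique[OF hk] by (simp add: set_lebesgue_integral_def)
    also have "\<dots> = (LINT x|lborel. indicator {0..t} (t + (-1) * x) *\<^sub>R (t + (-1) * x) powr (- a))"
      using lborel_integral_real_affine[of "-1" "\<lambda>x. indicator {0..t} x *\<^sub>R x powr (- a)" t] by simp
    also have "\<dots> = (LINT \<tau>|lborel. indicator {0<..<t} \<tau> * (t - \<tau>) powr (- a))"
    proof (rule integral_cong_AE)
      show "AE x in lborel. indicator {0..t} (t + (-1) * x) *\<^sub>R (t + (-1) * x) powr (- a) = indicator {0<..<t} x * (t - x) powr (- a)"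
        using AE_lborel_singleton[of 0] AE_lborel_singleton[of t] by eventually_elim (auto simp: indicator_def)
    qed measurable
    finally show ?thesis by simp
  qed
  have "\<bar>conv a t\<bar> \<le> (LINT \<tau>|lborel. V * (indicator {0<..<t} \<tau> * (t - \<tau>) powr (- a)))"
    unfolding conv_def real_norm_def[symmetric]
  proof (rule Bochner_Integration.integral_norm_bound_integral[OF int_caputo[OF a(2) t]])
    show "integrable lborel (\<lambda>\<tau>. V * (indicator {0<..<t} \<tau> * (t - \<tau>) powr (- a)))"
      by (intro integrable_mult_right integrable_powr_singularity a t)
    show "norm (indicator {0<..<t} \<tau> * (v \<tau> * (t - \<tau>) powr (- a))) \<le> V * (indicator {0<..<t} \<tau> * (t - \<tau>) powr (- a))" for \<tau>
      using V[of \<tau>] by (simp add: abs_mult indicator_def mult_right_mono)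
  qed
  also have "\<dots> = V / (1 - a) * t powr (1 - a)" by (simp add: nn)
  also have "t powr (1 - a) \<le> 1 + t"
  proof (cases "t \<le> 1")
    case True
    then have "t powr (1 - a) \<le> 1" using t a by (intro powr_le1) auto
    then show ?thesis using t by simp
  next
    case False
    then have "t powr (1 - a) \<le> t powr 1" using a by (intro powr_mono) auto
    then show ?thesis using t by simp
  qed
  finally show ?thesis using V0 a by (simp add: mult_left_mono divide_right_mono)
qed

text \<open>Scaling the integration variable by \<open>t\<close> fixes the domain and moves the
  singularity to the fixed point 1, so that dominated convergence applies.\<close>

lemma conv_cont:
  assumes a: "0 < a" "a < 1"
  shows "continuous_on {0<..} (conv a)"
proof -
  obtain V where V: "V \<ge> 0" "\<And>t. \<bar>v t\<bar> \<le> V" using v_bounded by blast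
  define k where "k t = (LINT x|lborel. indicator {0<..<1} x * (v (t * x) * (1 - x) powr (- a)))" for t
  have eq: "conv a t = t powr (1 - a) * k t" if t: "t > 0" for t
  proof -
    have "conv a t = t * (LINT x|lborel. indicator {0<..<t} (t * x) * (v (t * x) * (t - t * x) powr (- a)))"
      unfolding conv_def using t
      lborel_integral_real_affine[of t "\<lambda>\<tau>. indicator {0<..<t} \<tau> * (v \<tau> * (t - \<tau>) powr (- a))" 0] by simp
    also have "(LINT x|lborel. indicator {0<..<t} (t * x) * (v (t * x) * (t - t * x) powr (- a))) =
        (LINT x|lborel. t powr (- a) * (indicator {0<..<1} x * (v (t * x) * (1 - x) powr (- a))))"
    proof (intro Bochner_Integration.integral_cong refl)
      fix x :: real
      have i: "indicator {0<..<t} (t * x) = (indicator {0<..<1} x :: real)"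
        using t by (simp add: indicator_def zero_less_mult_iff)
      have "(t - t * x) powr (- a) = t powr (- a) * (1 - x) powr (- a)" if "x < 1"
      proof -
        have "t - t * x = t * (1 - x)" by (simp add: algebra_simps)
        then show ?thesis using t that by (simp add: powr_mult)
      qed
      then show "indicator {0<..<t} (t * x) * (v (t * x) * (t - t * x) powr (- a)) = t powr (- a) * (indicator {0<..<1} x * (v (t * x) * (1 - x) powr (- a)))"
        unfolding i by (simp add: indicator_def)
    qed
    also have "t * \<dots> = (t * t powr (- a)) * k t" by (simp add: k_def)
    also have "t * t powr (- a) = t powr (1 - a)" using t by (simp add: powr_diff powr_minus divide_inverse)
    finally show ?thesis .
  qed
  have "isCont k t" for t
    unfolding continuous_at_sequentially comp_def
  proof safe
    fix S assume S: "S \<longlonglongrightarrow> t"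
    show "(\<lambda>n. k (S n)) \<longlonglongrightarrow> k t"
      unfolding k_def
    proof (rule integral_dominated_convergence[OF _ _ integrable_mult_right[OF integrable_powr_singularity[OF a(2) zero_less_one], of V]])
      show "AE x in lborel. (\<lambda>n. indicator {0<..<1} x * (v (S n * x) * (1 - x) powr (- a))) \<longlonglongrightarrow> indicator {0<..<1} x * (v (t * x) * (1 - x) powr (- a))"
        by (intro AE_I2 tendsto_mult tendsto_const isCont_tendsto_compose[OF v_cont] S)
      show "AE x in lborel. norm (indicator {0<..<1} x * (v (S n * x) * (1 - x) powr (- a))) \<le> V * (indicator {0<..<1} x * (1 - x) powr (- a))" for n
        using V(2) by (intro AE_I2) (simp add: abs_mult indicator_def mult_right_mono)
    qed measurable
  qed
  then have "continuous_on {0<..} (\<lambda>t. t powr (1 - a) * k t)"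
    by (intro continuous_on_mult continuous_on_powr continuous_on_id continuous_on_const continuous_at_imp_continuous_on) auto
  then show ?thesis by (rule continuous_on_eq) (simp add: eq)
qed

text \<open>The transform of a convolution is a product: the power kernel contributes
  \<open>Gamma (1 - a) * \<mu> powr (a - 1)\<close>, and \<open>v\<close> contributes its
  transform.\<close>

lemma laplace_conv:
  assumes a: "0 < a" "a < 1" and \<mu>: "\<mu> > 0"
  shows "integrable lborel (\<lambda>t. indicator {0<..} t * exp (- (\<mu> * t)) * conv a t)"
    and "(LINT t|lborel. indicator {0<..} t * exp (- (\<mu> * t)) * conv a t) =
       Gamma (1 - a) * \<mu> powr (a - 1) * (LINT s|lborel. g1 s * exp (- s * phi \<mu>))"
proof -
  define K where "K \<tau> x = (indicator {0<..} \<tau> * exp (- (\<mu> * \<tau>)) * v \<tau>) * (indicator {0<..} x * (x powr ((1 - a) - 1) * exp (- (\<mu> * x))))" for \<tau> x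
  have Gam: "has_bochner_integral lborel (\<lambda>x. indicator {0<..} x * (x powr ((1 - a) - 1) * exp (- (\<mu> * x)))) (Gamma (1 - a) * \<mu> powr (- (1 - a)))"
    using a \<mu> by (intro has_bochner_integral_Gamma) auto
  note Gi = Gam[unfolded has_bochner_integral_iff]
  have intK: "integrable (lborel \<Otimes>\<^sub>M lborel) (\<lambda>(\<tau>, t). K \<tau> (t - \<tau>))"
  proof (rule lborel_pair.Fubini_integrable)
    have "has_bochner_integral lborel (\<lambda>t. indicator {0<..} (t - \<tau>) * ((t - \<tau>) powr ((1 - a) - 1) * exp (- (\<mu> * (t - \<tau>)))))
        (Gamma (1 - a) * \<mu> powr (- (1 - a)))" for \<tau>
      using Gam by (subst (asm) lborel_has_bochner_integral_real_affine_iff[of 1 _ _ "- \<tau>"]) simp_all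
    then have sh: "integrable lborel (\<lambda>t. indicator {0<..} (t - \<tau>) * ((t - \<tau>) powr ((1 - a) - 1) * exp (- (\<mu> * (t - \<tau>)))))"
      "(LINT t|lborel. indicator {0<..} (t - \<tau>) * ((t - \<tau>) powr ((1 - a) - 1) * exp (- (\<mu> * (t - \<tau>))))) = Gamma (1 - a) * \<mu> powr (- (1 - a))" for \<tau>
      unfolding has_bochner_integral_iff by blast+
    show "AE \<tau> in lborel. integrable lborel (\<lambda>t. case (\<tau>, t) of (\<tau>, t) \<Rightarrow> K \<tau> (t - \<tau>))"
      unfolding prod.case K_def by (intro AE_I2 integrable_mult_right sh)
    have "(LINT t|lborel. norm (K \<tau> (t - \<tau>))) = norm (indicator {0<..} \<tau> * exp (- (\<mu> * \<tau>)) * v \<tau>) * (Gamma (1 - a) * \<mu> powr (- (1 - a)))" for \<tau>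
    proof -
      have "norm (K \<tau> (t - \<tau>)) = norm (indicator {0<..} \<tau> * exp (- (\<mu> * \<tau>)) * v \<tau>) * (indicator {0<..} (t - \<tau>) * ((t - \<tau>) powr ((1 - a) - 1) * exp (- (\<mu> * (t - \<tau>)))))" for t
        unfolding K_def norm_mult[of "indicator {0<..} \<tau> * exp (- (\<mu> * \<tau>)) * v \<tau>"] by (simp add: indicator_def)
      then show ?thesis by (simp only: integral_mult_right_zero sh(2))
    qed
    then show "integrable lborel (\<lambda>\<tau>. LINT t|lborel. norm (case (\<tau>, t) of (\<tau>, t) \<Rightarrow> K \<tau> (t - \<tau>)))"
      unfolding prod.case using integrable_mult_left[OF integrable_norm[OF laplace_v(1)[OF \<mu>]]] by (simp only:)
    show "(\<lambda>(\<tau>, t). K \<tau> (t - \<tau>)) \<in> borel_measurable (lborel \<Otimes>\<^sub>M lborel)"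
      unfolding K_def by measurable
  qed
  have inner: "(LINT \<tau>|lborel. K \<tau> (t - \<tau>)) = indicator {0<..} t * exp (- (\<mu> * t)) * conv a t" for t
  proof -
    have "K \<tau> (t - \<tau>) = exp (- (\<mu> * t)) * (indicator {0<..<t} \<tau> * (v \<tau> * (t - \<tau>) powr (- a)))" for \<tau>
    proof -
      have "exp (- (\<mu> * \<tau>)) * exp (- (\<mu> * (t - \<tau>))) = exp (- (\<mu> * t))" by (simp add: exp_add[symmetric] algebra_simps)
      then show ?thesis by (auto simp: K_def indicator_def mult_ac)
    qed
    then have "(LINT \<tau>|lborel. K \<tau> (t - \<tau>)) = exp (- (\<mu> * t)) * conv a t" by (simp add: conv_def)
    moreover have "conv a t = 0" if "t \<le> 0"
    proof -
      have "{0<..<t} = {}" using that by auto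
      then show ?thesis by (simp add: conv_def)
    qed
    ultimately show ?thesis by (cases "t > 0") simp_all
  qed
  have sh2: "(LINT t|lborel. K \<tau> (t - \<tau>)) = (indicator {0<..} \<tau> * exp (- (\<mu> * \<tau>)) * v \<tau>) * (Gamma (1 - a) * \<mu> powr (- (1 - a)))" for \<tau>
  proof -
    have "(LINT t|lborel. K \<tau> (t - \<tau>)) = (LINT x|lborel. K \<tau> x)"
      using lborel_integral_real_affine[of 1 "K \<tau>" "- \<tau>"] by simp
    then show ?thesis using Gi by (simp add: K_def)
  qed
  show "integrable lborel (\<lambda>t. indicator {0<..} t * exp (- (\<mu> * t)) * conv a t)"
    using lborel_pair.integrable_snd[OF intK] by (simp only: inner)
  have "(LINT t|lborel. indicator {0<..} t * exp (- (\<mu> * t)) * conv a t) = (LINT t|lborel. LINT \<tau>|lborel. K \<tau> (t - \<tau>))"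
    by (simp only: inner)
  also have "\<dots> = (LINT \<tau>|lborel. LINT t|lborel. K \<tau> (t - \<tau>))"
    using lborel_pair.Fubini_integral[OF intK] by simp
  also have "\<dots> = (Gamma (1 - a) * \<mu> powr (- (1 - a))) * (LINT s|lborel. g1 s * exp (- s * phi \<mu>))"
    unfolding sh2 integral_mult_left_zero laplace_v(2)[OF \<mu>] by (rule mult.commute)
  finally show "(LINT t|lborel. indicator {0<..} t * exp (- (\<mu> * t)) * conv a t) =
       Gamma (1 - a) * \<mu> powr (a - 1) * (LINT s|lborel. g1 s * exp (- s * phi \<mu>))" by simp
qed

definition rate :: "real \<Rightarrow> real" where
  "rate t = (LINT s|N t. g1 s)"

text \<open>Agrees with \<open>rate\<close> for \<open>t > 0\<close>, but is expressed through
  \<open>dens\<close>. In this form continuity in \<open>t\<close> and the Laplace transform are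
  accessible, whereas \<open>N t\<close> is tied to \<open>t\<close> only through its tails.\<close>

definition rate' :: "real \<Rightarrow> real" where
  "rate' t = (LINT s|lborel. g2 s * (LINT \<tau>|lborel. indicator {0..t} \<tau> * dens s \<tau>))"

lemma dens_integral_le_1:
  assumes s: "s > 0" and A: "A \<in> sets borel"
  shows "0 \<le> (LINT \<tau>|lborel. indicator A \<tau> * dens s \<tau>)" "(LINT \<tau>|lborel. indicator A \<tau> * dens s \<tau>) \<le> 1"
proof -
  interpret prob_space "\<eta> s" by (rule prob[OF s])
  have "(LINT \<tau>|lborel. indicator A \<tau> * dens s \<tau>) = (LINT \<tau>|lborel. dens s \<tau> *\<^sub>R indicator A \<tau>)" by (simp add: mult.commute)
  also have "\<dots> = (LINT x|density lborel (\<lambda>x. ennreal (dens s x)). indicator A x)"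
    by (rule integral_density[symmetric]) (use dens_nonneg[OF s] A in auto)
  also have "\<dots> = (LINT x|\<eta> s. indicator A x)" by (simp only: eta_eq_density[OF s, symmetric])
  also have "\<dots> = prob A" by (simp add: eta_space[OF s])
  finally have e: "(LINT \<tau>|lborel. indicator A \<tau> * dens s \<tau>) = prob A" .
  show "0 \<le> (LINT \<tau>|lborel. indicator A \<tau> * dens s \<tau>)" "(LINT \<tau>|lborel. indicator A \<tau> * dens s \<tau>) \<le> 1"
    unfolding e by (rule measure_nonneg, rule prob_le_1)
qed

lemma rate_eq:
  assumes t: "t > 0"
  shows "rate t = rate' t"
proof -
  have "rate t = (LINT s|lborel. g2 s * measure (N t) {s<..})"
    unfolding rate_def by (rule integral_by_tail(2)[OF N(1)[OF t] N(2)[OF t] g1_der g2_cont g_zero(2,3) g2_int])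
  also have "\<dots> = rate' t"
    unfolding rate'_def
  proof (intro Bochner_Integration.integral_cong refl)
    fix s show "g2 s * measure (N t) {s<..} = g2 s * (LINT \<tau>|lborel. indicator {0..t} \<tau> * dens s \<tau>)"
      by (cases "s > 0") (simp_all add: tail[OF t] measure_eta[OF _ t] g_zero(3))
  qed
  finally show ?thesis .
qed

lemma g2_dens_le: "\<bar>g2 s * (LINT \<tau>|lborel. indicator {0..t} \<tau> * dens s \<tau>)\<bar> \<le> \<bar>g2 s\<bar>"
proof (cases "s > 0")
  case True
  then have "\<bar>g2 s\<bar> * \<bar>LINT \<tau>|lborel. indicator {0..t} \<tau> * dens s \<tau>\<bar> \<le> \<bar>g2 s\<bar> * 1"
    using dens_integral_le_1[OF True, of "{0..t}"] by (intro mult_left_mono) auto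
  then show ?thesis by (simp add: abs_mult)
qed (use g_zero(3)[of s] in simp)

lemma rate'_bound: "\<bar>rate' t\<bar> \<le> (LINT s|lborel. \<bar>g2 s\<bar>)"
  unfolding rate'_def real_norm_def[symmetric]
proof (rule Bochner_Integration.integral_norm_bound_integral)
  show "integrable lborel (\<lambda>s. g2 s * (LINT \<tau>|lborel. indicator {0..t} \<tau> * dens s \<tau>))"
    by (rule Bochner_Integration.integrable_bound[OF g2_int]) (measurable, use g2_dens_le in \<open>intro AE_I2, simp\<close>)
  show "integrable lborel (\<lambda>s. norm (g2 s))" by (rule integrable_norm[OF g2_int])
qed (use g2_dens_le in simp)

lemma rate'_cont: "continuous_on {0<..} rate'"
proof (rule continuous_at_imp_continuous_on, rule ballI)
  fix t :: real assume "t \<in> {0<..}"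
  show "isCont rate' t"
    unfolding continuous_at_sequentially comp_def
  proof safe
    fix S assume S: "S \<longlonglongrightarrow> t"
    show "(\<lambda>n. rate' (S n)) \<longlonglongrightarrow> rate' t"
      unfolding rate'_def
    proof (rule integral_dominated_convergence[OF _ _ integrable_norm[OF g2_int]])
      show "AE s in lborel. (\<lambda>n. g2 s * (LINT \<tau>|lborel. indicator {0..S n} \<tau> * dens s \<tau>)) \<longlonglongrightarrow> g2 s * (LINT \<tau>|lborel. indicator {0..t} \<tau> * dens s \<tau>)"
      proof (rule AE_I2)
        fix s :: real
        show "(\<lambda>n. g2 s * (LINT \<tau>|lborel. indicator {0..S n} \<tau> * dens s \<tau>)) \<longlonglongrightarrow> g2 s * (LINT \<tau>|lborel. indicator {0..t} \<tau> * dens s \<tau>)"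
        proof (cases "s > 0")
          case True
          have di: "integrable lborel (dens s)"
          proof -
            interpret prob_space "\<eta> s" by (rule prob[OF True])
            have "integrable (\<eta> s) (\<lambda>_. 1::real)" by simp
            then have "integrable (density lborel (\<lambda>x. ennreal (dens s x))) (\<lambda>_. 1::real)" by (simp only: eta_eq_density[OF True, symmetric])
            then show ?thesis by (subst (asm) integrable_density) (use dens_nonneg[OF True] in auto)
          qed
          have "(\<lambda>n. LINT \<tau>|lborel. indicator {0..S n} \<tau> * dens s \<tau>) \<longlonglongrightarrow> (LINT \<tau>|lborel. indicator {0..t} \<tau> * dens s \<tau>)"
          proof (rule integral_dominated_convergence[OF _ _ integrable_norm[OF di]])
            show "AE \<tau> in lborel. (\<lambda>n. indicator {0..S n} \<tau> * dens s \<tau>) \<longlonglongrightarrow> indicator {0..t} \<tau> * dens s \<tau>"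
              using AE_lborel_singleton[of t]
            proof eventually_elim
              case (elim \<tau>)
              then consider "\<tau> < t" | "\<tau> > t" by linarith
              then have "\<forall>\<^sub>F n in sequentially. indicator {0..S n} \<tau> = (indicator {0..t} \<tau> :: real)"
              proof cases
                case 1
                then have "\<forall>\<^sub>F n in sequentially. \<tau> < S n" using S by (intro order_tendstoD)
                then show ?thesis using 1 by (elim eventually_mono) (simp add: indicator_def)
              next
                case 2
                then have "\<forall>\<^sub>F n in sequentially. S n < \<tau>" using S by (intro order_tendstoD)
                then show ?thesis using 2 by (elim eventually_mono) (simp add: indicator_def)
              qed
              then show ?case by (intro tendsto_eventually) (elim eventually_mono, simp)
            qed
            show "AE \<tau> in lborel. norm (indicator {0..S n} \<tau> * dens s \<tau>) \<le> norm (dens s \<tau>)" for n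
              by (intro AE_I2) (simp add: indicator_def)
          qed measurable
          then show ?thesis by (intro tendsto_mult tendsto_const)
        qed (use g_zero(3)[of s] in simp)
      qed
      show "AE s in lborel. norm (g2 s * (LINT \<tau>|lborel. indicator {0..S n} \<tau> * dens s \<tau>)) \<le> norm (g2 s)" for n
        using g2_dens_le by (intro AE_I2) simp
    qed measurable
  qed
qed

text \<open>Integration by parts in \<open>s\<close>. The boundary terms vanish because
  \<open>g1\<close> is 0 at 0 and tends to 0 at infinity; the factor \<open>phi \<mu>\<close>
  released here is what the weighted Caputo derivatives have to match.\<close>

lemma laplace_g2:
  assumes \<mu>: "\<mu> > 0"
  shows "(LINT s|lborel. g2 s * exp (- s * phi \<mu>)) = phi \<mu> * (LINT s|lborel. g1 s * exp (- s * phi \<mu>))"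
proof -
  have phi: "phi \<mu> > 0" unfolding phi_def using m lam \<mu> by (intro sum_pos) auto
  let ?e = "\<lambda>s. exp (- s * phi \<mu>)"
  have dom: "integrable lborel (\<lambda>s. f s * ?e s)" if f: "integrable lborel f" and z: "\<And>s. s \<le> 0 \<Longrightarrow> f s = 0" for f :: "real \<Rightarrow> real"
  proof (rule Bochner_Integration.integrable_bound[OF f])
    show "(\<lambda>s. f s * ?e s) \<in> borel_measurable lborel" using borel_measurable_integrable[OF f] by measurable
    show "AE s in lborel. norm (f s * ?e s) \<le> norm (f s)"
    proof (rule AE_I2)
      fix s show "norm (f s * ?e s) \<le> norm (f s)"
        using z[of s] phi by (cases "s > 0") (auto simp: abs_mult intro!: mult_left_le)
    qed
  qed
  have i1: "integrable lborel (\<lambda>s. g1 s * ?e s)" by (rule dom[OF g1_int0 g_zero(2)])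
  have i2: "integrable lborel (\<lambda>s. g2 s * ?e s)" by (rule dom[OF g2_int g_zero(3)])
  define F' where "F' s = g2 s * ?e s - phi \<mu> * (g1 s * ?e s)" for s
  have F'i: "integrable lborel F'"
    unfolding F'_def[abs_def] by (intro Bochner_Integration.integrable_diff integrable_mult_right i1 i2)
  have der: "((\<lambda>s. g1 s * ?e s) has_real_derivative F' s) (at s)" for s
    unfolding F'_def by (auto intro!: derivative_eq_intros g1_der simp: algebra_simps)
  have F'c: "isCont F' s" for s
  proof -
    have "isCont (\<lambda>s. exp (- s * phi \<mu>)) s" by (intro continuous_intros)
    then show ?thesis unfolding F'_def[abs_def] by (intro isCont_diff isCont_mult g2_cont g1_cont continuous_const)
  qed
  have FTC: "(LINT s|lborel. indicator {0..real n} s * F' s) = g1 n * ?e n" for n :: nat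
    using integral_FTC_Icc_real[of 0 "real n" "\<lambda>s. g1 s * ?e s" F'] der F'c g_zero(2)[of 0] by (simp add: mult.commute)
  have "(\<lambda>n. LINT s|lborel. indicator {0..real n} s * F' s) \<longlonglongrightarrow> (LINT s|lborel. F' s)"
  proof (rule integral_dominated_convergence[OF _ _ integrable_norm[OF F'i]])
    show "AE s in lborel. (\<lambda>n. indicator {0..real n} s * F' s) \<longlonglongrightarrow> F' s"
    proof (rule AE_I2)
      fix s :: real
      obtain n0 :: nat where n0: "s < n0" using reals_Archimedean2 by blast
      have "indicator {0..real n} s * F' s = F' s" if "n \<ge> n0" for n
        using g_zero(2,3)[of s] that n0 by (cases "s > 0") (auto simp: indicator_def F'_def)
      then show "(\<lambda>n. indicator {0..real n} s * F' s) \<longlonglongrightarrow> F' s"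
        by (intro tendsto_eventually) (auto simp: eventually_sequentially)
    qed
    show "AE s in lborel. norm (indicator {0..real n} s * F' s) \<le> norm (F' s)" for n
      by (intro AE_I2) (simp add: indicator_def)
    show "F' \<in> borel_measurable lborel" by (rule borel_measurable_integrable[OF F'i])
    show "(\<lambda>s. indicator {0..real n} s * F' s) \<in> borel_measurable lborel" for n
      using borel_measurable_integrable[OF F'i] by measurable
  qed
  moreover have "(\<lambda>n. LINT s|lborel. indicator {0..real n} s * F' s) \<longlonglongrightarrow> 0"
    unfolding FTC
  proof (rule Lim_null_comparison)
    show "\<forall>\<^sub>F n in sequentially. norm (g1 (real n) * exp (- real n * phi \<mu>)) \<le> \<bar>g1 (real n)\<bar>"
      using phi by (intro always_eventually allI) (simp add: abs_mult mult_left_le)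
    show "(\<lambda>n. \<bar>g1 (real n)\<bar>) \<longlonglongrightarrow> 0"
      by (rule tendsto_rabs_zero[OF filterlim_compose[OF g1_lim filterlim_real_sequentially]])
  qed
  ultimately have "(LINT s|lborel. F' s) = 0" by (rule LIMSEQ_unique)
  then have "(LINT s|lborel. g2 s * ?e s) - phi \<mu> * (LINT s|lborel. g1 s * ?e s) = 0"
    unfolding F'_def[abs_def]
    by (subst (asm) Bochner_Integration.integral_diff[OF i2 integrable_mult_right[OF i1]]) (simp only: integral_mult_right_zero)
  then show ?thesis by simp
qed

lemma laplace_rate':
  assumes \<mu>: "\<mu> > 0"
  shows "integrable lborel (\<lambda>t. indicator {0<..} t * exp (- (\<mu> * t)) * rate' t)"
    and "(LINT t|lborel. indicator {0<..} t * exp (- (\<mu> * t)) * rate' t) = (LINT s|lborel. g2 s * exp (- s * phi \<mu>)) / \<mu>"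
proof -
  let ?w = "\<lambda>t. indicator {0<..} t * exp (- (\<mu> * t)) :: real"
  define Q where "Q s t = (LINT \<tau>|lborel. indicator {0..t} \<tau> * dens s \<tau>)" for s t
  have wb: "has_bochner_integral lborel (\<lambda>t. indicator {a..} t * exp (- (\<mu> * t))) (exp (- (\<mu> * a)) / \<mu>)" for a
  proof -
    have "has_bochner_integral lborel (\<lambda>t. indicator {0..} (- a + 1 * t) * exp (- (\<mu> * (- a + 1 * t)))) ((1 / \<mu>) /\<^sub>R \<bar>1\<bar>)"
      using has_bochner_integral_exp_atLeast[OF \<mu>] by (subst (asm) lborel_has_bochner_integral_real_affine_iff[of 1 _ _ "- a"]) simp_all
    from has_bochner_integral_mult_right[OF this, of "exp (- (\<mu> * a))"]
    have "has_bochner_integral lborel (\<lambda>t. exp (- (\<mu> * a)) * (indicator {0..} (- a + 1 * t) * exp (- (\<mu> * (- a + 1 * t))))) (exp (- (\<mu> * a)) / \<mu>)"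
      by simp
    moreover have "exp (- (\<mu> * a)) * (indicator {0..} (- a + 1 * t) * exp (- (\<mu> * (- a + 1 * t)))) = indicator {a..} t * exp (- (\<mu> * t))" for t
      by (simp add: indicator_def exp_add[symmetric] algebra_simps)
    ultimately show ?thesis by (simp only:)
  qed
  have wi: "integrable lborel ?w"
    by (rule Bochner_Integration.integrable_bound[OF wb[of 0, unfolded has_bochner_integral_iff, THEN conjunct1]])
       (measurable, intro AE_I2, simp add: indicator_def)
  have int: "integrable (lborel \<Otimes>\<^sub>M lborel) (\<lambda>(s, t). g2 s * Q s t * ?w t)"
  proof (rule lborel_pair.Fubini_integrable)
    have le: "\<bar>g2 s * Q s t * ?w t\<bar> \<le> \<bar>g2 s\<bar> * ?w t" for s t
      using mult_right_mono[OF g2_dens_le[of s t], of "?w t"] by (simp add: Q_def abs_mult)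
    have i: "integrable lborel (\<lambda>t. g2 s * Q s t * ?w t)" for s
    proof (rule Bochner_Integration.integrable_bound[OF integrable_mult_right[OF wi, of "\<bar>g2 s\<bar>"]])
      show "AE t in lborel. norm (g2 s * Q s t * ?w t) \<le> norm (\<bar>g2 s\<bar> * ?w t)"
        using le[of s] by (intro AE_I2) (simp add: abs_mult)
      show "(\<lambda>t. g2 s * Q s t * ?w t) \<in> borel_measurable lborel" unfolding Q_def indicator_def atLeastAtMost_iff greaterThan_iff by measurable
    qed
    then show "AE s in lborel. integrable lborel (\<lambda>t. case (s, t) of (s, t) \<Rightarrow> g2 s * Q s t * ?w t)" by simp
    show "integrable lborel (\<lambda>s. LINT t|lborel. norm (case (s, t) of (s, t) \<Rightarrow> g2 s * Q s t * ?w t))"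
      unfolding prod.case
    proof (rule Bochner_Integration.integrable_bound[OF integrable_mult_left[OF g2_int, of "LINT t|lborel. ?w t"]])
      show "(\<lambda>s. LINT t|lborel. norm (g2 s * Q s t * ?w t)) \<in> borel_measurable lborel" unfolding Q_def indicator_def atLeastAtMost_iff greaterThan_iff by measurable
      show "AE s in lborel. norm (LINT t|lborel. norm (g2 s * Q s t * ?w t)) \<le> norm (g2 s * (LINT t|lborel. ?w t))"
      proof (rule AE_I2)
        fix s
        have "(LINT t|lborel. norm (g2 s * Q s t * ?w t)) \<le> (LINT t|lborel. \<bar>g2 s\<bar> * ?w t)"
          unfolding real_norm_def by (intro integral_mono integrable_abs i integrable_mult_right wi le)
        moreover have "0 \<le> (LINT t|lborel. ?w t)" by (intro Bochner_Integration.integral_nonneg) simp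
        moreover have "0 \<le> (LINT t|lborel. norm (g2 s * Q s t * ?w t))" by (intro Bochner_Integration.integral_nonneg) simp
        ultimately show "norm (LINT t|lborel. norm (g2 s * Q s t * ?w t)) \<le> norm (g2 s * (LINT t|lborel. ?w t))"
          by (simp add: abs_mult)
      qed
    qed
    show "(\<lambda>(s, t). g2 s * Q s t * ?w t) \<in> borel_measurable (lborel \<Otimes>\<^sub>M lborel)" unfolding Q_def indicator_def atLeastAtMost_iff greaterThan_iff by measurable
  qed
  have outer: "(LINT s|lborel. g2 s * Q s t * ?w t) = ?w t * rate' t" for t
    unfolding integral_mult_left_zero rate'_def Q_def by (rule mult.commute)
  have Qhat: "(LINT t|lborel. g2 s * Q s t * ?w t) = g2 s * exp (- s * phi \<mu>) / \<mu>" for s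
  proof (cases "s > 0")
    case True
    interpret prob_space "\<eta> s" by (rule prob[OF True])
    note sets_eta[OF True, simp, measurable_cong]
    interpret pair_sigma_finite "\<eta> s" lborel ..
    \<comment> \<open>The distribution function at \<open>t\<close> is written as an average of
      indicators of \<open>{x..}\<close>, so that the integral over \<open>t\<close> can be done
      first and gives \<open>exp (- \<mu> * x) / \<mu>\<close>.\<close>
    have Q: "Q s t * ?w t = (LINT x|\<eta> s. ?w t * indicator {x..} t)" for t
    proof (cases "t > 0")
      case tpos: True
      have "Q s t = (LINT \<tau>|lborel. dens s \<tau> *\<^sub>R indicator {0..t} \<tau>)" by (simp add: Q_def mult.commute)
      also have "\<dots> = (LINT x|density lborel (\<lambda>x. ennreal (dens s x)). indicator {0..t} x)"
        by (rule integral_density[symmetric]) (use dens_nonneg[OF True] in auto)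
      also have "\<dots> = (LINT x|\<eta> s. indicator {0..t} x)" by (simp only: eta_eq_density[OF True, symmetric])
      also have "\<dots> = (LINT x|\<eta> s. indicator {x..} t)"
      proof (rule integral_cong_AE)
        show "AE x in \<eta> s. indicator {0..t} x = (indicator {x..} t :: real)"
          using nonneg[OF True] by eventually_elim (simp add: indicator_def)
        show "(\<lambda>x. indicator {x..} t :: real) \<in> borel_measurable (\<eta> s)" unfolding indicator_def atLeast_iff by measurable
      qed measurable
      finally show ?thesis by (simp add: mult.commute)
    qed simp
    have int2: "integrable (\<eta> s \<Otimes>\<^sub>M lborel) (\<lambda>(x, t). ?w t * indicator {x..} t)"
    proof (rule Fubini_integrable)
      have m: "(\<lambda>(x, t). ?w t * indicator {x..} t) \<in> borel_measurable (\<eta> s \<Otimes>\<^sub>M lborel)"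
        unfolding indicator_def atLeast_iff by measurable
      then show "(\<lambda>(x, t). ?w t * indicator {x..} t) \<in> borel_measurable (\<eta> s \<Otimes>\<^sub>M lborel)" .
      have i: "integrable lborel (\<lambda>t. ?w t * indicator {x..} t)" for x
        by (rule Bochner_Integration.integrable_bound[OF wi]) (measurable, intro AE_I2, simp add: indicator_def)
      then show "AE x in \<eta> s. integrable lborel (\<lambda>t. case (x, t) of (x, t) \<Rightarrow> ?w t * indicator {x..} t)" by simp
      have "norm (LINT t|lborel. norm (?w t * indicator {x..} t)) \<le> (LINT t|lborel. ?w t)" for x
      proof -
        have "(LINT t|lborel. norm (?w t * indicator {x..} t)) \<le> (LINT t|lborel. ?w t)"
          by (intro integral_mono integrable_norm i wi) (simp add: indicator_def)
        moreover have "0 \<le> (LINT t|lborel. norm (?w t * indicator {x..} t))" by (intro Bochner_Integration.integral_nonneg) simp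
        ultimately show ?thesis by simp
      qed
      moreover have "(\<lambda>x. LINT t|lborel. norm (?w t * indicator {x..} t)) \<in> borel_measurable (\<eta> s)"
        unfolding indicator_def atLeast_iff greaterThan_iff by measurable
      ultimately show "integrable (\<eta> s) (\<lambda>x. LINT t|lborel. norm (case (x, t) of (x, t) \<Rightarrow> ?w t * indicator {x..} t))"
        unfolding prod.case by (intro integrable_const_bound[where B="LINT t|lborel. ?w t"] AE_I2)
    qed
    have "(LINT t|lborel. Q s t * ?w t) = (LINT x|\<eta> s. LINT t|lborel. ?w t * indicator {x..} t)"
      unfolding Q using Fubini_integral[OF int2] by simp
    also have "\<dots> = (LINT x|\<eta> s. exp (- \<mu> * x) / \<mu>)"
    proof (rule integral_cong_AE)
      show "AE x in \<eta> s. (LINT t|lborel. ?w t * indicator {x..} t) = exp (- \<mu> * x) / \<mu>"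
        using nonneg[OF True]
      proof eventually_elim
        case (elim x)
        have "(LINT t|lborel. ?w t * indicator {x..} t) = (LINT t|lborel. indicator {x..} t * exp (- (\<mu> * t)))"
        proof (rule integral_cong_AE)
          show "AE t in lborel. ?w t * indicator {x..} t = indicator {x..} t * exp (- (\<mu> * t))"
            using AE_lborel_singleton[of "0::real"] by eventually_elim (use elim in \<open>auto simp: indicator_def\<close>)
        qed measurable
        then show ?case using wb[of x] by (simp add: has_bochner_integral_iff)
      qed
      show "(\<lambda>x. LINT t|lborel. ?w t * indicator {x..} t) \<in> borel_measurable (\<eta> s)"
        using borel_measurable_integrable[OF integrable_fst[OF int2]] by simp
    qed measurable
    also have "\<dots> = exp (- s * phi \<mu>) / \<mu>"
      unfolding integral_divide_zero laplace[OF True \<mu>] phi_def ..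
    finally have "(LINT t|lborel. Q s t * ?w t) = exp (- s * phi \<mu>) / \<mu>" .
    then show ?thesis unfolding mult.assoc[of "g2 s"] integral_mult_right_zero by simp
  qed (use g_zero(3)[of s] in simp)
  show "integrable lborel (\<lambda>t. ?w t * rate' t)"
    using lborel_pair.integrable_snd[OF int] by (simp only: outer)
  have "(LINT t|lborel. ?w t * rate' t) = (LINT t|lborel. LINT s|lborel. g2 s * Q s t * ?w t)"
    by (simp only: outer)
  also have "\<dots> = (LINT s|lborel. LINT t|lborel. g2 s * Q s t * ?w t)"
    using lborel_pair.Fubini_integral[OF int] by simp
  also have "\<dots> = (LINT s|lborel. g2 s * exp (- s * phi \<mu>)) / \<mu>"
    unfolding Qhat by (rule integral_divide_zero)
  finally show "(LINT t|lborel. ?w t * rate' t) = (LINT s|lborel. g2 s * exp (- s * phi \<mu>)) / \<mu>" .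
qed

text \<open>With \<open>J\<close> the Laplace transform of \<open>v\<close>, the Caputo derivative
  of order \<open>\<alpha> j\<close> has transform \<open>\<mu> powr (\<alpha> j - 1) * J\<close>,
  so the weighted sum has \<open>phi \<mu> * J / \<mu>\<close>. By \<open>laplace_g2\<close> this is
  also the transform of \<open>rate'\<close>. Only integer \<mu> are compared, which is all that
  \<open>lerch\<close> asks for.\<close>

theorem caputo_equation:
  assumes t: "t > 0"
  shows "(\<Sum>j=1..m. lam j * caputo_deriv (\<alpha> j) u t) = (LINT s|N t. g1 s)"
proof -
  obtain V where V: "\<And>t. \<bar>v t\<bar> \<le> V" using v_bounded by blast
  define A where "A t = (\<Sum>j=1..m. lam j / Gamma (1 - \<alpha> j) * conv (\<alpha> j) t)" for t
  define F where "F t = A t - rate' t" for t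
  have Gp: "Gamma (1 - \<alpha> j) > 0" if "j \<in> {1..m}" for j
    using \<alpha>[OF that] by (intro Gamma_real_pos) simp
  define C where "C = (\<Sum>j=1..m. lam j / Gamma (1 - \<alpha> j) * (V / (1 - \<alpha> j))) + (LINT s|lborel. \<bar>g2 s\<bar>)"
  have "F t = 0"
  proof (rule lerch[OF _ _ _ t])
    show "continuous_on {0<..} F"
      unfolding F_def[abs_def] A_def
      by (intro continuous_on_diff continuous_on_sum continuous_on_mult continuous_on_const rate'_cont conv_cont) (use \<alpha> in auto)
    show "\<bar>F t\<bar> \<le> C * (1 + t)" if t: "t > 0" for t
    proof -
      have "\<bar>A t\<bar> \<le> (\<Sum>j=1..m. lam j / Gamma (1 - \<alpha> j) * (V / (1 - \<alpha> j)) * (1 + t))"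
        unfolding A_def
      proof (rule order_trans[OF sum_abs], rule sum_mono)
        fix j assume j: "j \<in> {1..m}"
        have "\<bar>conv (\<alpha> j) t\<bar> \<le> V / (1 - \<alpha> j) * (1 + t)" using \<alpha>[OF j] by (intro conv_bound V t) auto
        then have "lam j / Gamma (1 - \<alpha> j) * \<bar>conv (\<alpha> j) t\<bar> \<le> lam j / Gamma (1 - \<alpha> j) * (V / (1 - \<alpha> j) * (1 + t))"
          using lam[OF j] Gp[OF j] by (intro mult_left_mono) auto
        then show "\<bar>lam j / Gamma (1 - \<alpha> j) * conv (\<alpha> j) t\<bar> \<le> lam j / Gamma (1 - \<alpha> j) * (V / (1 - \<alpha> j)) * (1 + t)"
          using lam[OF j] Gp[OF j] by (simp add: abs_mult mult.assoc)
      qed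
      moreover have "\<bar>rate' t\<bar> \<le> (LINT s|lborel. \<bar>g2 s\<bar>) * (1 + t)"
      proof -
        have "0 \<le> (LINT s|lborel. \<bar>g2 s\<bar>)" by (intro Bochner_Integration.integral_nonneg) simp
        then have "(LINT s|lborel. \<bar>g2 s\<bar>) * 1 \<le> (LINT s|lborel. \<bar>g2 s\<bar>) * (1 + t)" using t by (intro mult_left_mono) auto
        then show ?thesis using rate'_bound[of t] by simp
      qed
      ultimately show ?thesis unfolding F_def C_def by (simp add: distrib_right sum_distrib_right)
    qed
    fix k :: nat assume "k \<ge> 1"
    then have k: "real k > 0" by simp
    let ?w = "\<lambda>t. indicator {0<..} t * exp (- (real k * t)) :: real"
    let ?J = "LINT s|lborel. g1 s * exp (- s * phi (real k))"
    have ci: "integrable lborel (\<lambda>t. lam j / Gamma (1 - \<alpha> j) * (?w t * conv (\<alpha> j) t))" if "j \<in> {1..m}" for j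
      using \<alpha>[OF that] by (intro integrable_mult_right laplace_conv(1) k) auto
    have eq: "indicator {0<..} t * (exp (- (real k * t)) * F t) =
        (\<Sum>j=1..m. lam j / Gamma (1 - \<alpha> j) * (?w t * conv (\<alpha> j) t)) - ?w t * rate' t" for t
      by (simp add: F_def A_def right_diff_distrib sum_distrib_left mult_ac)
    have "(LINT t|lborel. indicator {0<..} t * (exp (- (real k * t)) * F t)) =
       (\<Sum>j=1..m. LINT t|lborel. lam j / Gamma (1 - \<alpha> j) * (?w t * conv (\<alpha> j) t)) - (LINT t|lborel. ?w t * rate' t)"
      unfolding eq by (subst Bochner_Integration.integral_diff[OF Bochner_Integration.integrable_sum[OF ci] laplace_rate'(1)[OF k]])
        (simp_all only: Bochner_Integration.integral_sum[OF ci])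
    also have "(\<Sum>j=1..m. LINT t|lborel. lam j / Gamma (1 - \<alpha> j) * (?w t * conv (\<alpha> j) t)) = (\<Sum>j=1..m. lam j * real k powr (\<alpha> j) / real k * ?J)"
    proof (rule sum.cong[OF refl])
      fix j assume j: "j \<in> {1..m}"
      have "(LINT t|lborel. lam j / Gamma (1 - \<alpha> j) * (?w t * conv (\<alpha> j) t)) = lam j / Gamma (1 - \<alpha> j) * (Gamma (1 - \<alpha> j) * real k powr (\<alpha> j - 1) * ?J)"
        using \<alpha>[OF j] \<open>k \<ge> 1\<close> by (subst integral_mult_right_zero, subst laplace_conv(2)) (auto simp: k)
      also have "\<dots> = lam j * real k powr (\<alpha> j - 1) * ?J" using Gp[OF j] by simp
      also have "real k powr (\<alpha> j - 1) = real k powr (\<alpha> j) / real k" using k by (simp add: powr_diff)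
      finally show "(LINT t|lborel. lam j / Gamma (1 - \<alpha> j) * (?w t * conv (\<alpha> j) t)) = lam j * real k powr (\<alpha> j) / real k * ?J"
        by simp
    qed
    also have "\<dots> = phi (real k) * ?J / real k"
      unfolding phi_def by (simp add: sum_distrib_right sum_divide_distrib)
    also have "(LINT t|lborel. ?w t * rate' t) = phi (real k) * ?J / real k"
      unfolding laplace_rate'(2)[OF k] laplace_g2[OF k] ..
    finally show "(LINT t|lborel. indicator {0<..} t * (exp (- (real k * t)) * F t)) = 0" by simp
  qed
  moreover have "(\<Sum>j=1..m. lam j * caputo_deriv (\<alpha> j) u t) = A t"
    unfolding A_def
  proof (rule sum.cong[OF refl])
    fix j assume "j \<in> {1..m}"
    then show "lam j * caputo_deriv (\<alpha> j) u t = lam j / Gamma (1 - \<alpha> j) * conv (\<alpha> j) t"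
      using \<alpha> by (subst caputo_u(2)[OF _ t]) (auto simp: conv_def)
  qed
  ultimately show ?thesis
    using rate_eq[OF t] by (simp add: F_def rate_def)
qed

end

subsection \<open>The limit\<close>

text \<open>Weak convergence of distribution functions, fed by tails at positive points only. The
  limit may have an atom at 0, as in \<open>clock_law_origin\<close>, where it is the Dirac
  measure.\<close>

lemma integral_convergence_by_tails:
  fixes f :: "real \<Rightarrow> real"
  assumes N: "\<And>r. prob_space (N r)" "\<And>r. sets (N r) = sets borel" "\<And>r. AE s in N r. 0 < s"
    and Q: "prob_space Q" "sets Q = sets borel" "AE s in Q. 0 \<le> s"
    and tails: "\<And>s. s > 0 \<Longrightarrow> (\<lambda>r. measure (N r) {s<..}) \<longlonglongrightarrow> measure Q {s<..}"
    and f: "\<And>s. isCont f s" "\<And>s. \<bar>f s\<bar> \<le> B"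
  shows "(\<lambda>r. LINT s|N r. f s) \<longlonglongrightarrow> (LINT s|Q. f s)"
proof -
  have rd: "real_distribution D" if "prob_space D" "sets D = sets borel" for D :: "real measure"
    using that by (simp add: real_distribution_def real_distribution_axioms_def)
  have cdf: "cdf D s = 1 - measure D {s<..}" if "prob_space D" "sets D = sets borel" for D s
  proof -
    interpret D: prob_space D by fact
    have "space D = UNIV" using sets_eq_imp_space_eq[OF that(2)] by simp
    then have "{..s} = space D - {s<..}" by auto
    then show ?thesis using D.prob_compl[of "{s<..}"] that(2) by (simp add: cdf_def2)
  qed
  have null: "measure D A = 0" if D: "prob_space D" "sets D = sets borel" and A: "A \<in> sets borel" and "AE s in D. s \<notin> A" for D :: "real measure" and A
  proof -
    interpret D: prob_space D by fact
    have "emeasure D A = 0" using AE_iff_measurable[of A D "\<lambda>s. s \<notin> A"] that sets_eq_imp_space_eq[OF D(2)] by auto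
    then show ?thesis by (simp add: measure_def)
  qed
  have "weak_conv_m N Q"
    unfolding weak_conv_m_def weak_conv_def
  proof safe
    fix s assume c: "isCont (cdf Q) s"
    interpret Q: real_distribution Q by (rule rd) (use Q in auto)
    show "(\<lambda>r. cdf (N r) s) \<longlonglongrightarrow> cdf Q s"
    proof (cases "s > 0")
      case True
      then show ?thesis unfolding cdf[OF N(1,2)] cdf[OF Q(1,2)] by (intro tendsto_intros tails)
    next
      case False
      have "cdf (N r) s = 0" for r
        unfolding cdf_def2 by (rule null[OF N(1,2)]) (use N(3)[of r] False in \<open>auto elim: AE_mp\<close>)
      \<comment> \<open>If \<open>Q\<close> has an atom at 0, then 0 is not a continuity point of
        its distribution function; continuity at \<open>s \<le> 0\<close> therefore rules out mass
        at \<open>s\<close>.\<close>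
      moreover have "cdf Q s = 0"
      proof -
        have "measure Q {..s} = measure Q {s} + measure Q {..<s}"
        proof -
          have "{..s} = {s} \<union> {..<s}" by auto
          then show ?thesis by (simp only:) (rule Q.finite_measure_Union, auto)
        qed
        moreover have "measure Q {..<s} = 0"
          by (rule null[OF Q(1,2)]) (use Q(3) False in \<open>auto elim: AE_mp\<close>)
        ultimately show ?thesis using c by (simp add: Q.isCont_cdf cdf_def2)
      qed
      ultimately show ?thesis by simp
    qed
  qed
  then show ?thesis
    using weak_conv_imp_integral_bdd_continuous_conv[of N Q f B] rd[OF N(1,2)] rd[OF Q(1,2)] f by auto
qed

abbreviation exp_law :: "real \<Rightarrow> real measure" where
  "exp_law l \<equiv> density lborel (\<lambda>s. ennreal (exponential_density l s))"

lemma exp_law_props: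
  assumes l: "l > 0"
  shows "prob_space (exp_law l)" "sets (exp_law l) = sets borel" "AE s in exp_law l. 0 < s"
    and "s \<ge> 0 \<Longrightarrow> measure (exp_law l) {s<..} = exp (- s * l)"
proof -
  show p: "prob_space (exp_law l)" by (rule prob_space_exponential_density[OF l])
  interpret prob_space "exp_law l" by fact
  show "sets (exp_law l) = sets borel" by simp
  have *: "distributed (exp_law l) lborel (\<lambda>x. x) (exponential_density l)"
    unfolding distributed_def by (auto simp: distr_id2)
  show "measure (exp_law l) {s<..} = exp (- s * l)" if "s \<ge> 0"
    using exponential_distributedD_gt[OF * that l] by (simp add: greaterThan_def)
  show "AE s in exp_law l. 0 < s"
    using AE_lborel_singleton[of "0::real"]
    by (subst AE_density) (auto elim: AE_mp simp: exponential_density_def)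
qed

context time_changed_bm
begin

definition limit_rate :: real where "limit_rate = (\<Sum>j=1..m. lam j) / c\<^sup>2"

lemma limit_rate_pos: "limit_rate > 0"
  unfolding limit_rate_def using m lam c by (intro divide_pos_pos sum_pos) auto

lemma Phi_tendsto:
  assumes \<mu>: "\<mu> > 0"
  shows "(\<lambda>r. Phi r \<mu> / c\<^sup>2) \<longlonglongrightarrow> limit_rate"
proof -
  have "(\<lambda>r. \<Sum>j=1..m. lam j * \<mu> powr (\<nu> j ^ r)) \<longlonglongrightarrow> (\<Sum>j=1..m. lam j * \<mu> powr 0)"
  proof (intro tendsto_sum tendsto_mult tendsto_const tendsto_powr)
    fix j assume "j \<in> {1..m}"
    then show "(\<lambda>r. \<nu> j ^ r) \<longlonglongrightarrow> 0" using \<nu>[of j] by (intro LIMSEQ_power_zero) auto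
  qed (use \<mu> in auto)
  then show ?thesis using \<mu> c unfolding Phi_def limit_rate_def by (intro tendsto_divide tendsto_const) auto
qed

text \<open>The limit of the Laplace exponent is the same for every \<mu>. The upper bound carries a
  factor \<open>exp (\<mu> * t)\<close>, harmless for small \<mu>; the lower bound loses
  \<open>exp (- \<mu> * t)\<close>, harmless for large \<mu>. The limit does not involve
  \<open>t\<close>, which is the source of the independence of \<open>t\<close> in the
  theorem.\<close>

lemma eta_tail_tendsto:
  assumes s: "s \<ge> 0" and t: "t > 0"
  shows "(\<lambda>r. measure (eta r s) {..<t}) \<longlonglongrightarrow> exp (- s * limit_rate)"
proof -
  have E: "(\<lambda>r. exp (- s * (Phi r \<mu> / c\<^sup>2))) \<longlonglongrightarrow> exp (- s * limit_rate)" if "\<mu> > 0" for \<mu>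
    by (intro tendsto_exp tendsto_mult tendsto_const Phi_tendsto that)
  have le: "measure (eta r s) {..<t} \<le> exp (\<mu> * t) * exp (- s * (Phi r \<mu> / c\<^sup>2))"
    and ge: "exp (- s * (Phi r \<mu> / c\<^sup>2)) - exp (- \<mu> * t) \<le> measure (eta r s) {..<t}" if "\<mu> > 0" for \<mu> r
    using laplace_lower_tail[OF eta_props(1,2,3)[OF s] that, of r t] eta_props(4)[OF s that, of r] by simp_all
  show ?thesis
  proof (rule order_tendstoI)
      fix a assume a: "exp (- s * limit_rate) < a"
      have "((\<lambda>\<mu>. exp (\<mu> * t) * exp (- s * limit_rate)) \<longlongrightarrow> exp (0 * t) * exp (- s * limit_rate)) (at_right 0)"
        by (intro tendsto_intros)
      then have "\<forall>\<^sub>F \<mu> in at_right 0. exp (\<mu> * t) * exp (- s * limit_rate) < a" using a by (auto dest: order_tendstoD)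
      then have "\<forall>\<^sub>F \<mu> in at_right 0. 0 < \<mu> \<and> exp (\<mu> * t) * exp (- s * limit_rate) < a"
        by (rule eventually_conj[OF eventually_at_right_less])
      then obtain \<mu> where \<mu>: "\<mu> > 0" "exp (\<mu> * t) * exp (- s * limit_rate) < a"
        using eventually_happens'[OF trivial_limit_at_right_real] by blast
      have "(\<lambda>r. exp (\<mu> * t) * exp (- s * (Phi r \<mu> / c\<^sup>2))) \<longlonglongrightarrow> exp (\<mu> * t) * exp (- s * limit_rate)"
        by (intro tendsto_mult tendsto_const E \<mu>)
      from order_tendstoD(2)[OF this \<mu>(2)]
      show "\<forall>\<^sub>F r in sequentially. measure (eta r s) {..<t} < a"
        by (rule eventually_mono) (use le[OF \<mu>(1)] in \<open>auto intro: le_less_trans\<close>)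
    next
      fix a assume a: "a < exp (- s * limit_rate)"
      have "((\<lambda>\<mu>. y - exp (- \<mu> * t)) \<longlongrightarrow> y) at_top" for y
        using t by real_asymp
      then have "\<forall>\<^sub>F \<mu> in at_top. a < exp (- s * limit_rate) - exp (- \<mu> * t)" using a by (auto dest: order_tendstoD)
      then have "\<forall>\<^sub>F \<mu> in at_top. 0 < \<mu> \<and> a < exp (- s * limit_rate) - exp (- \<mu> * t)"
        by (rule eventually_conj[OF eventually_gt_at_top])
      then obtain \<mu> where \<mu>: "\<mu> > 0" "a < exp (- s * limit_rate) - exp (- \<mu> * t)"
        using eventually_happens'[OF trivial_limit_at_top_linorder] by blast
      have "(\<lambda>r. exp (- s * (Phi r \<mu> / c\<^sup>2)) - exp (- \<mu> * t)) \<longlonglongrightarrow> exp (- s * limit_rate) - exp (- \<mu> * t)"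
        by (intro tendsto_diff tendsto_const E \<mu>)
      from order_tendstoD(1)[OF this \<mu>(2)]
      show "\<forall>\<^sub>F r in sequentially. a < measure (eta r s) {..<t}"
        by (rule eventually_mono) (use ge[OF \<mu>(1)] in \<open>auto intro: less_le_trans\<close>)
    qed
qed

lemma clock_law_tendsto:
  fixes f :: "real \<Rightarrow> real"
  assumes t: "t > 0" and f: "\<And>s. isCont f s" "\<And>s. \<bar>f s\<bar> \<le> K"
  shows "(\<lambda>r. LINT s|clock_law r t. f s) \<longlonglongrightarrow> (LINT s|exp_law limit_rate. f s)"
proof -
  \<comment> \<open>Shifted by one, because the properties of the clock law are available from
    \<open>r = 1\<close> on.\<close>
  have "(\<lambda>r. LINT s|clock_law (Suc r) t. f s) \<longlonglongrightarrow> (LINT s|exp_law limit_rate. f s)"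
  proof (rule integral_convergence_by_tails)
    fix s :: real assume s: "s > 0"
    have "(\<lambda>r. measure (eta (Suc r) s) {..<t}) \<longlonglongrightarrow> exp (- s * limit_rate)"
      using s by (intro LIMSEQ_Suc eta_tail_tendsto t) simp
    then show "(\<lambda>r. measure (clock_law (Suc r) t) {s<..}) \<longlonglongrightarrow> measure (exp_law limit_rate) {s<..}"
      using s t by (simp add: clock_law_props(3) exp_law_props(4)[OF limit_rate_pos])
  next
    show "AE s in exp_law limit_rate. 0 \<le> s" using exp_law_props(3)[OF limit_rate_pos] by eventually_elim simp
  qed (use t f exp_law_props(1,2)[OF limit_rate_pos] clock_law_props(1,2,4) in auto)
  then show ?thesis by (rule LIMSEQ_imp_Suc)
qed

text \<open>As \<open>t\<close> decreases to 0 the clock law concentrates at 0, which yields the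
  initial condition.\<close>

lemma clock_law_origin:
  fixes f :: "real \<Rightarrow> real"
  assumes r: "r \<ge> 1" and f: "\<And>s. isCont f s" "\<And>s. \<bar>f s\<bar> \<le> K"
  shows "((\<lambda>t. LINT s|clock_law r t. f s) \<longlongrightarrow> f 0) (at_right 0)"
proof (rule tendsto_at_right_sequentially[OF zero_less_one])
  fix T :: "nat \<Rightarrow> real"
  assume T: "\<And>n. 0 < T n" and T0: "T \<longlonglongrightarrow> 0"
  have "(\<lambda>n. LINT s|clock_law r (T n). f s) \<longlonglongrightarrow> (LINT s|return borel 0. f s)"
  proof (rule integral_convergence_by_tails)
    fix s :: real assume s: "s > 0"
    define a p where "a = s / c\<^sup>2 * lam 1" and "p = \<nu> 1 ^ r"
    have a: "a > 0" and p: "p > 0" using s c lam[of 1] \<nu>[of 1] m by (auto simp: a_def p_def)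
    \<comment> \<open>The choice \<open>\<mu> = 1 / t\<close> keeps the prefactor equal to
      \<open>exp 1\<close> while the exponent grows at least like the power \<open>p\<close> of
      \<open>1 / t\<close>.\<close>
    have le: "measure (clock_law r t) {s<..} \<le> exp 1 * exp (- a * (1 / t) powr p)" if t: "t > 0" for t
    proof -
      have "lam 1 * (1 / t) powr p \<le> Phi r (1 / t)"
        unfolding Phi_def p_def using m by (intro member_le_sum mult_nonneg_nonneg) (auto simp: less_imp_le[OF lam])
      then have "s / c\<^sup>2 * (lam 1 * (1 / t) powr p) \<le> s / c\<^sup>2 * Phi r (1 / t)"
        using s by (intro mult_left_mono) auto
      then have "a * (1 / t) powr p \<le> s * (Phi r (1 / t) / c\<^sup>2)" by (simp add: a_def)
      moreover have "measure (eta r s) {..<t} \<le> exp (1 / t * t) * exp (- s * (Phi r (1 / t) / c\<^sup>2))"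
        using laplace_lower_tail(1)[OF eta_props(1,2,3), of s "1 / t" r t] eta_props(4)[of s "1 / t" r] s t by simp
      ultimately show ?thesis using clock_law_props(3)[OF r t, of s] s t by (auto intro: order_trans)
    qed
    have "((\<lambda>t. exp 1 * exp (- a * (1 / t) powr p)) \<longlongrightarrow> 0) (at_right 0)"
      using a p by real_asymp
    moreover have "filterlim T (at_right 0) sequentially"
      using T T0 by (simp add: filterlim_at less_imp_neq[THEN not_sym])
    ultimately have "(\<lambda>n. exp 1 * exp (- a * (1 / T n) powr p)) \<longlonglongrightarrow> 0" by (rule filterlim_compose)
    then have "(\<lambda>n. measure (clock_law r (T n)) {s<..}) \<longlonglongrightarrow> 0"
      by (rule tendsto_sandwich[OF always_eventually always_eventually tendsto_const, rotated 2]) (simp, intro allI le T)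
    then show "(\<lambda>n. measure (clock_law r (T n)) {s<..}) \<longlonglongrightarrow> measure (return borel 0) {s<..}"
      using s by (simp add: measure_return)
  qed (use T f clock_law_props(1,2,4)[OF r] in \<open>auto intro: prob_space_return simp: AE_return\<close>)
  moreover have "f \<in> borel_measurable borel"
    using f(1) by (intro borel_measurable_continuous_onI continuous_at_imp_continuous_on) auto
  ultimately show "(\<lambda>n. LINT s|clock_law r (T n). f s) \<longlonglongrightarrow> f 0" by (simp add: integral_return)
qed

end

section \<open>The Bessel form of the limit density\<close>

lemma integral_ek_exp_eq_bessel_K:
  assumes l: "l > 0" and b: "b > 0" and p: "p \<ge> 0"
  shows "(LINT s|lborel. exp (- (l * s)) * ek p b s) = 2 * sqrt (b / l) powr (1 - p) * bessel_K (p - 1) (2 * sqrt (b * l))"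
proof -
  define s0 where "s0 = sqrt (b / l)"
  define z where "z = 2 * sqrt (b * l)"
  define h where "h s = exp (- (l * s)) * ek p b s" for s
  define F where "F y = exp (- z * cosh y) * exp ((1 - p) * y)" for y
  define G where "G y = exp (- z * cosh y) * cosh ((p - 1) * y)" for y
  have s0: "s0 > 0" using l b by (simp add: s0_def)
  have [measurable]: "h \<in> borel_measurable borel" "F \<in> borel_measurable borel" "G \<in> borel_measurable borel"
    unfolding h_def[abs_def] F_def[abs_def] G_def[abs_def] cosh_def by measurable
  have hi: "integrable lborel h"
  proof -
    obtain C where C: "C \<ge> 0" "\<And>s. ek p b s \<le> C" using ek_bounded[OF b p] by blast
    have "integrable lborel (\<lambda>t. C * (indicator {0..} t * exp (- (l * t))))"
      using has_bochner_integral_exp_atLeast[OF l] by (intro integrable_mult_right) (simp add: has_bochner_integral_iff)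
    then show ?thesis
    proof (rule Bochner_Integration.integrable_bound)
      have "\<bar>h s\<bar> \<le> \<bar>C * (indicator {0..} s * exp (- (l * s)))\<bar>" for s
        using C mult_right_mono[OF C(2)[of s], of "exp (- (l * s))"] by (cases "s \<le> 0") (auto simp: h_def abs_mult mult.commute)
      then show "AE s in lborel. norm (h s) \<le> norm (C * (indicator {0..} s * exp (- (l * s))))" by simp
    qed measurable
  qed
  have range: "(\<lambda>y. s0 * exp y) ` UNIV = {0<..}"
  proof safe
    fix s :: real assume "s > 0"
    then have "s = s0 * exp (ln (s / s0))" using s0 by simp
    then show "s \<in> range (\<lambda>y. s0 * exp y)" by (rule range_eqI)
  qed (use s0 in simp)
  have sub: "\<bar>s0 * exp y\<bar> * h (s0 * exp y) = s0 powr (1 - p) * F y" for y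
  proof -
    have s0sq: "s0 * s0 = b / l" using l b by (simp add: s0_def)
    have zs: "z = 2 * (l * s0)" using l b
      by (simp add: z_def s0_def real_sqrt_divide real_sqrt_mult real_div_sqrt field_simps)
    have bz: "b = l * s0 * s0" using s0sq l by (simp add: field_simps)
    \<comment> \<open>The scale \<open>s0\<close> is the point where \<open>l * s\<close> and
      \<open>b / s\<close> balance, both being \<open>z / 2\<close> there; centring the substitution
      at it makes the exponent even in \<open>y\<close>.\<close>
    have "l * (s0 * exp y) + b / (s0 * exp y) = z * cosh y"
      unfolding zs using s0 by (subst bz) (simp add: cosh_def exp_minus field_simps)
    then have e: "exp (- (l * (s0 * exp y))) * exp (- b / (s0 * exp y)) = exp (- z * cosh y)"
      by (simp add: exp_add[symmetric])
    have "(s0 * exp y) * (s0 * exp y) powr (- p) = (s0 * exp y) powr (1 - p)"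
      using s0 by (simp add: powr_diff powr_minus field_simps)
    also have "\<dots> = s0 powr (1 - p) * exp ((1 - p) * y)"
      using s0 by (simp add: powr_mult powr_def[of "exp y"])
    finally have "s0 * exp y * (s0 * exp y) powr (- p) = s0 powr (1 - p) * exp ((1 - p) * y)" .
    then have "s0 * exp y * h (s0 * exp y) = s0 powr (1 - p) * exp ((1 - p) * y) * exp (- z * cosh y)"
      using s0 e by (simp add: h_def ek_def mult_ac)
    then show ?thesis using s0 by (simp add: F_def abs_mult mult_ac)
  qed
  have hs: "set_integrable lborel {0<..} h"
    unfolding set_integrable_def by (rule integrable_mult_indicator[OF _ hi]) simp
  have ha: "h absolutely_integrable_on {0<..}"
    unfolding set_integrable_def by (subst integrable_completion) (use hs in \<open>auto simp: set_integrable_def\<close>)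
  have "(\<lambda>y. \<bar>s0 * exp y\<bar> * h (s0 * exp y)) absolutely_integrable_on UNIV \<and>
      integral UNIV (\<lambda>y. \<bar>s0 * exp y\<bar> * h (s0 * exp y)) = integral {0<..} h"
  proof (subst has_absolute_integral_change_of_variables_1'[where S=UNIV and g="\<lambda>y. s0 * exp y" and f=h])
    show "((\<lambda>y. s0 * exp y) has_real_derivative s0 * exp y) (at y within UNIV)" for y
      by (auto intro!: derivative_eq_intros)
    show "inj (\<lambda>y. s0 * exp y)" using s0 by (intro injI) simp
  qed (use ha in \<open>auto simp: range\<close>)
  then have Fa: "(\<lambda>y. s0 powr (1 - p) * F y) absolutely_integrable_on UNIV"
    and Fh: "integral UNIV (\<lambda>y. s0 powr (1 - p) * F y) = integral {0<..} h" unfolding sub by blast+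
  have K: "s0 powr (1 - p) > 0" using s0 by simp
  have KFi: "integrable lborel (\<lambda>y. s0 powr (1 - p) * F y)"
    using Fa unfolding set_integrable_def by (subst (asm) integrable_completion) auto
  then have Fi: "integrable lborel F" using K by simp
  have Frev: "integrable lborel (\<lambda>y. F (- y))" "(LINT y|lborel. F (- y)) = (LINT y|lborel. F y)"
    using lborel_integrable_real_affine_iff[of "-1" F 0] lborel_integral_real_affine[of "-1" F 0] Fi by auto
  \<comment> \<open>\<open>G\<close> is the even part of \<open>F\<close>; the odd part integrates
    to 0, and evenness turns the whole line into twice the half-line of
    \<open>bessel_K\<close>.\<close>
  have FG: "G y = (F y + F (- y)) / 2" for y
  proof -
    have "cosh ((p - 1) * y) = (exp ((1 - p) * y) + exp ((1 - p) * - y)) / 2"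
      by (simp add: cosh_def algebra_simps)
    then show ?thesis by (simp only: F_def G_def cosh_minus) (simp only: distrib_left add_divide_distrib times_divide_eq_right)
  qed
  have Gi: "integrable lborel G" and GF: "(LINT y|lborel. G y) = (LINT y|lborel. F y)"
    using Fi Frev by (auto simp: FG[abs_def])
  have "has_bochner_integral lborel (\<lambda>y. indicator {0..} y *\<^sub>R G y) (bessel_K (p - 1) z)"
    unfolding has_bochner_integral_iff bessel_K_def set_lebesgue_integral_def
    using integrable_mult_indicator[of "{0..}" lborel G] Gi by (auto simp: G_def)
  then have "has_bochner_integral lborel G (2 *\<^sub>R bessel_K (p - 1) z)"
    by (rule has_bochner_integral_even_function) (simp add: G_def)
  then have G: "(LINT y|lborel. G y) = 2 * bessel_K (p - 1) z" by (simp add: has_bochner_integral_iff)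
  have "(LINT s|lborel. h s) = (LINT s:{0<..}|lborel. h s)"
    unfolding set_lebesgue_integral_def by (intro Bochner_Integration.integral_cong) (auto simp: indicator_def h_def)
  also have "\<dots> = integral {0<..} h" by (rule set_borel_integral_eq_integral(2)[OF hs])
  also have "\<dots> = (LINT y|lborel. s0 powr (1 - p) * F y)" unfolding Fh[symmetric] by (rule integral_lborel[OF KFi])
  also have "\<dots> = s0 powr (1 - p) * (2 * bessel_K (p - 1) z)" by (simp add: GF[symmetric] G)
  finally show ?thesis by (simp add: h_def s0_def z_def)
qed

text \<open>With \<open>b = (norm x)\<^sup>2 / 4\<close> and \<open>l = a\<^sup>2\<close> the Bessel
  argument \<open>2 * sqrt (b * l)\<close> is \<open>a * norm x\<close>, and its index
  \<open>p - 1\<close> is half of the dimension minus 2. At \<open>x = 0\<close> both sides are 0 by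
  convention.\<close>

lemma gauss_mix_exp_law:
  fixes x :: "real ^ 'n"
  assumes lam: "(\<Sum>j=1..m. lam j) > 0" and c: "c > 0"
  shows "gauss_mix (exp_law ((\<Sum>j=1..m. lam j) / c\<^sup>2)) x = limit_density m lam c x"
proof (cases "x = 0")
  case False
  define \<Lambda> where "\<Lambda> = (\<Sum>j=1..m. lam j)"
  define l where "l = \<Lambda> / c\<^sup>2"
  define p where "p = real CARD('n) / 2"
  define a where "a = sqrt \<Lambda> / c"
  have \<Lambda>: "\<Lambda> > 0" using lam by (simp add: \<Lambda>_def)
  have a: "a > 0" and la: "l = a\<^sup>2" and l: "l > 0" using \<Lambda> c by (auto simp: a_def l_def power_divide)
  have nx: "norm x > 0" using False by simp
  have "(LINT s|exp_law l. gauss s x) = (LINT s|lborel. exponential_density l s *\<^sub>R gauss s x)"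
    by (rule integral_density) (use l in \<open>auto intro!: AE_I2 exponential_density_nonneg\<close>)
  also have "\<dots> = (LINT s|lborel. l * (4 * pi) powr (- p) * (exp (- (l * s)) * ek p ((norm x)\<^sup>2 / 4) s))"
    by (intro Bochner_Integration.integral_cong) (auto simp: gauss_eq_ek p_def exponential_density_def mult_ac)
  also have "\<dots> = l * (4 * pi) powr (- p) * (2 * sqrt ((norm x)\<^sup>2 / 4 / l) powr (1 - p) * bessel_K (p - 1) (2 * sqrt ((norm x)\<^sup>2 / 4 * l)))"
    using l nx by (subst integral_mult_right_zero, subst integral_ek_exp_eq_bessel_K) (auto simp: p_def)
  also have "sqrt ((norm x)\<^sup>2 / 4 / l) = norm x / (2 * a)"
    using a by (intro real_sqrt_unique) (auto simp: la power_divide power_mult_distrib)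
  also have "2 * sqrt ((norm x)\<^sup>2 / 4 * l) = a * norm x"
    using a by (simp add: la real_sqrt_mult real_sqrt_divide)
  also have "l * (4 * pi) powr (- p) * (2 * (norm x / (2 * a)) powr (1 - p) * bessel_K (p - 1) (a * norm x)) =
     (1 / (2 * pi) powr p * a powr (p + 1) * norm x powr (1 - p)) * bessel_K (p - 1) (a * norm x)"
  proof -
    have "(4 * pi) powr (- p) = 2 powr (- p) * (2 * pi) powr (- p)"
      using powr_mult[of 2 "2 * pi" "- p"] by simp
    moreover have "(norm x / (2 * a)) powr (1 - p) = norm x powr (1 - p) * 2 powr (p - 1) * a powr (p - 1)"
      using nx a by (simp add: powr_divide powr_mult powr_diff field_simps)
    moreover have "2 powr (p - 1) = 2 powr p / (2::real)" "a powr (p + 1) = a\<^sup>2 * a powr (p - 1)"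
      using a by (simp_all add: powr_diff powr_add power2_eq_square)
    ultimately show ?thesis by (simp add: la powr_minus field_simps)
  qed
  finally have "(LINT s|exp_law l. gauss s x) = \<dots>" .
  moreover have "limit_density m lam c x = (1 / (2 * pi) powr p * a powr (p + 1) * norm x powr (1 - p)) * bessel_K (p - 1) (a * norm x)"
    by (simp add: limit_density_def Let_def p_def a_def \<Lambda>_def add_divide_distrib diff_divide_distrib)
  ultimately show ?thesis using False by (simp add: gauss_mix_def l_def \<Lambda>_def)
qed (simp add: gauss_mix_def limit_density_def Let_def)

text \<open>The second derivative of the Gauss kernel in \<open>s\<close>, left in the form that
  \<open>ek_has_derivative\<close> produces from the two terms of \<open>dgauss\<close>.\<close>

definition d2gauss :: "'b::euclidean_space \<Rightarrow> real \<Rightarrow> real" where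
  "d2gauss x s = (let p = real DIM('b) / 2; b = (norm x)\<^sup>2 / 4 in (4 * pi) powr (- p) *
     (b * (b * ek (p + 2 + 2) b s - (p + 2) * ek (p + 2 + 1) b s) - p * (b * ek (p + 1 + 2) b s - (p + 1) * ek (p + 1 + 1) b s)))"

lemma heat_time_derivatives:
  fixes x :: "'b::euclidean_space"
  assumes x: "x \<noteq> 0"
  shows "(dgauss x has_real_derivative d2gauss x s) (at s)"
    and "isCont (d2gauss x) s" and "isCont (dgauss x) s"
    and "s \<le> 0 \<Longrightarrow> gauss s x = 0" and "s \<le> 0 \<Longrightarrow> dgauss x s = 0" and "s \<le> 0 \<Longrightarrow> d2gauss x s = 0"
    and "q \<ge> 0 \<Longrightarrow> integrable lborel (\<lambda>s. dgauss x s * s powr (- q))"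
    and "integrable lborel (dgauss x)" and "integrable lborel (d2gauss x)"
    and "(dgauss x \<longlongrightarrow> 0) at_top"
    and "\<exists>C. \<forall>s. \<bar>gauss s x\<bar> \<le> C" and "\<exists>C. \<forall>s. \<bar>dgauss x s\<bar> \<le> C"
proof -
  define p where "p = real DIM('b) / 2"
  define b where "b = (norm x)\<^sup>2 / 4"
  define A where "A = (4 * pi) powr (- p)"
  have p: "p > 0" and b: "b > 0" using x by (auto simp: p_def b_def)
  have g: "gauss s x = A * ek p b s" for s by (simp add: gauss_eq_ek p_def b_def A_def)
  have g1: "dgauss x = (\<lambda>s. A * (b * ek (p + 2) b s - p * ek (p + 1) b s))"
    by (simp add: dgauss_def[abs_def] p_def b_def A_def)
  have g2: "d2gauss x = (\<lambda>s. A * (b * (b * ek (p + 2 + 2) b s - (p + 2) * ek (p + 2 + 1) b s) - p * (b * ek (p + 1 + 2) b s - (p + 1) * ek (p + 1 + 1) b s)))"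
    by (simp add: d2gauss_def[abs_def] p_def b_def A_def Let_def)
  show "(dgauss x has_real_derivative d2gauss x s) (at s)"
    unfolding g1 g2 by (intro DERIV_cmult DERIV_diff ek_has_derivative b)
  show c2: "isCont (d2gauss x) s" and "isCont (dgauss x) s" for s
    unfolding g1 g2 by (intro isCont_mult isCont_diff continuous_const ek_continuous b)+
  show "gauss s x = 0" "dgauss x s = 0" "d2gauss x s = 0" if "s \<le> 0" for s
    unfolding g g1 g2 using that by simp_all
  have int: "integrable lborel (\<lambda>s. A * (b * ek (p + 2 + q) b s - p * ek (p + 1 + q) b s))" if "q \<ge> 0" for q
    using p b that by (intro integrable_mult_right Bochner_Integration.integrable_diff ek_integrable) auto
  show "integrable lborel (\<lambda>s. dgauss x s * s powr (- q))" if "q \<ge> 0"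
  proof -
    have "dgauss x s * s powr (- q) = A * (b * ek (p + 2 + q) b s - p * ek (p + 1 + q) b s)" for s
      unfolding g1 ek_mult_powr[symmetric] by (simp add: algebra_simps)
    then show ?thesis using int[OF that] by (simp only:)
  qed
  show "integrable lborel (dgauss x)" using int[of 0] unfolding g1 by simp
  show "integrable lborel (d2gauss x)"
    unfolding g2 using p b by (intro integrable_mult_right Bochner_Integration.integrable_diff ek_integrable) auto
  have "((\<lambda>s. A * (b * ek (p + 2) b s - p * ek (p + 1) b s)) \<longlongrightarrow> A * (b * 0 - p * 0)) at_top"
    using p by (intro tendsto_mult tendsto_diff tendsto_const ek_tendsto_at_top) auto
  then show "(dgauss x \<longlongrightarrow> 0) at_top" by (simp add: g1)
  obtain C where C: "C \<ge> 0" "\<And>s. ek p b s \<le> C" using ek_bounded[OF b, of p] p by auto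
  obtain C1 where C1: "C1 \<ge> 0" "\<And>s. ek (p + 1) b s \<le> C1" using ek_bounded[OF b, of "p + 1"] p by auto
  obtain C2 where C2: "C2 \<ge> 0" "\<And>s. ek (p + 2) b s \<le> C2" using ek_bounded[OF b, of "p + 2"] p by auto
  have A: "A > 0" by (simp add: A_def)
  show "\<exists>C. \<forall>s. \<bar>gauss s x\<bar> \<le> C"
    unfolding g using C A by (intro exI[of _ "A * C"]) (simp add: abs_mult)
  have "\<bar>b * ek (p + 2) b s - p * ek (p + 1) b s\<bar> \<le> b * C2 + p * C1" for s
  proof -
    have "b * ek (p + 2) b s \<le> b * C2" "p * ek (p + 1) b s \<le> p * C1" using C1 C2 b p by (auto intro: mult_left_mono)
    moreover have "0 \<le> b * ek (p + 2) b s" "0 \<le> p * ek (p + 1) b s" "0 \<le> b * C2" "0 \<le> p * C1" using C1 C2 b p by auto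
    ultimately show ?thesis by linarith
  qed
  then show "\<exists>C. \<forall>s. \<bar>dgauss x s\<bar> \<le> C"
    unfolding g1 using A by (intro exI[of _ "A * (b * C2 + p * C1)"]) (simp add: abs_mult)
qed

section \<open>The fractional equation for the clock and its limit\<close>

context time_changed_bm
begin

definition kappa :: real where "kappa = Min ((\<lambda>j. cos (pi * \<nu> j / 2)) ` {1..m})"

lemma kappa_pos: "kappa > 0"
proof -
  have "cos (pi * \<nu> j / 2) > 0" if "j \<in> {1..m}" for j
    using \<nu>[OF that] by (intro cos_gt_zero_pi) (auto simp: field_simps intro: less_trans[of _ 0])
  then show ?thesis using m by (auto simp: kappa_def)
qed

text \<open>The powers \<open>\<nu> j ^ r\<close> are at most \<open>\<nu> j\<close> and the cosine
  decreases, so the minimum taken at \<open>r = 1\<close> bounds all later cosines.\<close>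

lemma kappa_le:
  assumes r: "r \<ge> 1" and j: "j \<in> {1..m}"
  shows "kappa \<le> cos (pi * \<nu> j ^ r / 2)"
proof -
  have "\<nu> j ^ r \<le> \<nu> j ^ 1" using \<nu>[OF j] r by (intro power_decreasing) auto
  then have "cos (pi * \<nu> j / 2) \<le> cos (pi * \<nu> j ^ r / 2)"
    using \<nu>[OF j] by (intro cos_monotone_0_pi_le) (auto simp: field_simps)
  moreover have "kappa \<le> cos (pi * \<nu> j / 2)" unfolding kappa_def using j by (intro Min_le) auto
  ultimately show ?thesis by linarith
qed

lemma order_power:
  assumes "r \<ge> 1" "j \<in> {1..m}"
  shows "0 < \<nu> j ^ r" "\<nu> j ^ r < 1"
  using \<nu>[OF assms(2)] assms(1) by (auto intro: power_Suc_less_one simp: power_less_one_iff)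

text \<open>The weights are \<open>lam j / c\<^sup>2\<close> because \<open>eta\<close> runs at time
  \<open>s / c\<^sup>2\<close>; multiplying by \<open>c\<^sup>2\<close> at the end restores the
  coefficients of the equation.\<close>

lemma inverse_average_clock:
  fixes x :: "real ^ 'n"
  assumes r: "r \<ge> 1" and x: "x \<noteq> 0"
  shows "inverse_average m (\<lambda>j. lam j / c\<^sup>2) (\<lambda>j. \<nu> j ^ r) (eta r) kappa (clock_law r) (\<lambda>s. gauss s x) (dgauss x) (d2gauss x)"
proof (intro inverse_average.intro subordinator_laws.intro inverse_average_axioms.intro)
  fix j assume j: "j \<in> {1..m}"
  show "0 < lam j / c\<^sup>2" using lam[OF j] c by simp
  show "0 < \<nu> j ^ r \<and> \<nu> j ^ r < 1" using order_power[OF r j] by simp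
  show "kappa \<le> cos (pi * \<nu> j ^ r / 2)" by (rule kappa_le[OF r j])
next
  fix s \<mu> :: real assume "s > 0" "\<mu> > 0"
  then show "(LINT x|eta r s. exp (- \<mu> * x)) = exp (- s * (\<Sum>j=1..m. lam j / c\<^sup>2 * \<mu> powr (\<nu> j ^ r)))"
    by (subst eta_props(4)) (simp_all add: Phi_def sum_divide_distrib)
next
  fix t s :: real assume "t > 0" "s > 0"
  then show "measure (clock_law r t) {s<..} = measure (eta r s) {..<t}"
    using clock_law_props(3)[OF r] by simp
qed (use m kappa_pos eta_props(1,2,3)[OF less_imp_le] clock_law_props(1,2)[OF r] gauss_has_derivative[OF x] heat_time_derivatives[OF x] in auto)

definition sol :: "nat \<Rightarrow> real ^ 'n \<Rightarrow> real \<Rightarrow> real" where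
  "sol r x t = gauss_mix (clock_law r t) x"

lemma sol_eq: "r \<ge> 1 \<Longrightarrow> x \<noteq> 0 \<Longrightarrow> sol r x = inverse_average.u (clock_law r) (\<lambda>s. gauss s x)" for x :: "real ^ 'n"
  by (rule ext) (simp add: sol_def gauss_mix_def inverse_average.u_def[OF inverse_average_clock])

lemma gauss_average_bounded_continuous:
  fixes f :: "real ^ 'n \<Rightarrow> real"
  assumes f: "continuous_on UNIV f \<and> bounded (range f)"
  obtains K where "f \<in> borel_measurable borel" "\<And>x. norm (f x) \<le> K"
    "\<And>s. isCont (\<lambda>s. LINT z|lborel. gauss 1 z * f (sqrt s *\<^sub>R z)) s"
    "\<And>s. \<bar>LINT z|lborel. gauss 1 z * f (sqrt s *\<^sub>R z)\<bar> \<le> K"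
proof -
  obtain K where K: "\<And>x. norm (f x) \<le> K" using f by (auto simp: bounded_iff)
  have c: "continuous_on UNIV f" using f by blast
  show ?thesis
    by (rule that[OF borel_measurable_continuous_onI[OF c] K continuous_gauss_average(1)[OF c K] continuous_gauss_average(2)[OF c K, unfolded real_norm_def]])
qed

text \<open>For the exponential law the density is the rate times the tail, so integration against
  tails turns the average of the derivative into the rate times the average of the kernel.\<close>

lemma exp_law_average_dgauss:
  fixes x :: "real ^ 'n"
  assumes x: "x \<noteq> 0"
  shows "(LINT s|exp_law limit_rate. dgauss x s) = limit_rate * (LINT s|exp_law limit_rate. gauss s x)"
proof -
  note h = heat_time_derivatives[OF x]
  note p = exp_law_props[OF limit_rate_pos]
  have "(LINT s|exp_law limit_rate. dgauss x s) = (LINT s|lborel. exponential_density limit_rate s *\<^sub>R dgauss x s)"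
    using borel_measurable_integrable[OF h(8)] limit_rate_pos by (intro integral_density) (auto intro!: AE_I2 exponential_density_nonneg)
  also have "\<dots> = (LINT s|lborel. limit_rate * (dgauss x s * measure (exp_law limit_rate) {s<..}))"
  proof (intro Bochner_Integration.integral_cong refl)
    fix s :: real
    show "exponential_density limit_rate s *\<^sub>R dgauss x s = limit_rate * (dgauss x s * measure (exp_law limit_rate) {s<..})"
      using p(4)[of s] h(5)[of s] by (cases "s \<ge> 0") (auto simp: exponential_density_def)
  qed
  also have "\<dots> = limit_rate * (LINT s|exp_law limit_rate. gauss s x)"
    using integral_by_tail(2)[OF p(1,2) gauss_has_derivative[OF x] h(3) h(4,5,8)] by simp
  finally show ?thesis .
qed

theorem limit_law:
  assumes t: "t > 0"
  shows "converges_in_law (\<lambda>r. distr M borel (\<lambda>\<omega>. B (c\<^sup>2 * L r t \<omega>) \<omega>))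
    (density lborel (\<lambda>x. ennreal (gauss_mix (exp_law limit_rate) x))) sequentially"
  unfolding converges_in_law_def
proof safe
  fix f :: "real ^ 'n \<Rightarrow> real" assume "continuous_on UNIV f" "bounded (range f)"
  then obtain K where K: "f \<in> borel_measurable borel" "\<And>x. norm (f x) \<le> K"
    "\<And>s. isCont (\<lambda>s. LINT z|lborel. gauss 1 z * f (sqrt s *\<^sub>R z)) s"
    "\<And>s. \<bar>LINT z|lborel. gauss 1 z * f (sqrt s *\<^sub>R z)\<bar> \<le> K"
    using gauss_average_bounded_continuous[of f] by blast
  have e: "\<forall>\<^sub>F r in sequentially. (LINT x|distr M borel (\<lambda>\<omega>. B (c\<^sup>2 * L r t \<omega>) \<omega>). f x) =
      (LINT s|clock_law r t. LINT z|lborel. gauss 1 z * f (sqrt s *\<^sub>R z))"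
    using eventually_ge_at_top[of 1]
    by eventually_elim (simp only: B_at_clock_law[OF _ t] integral_density_gauss_mix[OF clock_law_props(1,2,4)[OF _ t] K(1,2)])
  show "(\<lambda>r. LINT x|distr M borel (\<lambda>\<omega>. B (c\<^sup>2 * L r t \<omega>) \<omega>). f x) \<longlonglongrightarrow>
      (LINT x|density lborel (\<lambda>x. ennreal (gauss_mix (exp_law limit_rate) x)). f x)"
    unfolding integral_density_gauss_mix[OF exp_law_props(1,2,3)[OF limit_rate_pos] K(1,2)] tendsto_cong[OF e]
    by (rule clock_law_tendsto[OF t K(3,4)])
qed

theorem sol_solves:
  assumes r: "r \<ge> 1"
  shows "solves_fractional_cauchy m lam (\<lambda>j. \<nu> j ^ r) c (sol r)"
  unfolding solves_fractional_cauchy_def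
proof (intro conjI allI impI ballI; (elim conjE)?)
  fix x :: "real ^ 'n" and t :: real assume x: "x \<noteq> 0" and t: "t > 0"
  interpret I: inverse_average m "\<lambda>j. lam j / c\<^sup>2" "\<lambda>j. \<nu> j ^ r" "eta r" kappa "clock_law r" "\<lambda>s. gauss s x" "dgauss x" "d2gauss x"
    by (rule inverse_average_clock[OF r x])
  have u: "sol r x = I.u" by (rule sol_eq[OF r x])
  show "caputo_differentiable (\<nu> j ^ r) (sol r x) t" if "j \<in> {1..m}" for j
    unfolding u by (rule I.caputo_u(1)[OF order_power(2)[OF r that] t])
  note g = gauss_mix_second_partials[OF clock_law_props(1,2)[OF r t] x]
  show "has_second_partials (\<lambda>y. sol r y t) x" unfolding sol_def by (rule g(1))
  have "(\<Sum>j=1..m. lam j * caputo_deriv (\<nu> j ^ r) (sol r x) t) = c\<^sup>2 * (\<Sum>j=1..m. lam j / c\<^sup>2 * caputo_deriv (\<nu> j ^ r) I.u t)"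
    unfolding u sum_distrib_left using c by (intro sum.cong) auto
  also have "\<dots> = c\<^sup>2 * laplacian (\<lambda>y. sol r y t) x"
    unfolding I.caputo_equation[OF t] sol_def g(2) ..
  finally show "(\<Sum>j=1..m. lam j * caputo_deriv (\<nu> j ^ r) (sol r x) t) = c\<^sup>2 * laplacian (\<lambda>y. sol r y t) x" .
next
  show "converges_in_law (\<lambda>t. density lborel (\<lambda>x. ennreal (sol r x t))) (return borel 0) (at_right 0)"
    unfolding converges_in_law_def
  proof safe
    fix f :: "real ^ 'n \<Rightarrow> real" assume "continuous_on UNIV f" "bounded (range f)"
    then obtain K where K: "f \<in> borel_measurable borel" "\<And>x. norm (f x) \<le> K"
      "\<And>s. isCont (\<lambda>s. LINT z|lborel. gauss 1 z * f (sqrt s *\<^sub>R z)) s"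
      "\<And>s. \<bar>LINT z|lborel. gauss 1 z * f (sqrt s *\<^sub>R z)\<bar> \<le> K"
      using gauss_average_bounded_continuous[of f] by blast
    have e: "\<forall>\<^sub>F t in at_right 0. (LINT x|density lborel (\<lambda>x. ennreal (sol r x t)). f x) =
        (LINT s|clock_law r t. LINT z|lborel. gauss 1 z * f (sqrt s *\<^sub>R z))"
      using eventually_at_right_less[of "0::real"]
      by eventually_elim (simp only: sol_def integral_density_gauss_mix[OF clock_law_props(1,2,4)[OF r] K(1,2)])
    \<comment> \<open>At clock value 0 the Gaussian average is evaluation at the origin, so
      concentration of the clock at 0 gives the Dirac measure.\<close>
    have "(LINT z|lborel. gauss 1 z * f (sqrt 0 *\<^sub>R z)) = f 0"
      using integral_gauss[of 1, where 'b="real ^ 'n"] by simp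
    then have "(LINT z|lborel. gauss 1 z * f (sqrt 0 *\<^sub>R z)) = (LINT x|return borel 0. f x)"
      using K(1) by (simp add: integral_return)
    then show "((\<lambda>t. LINT x|density lborel (\<lambda>x. ennreal (sol r x t)). f x) \<longlongrightarrow> (LINT x|return borel 0. f x)) (at_right 0)"
      unfolding tendsto_cong[OF e] using clock_law_origin[OF r K(3,4)] by simp
  qed
next
  fix x :: "real ^ 'n" assume x: "x \<noteq> 0"
  note h = heat_time_derivatives[OF x]
  obtain C where C: "\<And>s. \<bar>gauss s x\<bar> \<le> C" using h(11) by blast
  \<comment> \<open>Off the origin the kernel at clock value 0 is 0, and it is continuous there, so
    the density itself tends to 0.\<close>
  have "((\<lambda>t. LINT s|clock_law r t. gauss s x) \<longlongrightarrow> gauss 0 x) (at_right 0)"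
    by (rule clock_law_origin[OF r DERIV_isCont[OF gauss_has_derivative[OF x]] C])
  then show "(sol r x \<longlongrightarrow> 0) (at_right 0)" using x h(4)[of 0] by (simp add: sol_def[abs_def] gauss_mix_def)
qed

text \<open>All three limits come from the convergence of the clock law: tested with the kernel for
  the solution, with \<open>dgauss\<close> for its Laplacian. The Caputo derivatives of each order
  inherit the limit of the solution, as their orders tend to 0 and the initial value off the origin
  is 0.\<close>

theorem sol_limits:
  fixes x :: "real ^ 'n"
  assumes x: "x \<noteq> 0" and t: "t > 0"
  shows "(\<lambda>r. sol r x t) \<longlonglongrightarrow> gauss_mix (exp_law limit_rate) x"
    and "j \<in> {1..m} \<Longrightarrow> (\<lambda>r. caputo_deriv (\<nu> j ^ r) (sol r x) t) \<longlonglongrightarrow> gauss_mix (exp_law limit_rate) x"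
    and "(\<lambda>r. laplacian (\<lambda>y. sol r y t) x) \<longlonglongrightarrow> laplacian (gauss_mix (exp_law limit_rate)) x"
proof -
  note h = heat_time_derivatives[OF x]
  obtain C where C: "\<And>s. \<bar>gauss s x\<bar> \<le> C" using h(11) by blast
  obtain C' where C': "\<And>s. \<bar>dgauss x s\<bar> \<le> C'" using h(12) by blast
  show u: "(\<lambda>r. sol r x t) \<longlonglongrightarrow> gauss_mix (exp_law limit_rate) x"
    using clock_law_tendsto[OF t DERIV_isCont[OF gauss_has_derivative[OF x]] C] x by (simp add: sol_def gauss_mix_def)
  have e: "\<forall>\<^sub>F r in sequentially. laplacian (\<lambda>y. sol r y t) x = (LINT s|clock_law r t. dgauss x s)"
    using eventually_ge_at_top[of 1]
    by eventually_elim (unfold sol_def, rule gauss_mix_second_partials(2)[OF clock_law_props(1,2)[OF _ t] x])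
  show "(\<lambda>r. laplacian (\<lambda>y. sol r y t) x) \<longlonglongrightarrow> laplacian (gauss_mix (exp_law limit_rate)) x"
    unfolding tendsto_cong[OF e] gauss_mix_second_partials(2)[OF exp_law_props(1,2)[OF limit_rate_pos] x]
    by (rule clock_law_tendsto[OF t h(3) C'])
  assume j: "j \<in> {1..m}"
  \<comment> \<open>Stated for \<open>Suc r\<close>, since at \<open>r = 0\<close> the order would
    be 1, which is outside the range of the locale.\<close>
  have I: "inverse_average m (\<lambda>j. lam j / c\<^sup>2) (\<lambda>j. \<nu> j ^ Suc r) (eta (Suc r)) kappa (clock_law (Suc r)) (\<lambda>s. gauss s x) (dgauss x) (d2gauss x)" for r
    by (rule inverse_average_clock[OF _ x]) simp
  have S: "Suc r \<ge> 1" for r by simp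
  define v where "v r = inverse_average.v m (\<lambda>j. lam j / c\<^sup>2) (\<lambda>j. \<nu> j ^ Suc r) (dgauss x)" for r
  have u': "sol (Suc r) x t = (LINT \<tau>|lborel. indicator {0<..<t} \<tau> * v r \<tau>)" for r
    unfolding v_def sol_eq[OF S x] by (rule inverse_average.u_eq_open[OF I t])
  have "(\<lambda>r. 1 / Gamma (1 - \<nu> j ^ Suc r) * (LINT \<tau>|lborel. indicator {0<..<t} \<tau> * (v r \<tau> * (t - \<tau>) powr (- (\<nu> j ^ Suc r))))) \<longlonglongrightarrow> gauss_mix (exp_law limit_rate) x"
  proof (rule caputo_limit[OF t])
    fix r
    show "v r \<in> borel_measurable borel" unfolding v_def by (rule inverse_average.v_measurable[OF I])
    show "integrable lborel (\<lambda>\<tau>. indicator {0<..<t} \<tau> * v r \<tau>)"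
      unfolding v_def by (rule inverse_average.Fubini_g1_dens(1)[OF I]) auto
    show "integrable lborel (\<lambda>\<tau>. indicator {0<..<t} \<tau> * (v r \<tau> * (t - \<tau>) powr (- (\<nu> j ^ Suc r))))"
      unfolding v_def by (rule inverse_average.int_caputo[OF I order_power(2)[OF _ j] t]) simp
    show "\<bar>v r \<tau>\<bar> \<le> (2 + 1 / kappa) * (LINT s|lborel. \<bar>dgauss x s\<bar>) / \<tau>" if "\<tau> > 0" for \<tau>
      unfolding v_def by (rule inverse_average.v_le_inverse[OF I that])
    show "0 < \<nu> j ^ Suc r" "\<nu> j ^ Suc r < 1" using order_power[OF _ j, of "Suc r"] by simp_all
  next
    show "(\<lambda>r. LINT \<tau>|lborel. indicator {0<..<t} \<tau> * v r \<tau>) \<longlonglongrightarrow> gauss_mix (exp_law limit_rate) x"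
      unfolding u'[symmetric] by (rule LIMSEQ_Suc[OF u])
    show "(\<lambda>r. \<nu> j ^ Suc r) \<longlonglongrightarrow> 0" using \<nu>[OF j] by (intro LIMSEQ_Suc LIMSEQ_power_zero) auto
  qed
  moreover have "caputo_deriv (\<nu> j ^ Suc r) (sol (Suc r) x) t =
     1 / Gamma (1 - \<nu> j ^ Suc r) * (LINT \<tau>|lborel. indicator {0<..<t} \<tau> * (v r \<tau> * (t - \<tau>) powr (- (\<nu> j ^ Suc r))))" for r
    unfolding v_def sol_eq[OF S x] by (rule inverse_average.caputo_u(2)[OF I order_power(2)[OF _ j] t]) simp
  ultimately have "(\<lambda>r. caputo_deriv (\<nu> j ^ Suc r) (sol (Suc r) x) t) \<longlonglongrightarrow> gauss_mix (exp_law limit_rate) x" by (simp only:)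
  then show "(\<lambda>r. caputo_deriv (\<nu> j ^ r) (sol r x) t) \<longlonglongrightarrow> gauss_mix (exp_law limit_rate) x"
    by (rule LIMSEQ_imp_Suc)
qed

lemma limit_density_eq: "gauss_mix (exp_law limit_rate) = (limit_density m lam c :: real ^ 'n \<Rightarrow> real)"
proof
  have "(\<Sum>j=1..m. lam j) > 0" using m lam by (intro sum_pos) auto
  from gauss_mix_exp_law[OF this c] show "gauss_mix (exp_law limit_rate) x = limit_density m lam c x" for x :: "real ^ 'n"
    by (simp add: limit_rate_def)
qed

text \<open>The Laplacian of the mixture is the average of \<open>dgauss\<close> under the
  exponential law, that is \<open>limit_rate\<close> times the mixture, and
  \<open>c\<^sup>2 * limit_rate\<close> is the sum of the \<open>lam j\<close>.\<close>

lemma limit_density_elliptic: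
  fixes x :: "real ^ 'n"
  assumes x: "x \<noteq> 0"
  shows "has_second_partials (limit_density m lam c) x"
    and "(\<Sum>j=1..m. lam j) * limit_density m lam c x = c\<^sup>2 * laplacian (limit_density m lam c) x"
proof -
  note g = gauss_mix_second_partials[OF exp_law_props(1,2)[OF limit_rate_pos] x]
  show "has_second_partials (limit_density m lam c) x" using g(1) by (simp only: limit_density_eq)
  have "c\<^sup>2 * laplacian (limit_density m lam c) x = c\<^sup>2 * (limit_rate * gauss_mix (exp_law limit_rate) x)"
    unfolding limit_density_eq[symmetric] g(2) exp_law_average_dgauss[OF x] using x by (simp add: gauss_mix_def)
  then show "(\<Sum>j=1..m. lam j) * limit_density m lam c x = c\<^sup>2 * laplacian (limit_density m lam c) x"
    using c by (simp add: limit_rate_def[symmetric] limit_density_eq[symmetric]) (simp add: limit_rate_def)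
qed

end

theorem theorem3p3:
  fixes M :: "'a measure"
    and m :: nat
    and \<nu> lam :: "nat \<Rightarrow> real"
    and c :: real
    and H :: "nat \<Rightarrow> nat \<Rightarrow> real \<Rightarrow> 'a \<Rightarrow> real"
    and B :: "real \<Rightarrow> 'a \<Rightarrow> real ^ 'n"
    and L :: "nat \<Rightarrow> real \<Rightarrow> 'a \<Rightarrow> real"
    and w :: "real ^ 'n \<Rightarrow> real"
  assumes "prob_space M"
    and "m \<ge> 1"
    and "\<And>j. j \<in> {1..m} \<Longrightarrow> 0 < \<nu> j \<and> \<nu> j < 1"
    and "\<And>j. j \<in> {1..m} \<Longrightarrow> lam j > 0"
    and "c > 0"
    and "\<And>k j. k \<ge> 1 \<Longrightarrow> j \<in> {1..m} \<Longrightarrow> stable_subordinator M (\<nu> j) (H k j)"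
    and "prob_space.indep_vars M (\<lambda>_. PiM {0..} (\<lambda>_. borel))
           (\<lambda>(k, j) \<omega>. \<lambda>s\<in>{0..}. H k j s \<omega>) ({1..} \<times> {1..m})"
    and L_def: "\<And>r. L r = inverse_process (weighted_sum_process m lam \<nu> H r)"
    and "brownian_motion M B"
    and "\<And>r. r \<ge> 1 \<Longrightarrow> independent_processes M {0..} B {0<..} (L r)"
    and w_def: "w = limit_density m lam c"
  shows
    "prob_space (density lborel (\<lambda>x. ennreal (w x))) \<and>
     (\<forall>t>0. converges_in_law (\<lambda>r. distr M borel (\<lambda>\<omega>. B (c\<^sup>2 * L r t \<omega>) \<omega>))
               (density lborel (\<lambda>x. ennreal (w x))) sequentially) \<and>
     (\<forall>x. x \<noteq> 0 \<longrightarrow> has_second_partials w x \<and>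
        (\<Sum>j=1..m. lam j) * w x = c\<^sup>2 * laplacian w x) \<and>
     (\<exists>u :: nat \<Rightarrow> real ^ 'n \<Rightarrow> real \<Rightarrow> real.
        (\<forall>r\<ge>1. \<forall>t>0. (\<forall>x. u r x t \<ge> 0) \<and>
           distributed M lborel (\<lambda>\<omega>. B (c\<^sup>2 * L r t \<omega>) \<omega>) (\<lambda>x. ennreal (u r x t))) \<and>
        (\<forall>r\<ge>1. solves_fractional_cauchy m lam (\<lambda>j. \<nu> j ^ r) c (u r)) \<and>
        (\<forall>x t. x \<noteq> 0 \<and> t > 0 \<longrightarrow>
           (\<lambda>r. u r x t) \<longlonglongrightarrow> w x \<and>
           (\<forall>j\<in>{1..m}. (\<lambda>r. caputo_deriv (\<nu> j ^ r) (u r x) t) \<longlonglongrightarrow> w x) \<and>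
           (\<lambda>r. laplacian (\<lambda>y. u r y t) x) \<longlonglongrightarrow> laplacian w x))"
proof -
  interpret prob_space M by fact
  interpret time_changed_bm M m \<nu> lam H c B L
    by unfold_locales (fact assms)+
  have w: "w = gauss_mix (exp_law limit_rate)" unfolding w_def limit_density_eq ..
  note N = exp_law_props(1,2,3)[OF limit_rate_pos]
  have "prob_space (density lborel (\<lambda>x. ennreal (w x)))" unfolding w by (rule prob_space_gauss_mix[OF N])
  moreover have "\<forall>t>0. converges_in_law (\<lambda>r. distr M borel (\<lambda>\<omega>. B (c\<^sup>2 * L r t \<omega>) \<omega>))
               (density lborel (\<lambda>x. ennreal (w x))) sequentially" unfolding w by (intro allI impI limit_law)
  moreover have "\<forall>x. x \<noteq> 0 \<longrightarrow> has_second_partials w x \<and> (\<Sum>j=1..m. lam j) * w x = c\<^sup>2 * laplacian w x"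
    unfolding w_def by (intro allI impI conjI limit_density_elliptic)
  moreover have "distributed M lborel (\<lambda>\<omega>. B (c\<^sup>2 * L r t \<omega>) \<omega>) (\<lambda>x. ennreal (sol r x t))" if "r \<ge> 1" "t > 0" for r t
    unfolding distributed_def sol_def
    using B_at_clock_law[OF that] B_at_clock_char(1)[OF that] gauss_mix_measurable[OF clock_law_props(1,2)[OF that]]
    by (auto simp: distr_cong[OF refl sets_lborel])
  moreover have "sol r x t \<ge> 0" for r x t by (simp add: sol_def)
  ultimately show ?thesis
    using sol_solves sol_limits unfolding w by (intro conjI exI[of _ sol]) auto
qed

end
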